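(* Let $\{a^{(0)}_{\ell m},b^{(0)}_\ell\}$ be a one-dimensional periodic set of Jacobi parameters, or the almost periodic Jacobi parameters associated with a finite gap spectrum, and let $J_0$ be the associated half-line Jacobi matrix. Then there is a constant $C$ depending only on $J_0$ such that the following holds. Let $J$ be the half-line Jacobi matrix associated with $\{a^{(0)}_{\ell m}+\delta a_{\ell m},\,b^{(0)}_\ell+\delta b_\ell\}$, where $$\sum_{\substack{|\ell-m|=1\\ \ell=1,2,3,\dots}}|\delta a_{\ell m}|+\sum_{\ell=1}^\infty|\delta b_\ell|<\infty,$$ and let $E^-_1<E^-_2<\cdots<\inf\operatorname{spec}(J_0)<\sup\operatorname{spec}(J_0)<\cdots<E^+_2<E^+_1$ be the eigenvalues of $J$ outside the convex hull of $\operatorname{spec}(J_0)$. Then $$\sum_{k,\pm}\operatorname{dist}(E^\pm_k,\sigma(J_0))^{1/2}\le C\Bigl(\sum_{\substack{|\ell-m|=1\\ \ell=1,2,3,\dots}}|\delta a_{\ell m}|+\sum_{\ell=1}^\infty|\delta b_\ell|\Bigr).$$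
   Context: One-dimensional Jacobi parameters are symmetric $a_{\ell m}=a_{m\ell}>0$ for integers with $|\ell-m|=1$ and real $b_\ell$, all bounded. The half-line Jacobi matrix associated with them is the bounded self-adjoint operator on $\ell^2(\{1,2,3,\dots\})$ given by $(J\varphi)_\ell=\sum_{m\ge1,\,|m-\ell|=1}a_{\ell m}\varphi_m+b_\ell\varphi_\ell$. The perturbations $\delta a_{\ell m}$ (real, symmetric), $\delta b_\ell$ (real) satisfy $a^{(0)}_{\ell m}+\delta a_{\ell m}>0$, and all indices in the sums are $\ge1$. Each of the lists $E^-_k$, $E^+_k$ may be empty, finite or infinite. $\sigma(J_0)=\operatorname{spec}(J_0)$. Periodic parameters: $a_{\ell+p,\ell+1+p}=a_{\ell,\ell+1}$ and $b_{\ell+p}=b_\ell$ for some $p\ge1$ and all $\ell$. Almost periodic parameters associated with a finite gap spectrum: let $\mathfrak{e}\subset\mathbb{R}$ be a finite union of disjoint compact intervals of positive length; the parameters are the restrictions to the half-line of those of a two-sided Jacobi matrix $\widetilde J$ on $\ell^2(\mathbb{Z})$ in the isospectral torus of $\mathfrak{e}$, i.e. $\operatorname{spec}(\widetilde J)=\mathfrak{e}$ and $\widetilde J$ is reflectionless on $\mathfrak{e}$: for every $n\in\mathbb{Z}$, the boundary values $\lim_{\varepsilon\downarrow0}\langle\delta_n,(\widetilde J-x-i\varepsilon)^{-1}\delta_n\rangle$ are purely imaginary for a.e. $x\in\mathfrak{e}$ (such parameters are almost periodic). *)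

theory Defs
  imports "HOL-Analysis.Analysis"
begin

section \<open>Operators on square-summable sequences\<close>

text \<open>A vector of \<open>\<ell>\<^sup>2(S)\<close> is a function on the whole index type that vanishes off \<open>S\<close>.\<close>

definition ell2 :: "'i set \<Rightarrow> ('i \<Rightarrow> complex) set" where
  "ell2 S = {\<phi>. (\<forall>i. i \<notin> S \<longrightarrow> \<phi> i = 0) \<and> (\<lambda>i. (cmod (\<phi> i))\<^sup>2) summable_on S}"

definition ell2_norm :: "'i set \<Rightarrow> ('i \<Rightarrow> complex) \<Rightarrow> real" where
  "ell2_norm S \<phi> = sqrt (\<Sum>\<^sub>\<infinity>i\<in>S. (cmod (\<phi> i))\<^sup>2)"

definition ell2_inner :: "'i set \<Rightarrow> ('i \<Rightarrow> complex) \<Rightarrow> ('i \<Rightarrow> complex) \<Rightarrow> complex" where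
  "ell2_inner S \<phi> \<psi> = (\<Sum>\<^sub>\<infinity>i\<in>S. cnj (\<phi> i) * \<psi> i)"

definition unit_seq :: "'i \<Rightarrow> 'i \<Rightarrow> complex" where
  "unit_seq n = (\<lambda>i. if i = n then 1 else 0)"

definition shifted :: "(('i \<Rightarrow> complex) \<Rightarrow> ('i \<Rightarrow> complex)) \<Rightarrow> complex \<Rightarrow> ('i \<Rightarrow> complex) \<Rightarrow> ('i \<Rightarrow> complex)" where
  "shifted T z \<phi> = (\<lambda>i. T \<phi> i - z * \<phi> i)"

definition spectrum :: "'i set \<Rightarrow> (('i \<Rightarrow> complex) \<Rightarrow> ('i \<Rightarrow> complex)) \<Rightarrow> complex set" where
  "spectrum S T = {z. \<not> (bij_betw (shifted T z) (ell2 S) (ell2 S) \<and>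
     (\<exists>K. \<forall>\<phi>\<in>ell2 S. ell2_norm S \<phi> \<le> K * ell2_norm S (shifted T z \<phi>)))}"

definition eigenvalues :: "'i set \<Rightarrow> (('i \<Rightarrow> complex) \<Rightarrow> ('i \<Rightarrow> complex)) \<Rightarrow> complex set" where
  "eigenvalues S T = {z. \<exists>\<phi>\<in>ell2 S. \<phi> \<noteq> (\<lambda>i. 0) \<and> T \<phi> = (\<lambda>i. z * \<phi> i)}"

text \<open>Only meaningful for \<open>z\<close> outside the spectrum.\<close>

definition resolvent :: "'i set \<Rightarrow> (('i \<Rightarrow> complex) \<Rightarrow> ('i \<Rightarrow> complex)) \<Rightarrow> complex \<Rightarrow> ('i \<Rightarrow> complex) \<Rightarrow> ('i \<Rightarrow> complex)" where
  "resolvent S T z = inv_into (ell2 S) (shifted T z)"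

section \<open>Jacobi matrices\<close>

text \<open>Only the entries \<open>a l m\<close> with \<open>\<bar>l - m\<bar> = 1\<close> are parameters; the others are never used.\<close>

definition jacobi_parameters :: "(int \<Rightarrow> int \<Rightarrow> real) \<Rightarrow> (int \<Rightarrow> real) \<Rightarrow> bool" where
  "jacobi_parameters a b \<longleftrightarrow>
     (\<forall>l m. \<bar>l - m\<bar> = 1 \<longrightarrow> a l m = a m l \<and> a l m > 0) \<and>
     (\<exists>M. (\<forall>l m. \<bar>l - m\<bar> = 1 \<longrightarrow> \<bar>a l m\<bar> \<le> M) \<and> (\<forall>l. \<bar>b l\<bar> \<le> M))"

text \<open>The index set \<open>S\<close> is \<open>{1..}\<close> for the half-line matrix and \<open>UNIV\<close> for the two-sided one.\<close>

definition jacobi_op ::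
    "int set \<Rightarrow> (int \<Rightarrow> int \<Rightarrow> real) \<Rightarrow> (int \<Rightarrow> real) \<Rightarrow> (int \<Rightarrow> complex) \<Rightarrow> (int \<Rightarrow> complex)" where
  "jacobi_op S a b \<phi> = (\<lambda>l. if l \<in> S
     then (\<Sum>m | m \<in> S \<and> \<bar>m - l\<bar> = 1. of_real (a l m) * \<phi> m) + of_real (b l) * \<phi> l
     else 0)"

lemma finite_neighbours: "finite {m::int. m \<in> S \<and> \<bar>m - l\<bar> = 1}"
  by (rule finite_subset[of _ "{l - 1, l + 1}"]) auto

definition periodic_jacobi :: "(int \<Rightarrow> int \<Rightarrow> real) \<Rightarrow> (int \<Rightarrow> real) \<Rightarrow> bool" where
  "periodic_jacobi a b \<longleftrightarrow> jacobi_parameters a b \<and>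
     (\<exists>p\<ge>1. \<forall>l. a (l + p) (l + 1 + p) = a l (l + 1) \<and> b (l + p) = b l)"

definition finite_gap_set :: "real set \<Rightarrow> bool" where
  "finite_gap_set \<ee> \<longleftrightarrow> (\<exists>\<I>. finite \<I> \<and> disjoint \<I> \<and>
     (\<forall>I\<in>\<I>. \<exists>\<alpha> \<beta>. \<alpha> < \<beta> \<and> I = {\<alpha>..\<beta>}) \<and> \<ee> = \<Union>\<I>)"

definition reflectionless_on :: "real set \<Rightarrow> (int \<Rightarrow> int \<Rightarrow> real) \<Rightarrow> (int \<Rightarrow> real) \<Rightarrow> bool" where
  "reflectionless_on \<ee> a b \<longleftrightarrow> (\<forall>n. AE x\<in>\<ee> in lborel. \<exists>L. Re L = 0 \<and>
     ((\<lambda>\<epsilon>. ell2_inner UNIV (unit_seq n)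
        (resolvent UNIV (jacobi_op UNIV a b) (Complex x \<epsilon>) (unit_seq n))) \<longlongrightarrow> L) (at_right 0))"

definition in_isospectral_torus :: "real set \<Rightarrow> (int \<Rightarrow> int \<Rightarrow> real) \<Rightarrow> (int \<Rightarrow> real) \<Rightarrow> bool" where
  "in_isospectral_torus \<ee> a b \<longleftrightarrow> jacobi_parameters a b \<and>
     spectrum UNIV (jacobi_op UNIV a b) = complex_of_real ` \<ee> \<and> reflectionless_on \<ee> a b"

definition finite_gap_jacobi :: "(int \<Rightarrow> int \<Rightarrow> real) \<Rightarrow> (int \<Rightarrow> real) \<Rightarrow> bool" where
  "finite_gap_jacobi a b \<longleftrightarrow> (\<exists>\<ee>. finite_gap_set \<ee> \<and> in_isospectral_torus \<ee> a b)"

text \<open>Ordered pairs: each off-diagonal perturbation is counted twice in the sums below.\<close>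

definition half_line_bonds :: "(int \<times> int) set" where
  "half_line_bonds = {(l, m). l \<ge> 1 \<and> m \<ge> 1 \<and> \<bar>l - m\<bar> = 1}"

text \<open>
  The eigenvalues of \<open>J\<close> outside the convex hull of the spectrum of \<open>J\<^sub>0\<close>: the values
  \<open>E\<^sup>-\<^sub>k\<close> and \<open>E\<^sup>+\<^sub>k\<close>, collected in one set. They are real by
  self-adjointness of \<open>J\<close>, which is not imposed here.
\<close>

definition outer_eigenvalues ::
    "((int \<Rightarrow> complex) \<Rightarrow> (int \<Rightarrow> complex)) \<Rightarrow> ((int \<Rightarrow> complex) \<Rightarrow> (int \<Rightarrow> complex)) \<Rightarrow> complex set" where
  "outer_eigenvalues J0 J = eigenvalues {1..} J - convex hull (spectrum {1..} J0)"

end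

theory Submission
  imports Defs "HOL-Complex_Analysis.Complex_Analysis" "HOL-Library.Diagonal_Subsequence"
begin

text \<open>
  Both spectral edges of \<open>J\<^sub>0\<close> carry a regular ground state: a solution \<open>u\<close> of \<open>J\<^sub>0 u = E u\<close>, up to
  alternating signs at the lower edge, lying between two positive constants. Writing \<open>f = u g\<close>, the form
  of \<open>E - J\<^sub>0\<close> dominates \<open>\<Sum>(g (n + 1) - g n)\<^sup>2\<close>, and the perturbation is dominated by a summable
  potential \<open>V\<close>. Cutting the half-line into intervals \<open>I\<close> on which \<open>\<bar>I\<bar> V(I)\<close> is about constant, the
  gradient absorbs \<open>\<Sum>V f\<^sup>2\<close> up to rank-one forms \<open>\<langle>v, f\<rangle>\<^sup>2\<close> with \<open>\<Sum>\<parallel>v\<parallel> \<le> C \<Sum>V\<close>, and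
  \<open>\<Sum>(E\<^sub>k - E) c\<^sub>k\<^sup>2 \<le> \<Sum>\<langle>v, \<Sum>c\<^sub>k \<phi>\<^sub>k\<rangle>\<^sup>2\<close> implies
  \<open>\<Sum>(E\<^sub>k - E)\<^sup>1\<^sup>/\<^sup>2 \<le> \<Sum>\<parallel>v\<parallel>\<close> by Gram--Schmidt orthogonalisation.

  In the periodic case \<open>u\<close> is a Perron eigenvector over one period. In the finite gap case the diagonal
  Green's functions are compared with \<open>- 1 / sqrt ((z - lo) (z - hi))\<close>, where \<open>[lo, hi]\<close> is the hull of the
  spectrum: by reflectionlessness the logarithm of the quotient has a bounded imaginary part supported on the
  gaps, so the quotient is bounded above and below near \<open>hi\<close>, uniformly in the site. Hence
  \<open>sqrt (x - hi) (x - J)\<^sup>-\<^sup>1\<close> has entrywise limits as \<open>x\<close> decreases to \<open>hi\<close>, with kernel \<open>u n * u m\<close>.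
\<close>

section \<open>Sums of square roots from rank-one bounds\<close>

text \<open>The power 1/2 is critical in one dimension: a weak potential of mass \<open>W\<close>
  far from the origin can bind with energy of order \<open>W\<close> squared, so every estimate has
  to be linear in the mass. A window of length \<open>r\<close> and mass \<open>W\<close> produces a
  rank-one form whose vector has norm about \<open>sqrt (W / r)\<close>. This is at most of order
  \<open>W\<close> if \<open>r * W\<close> is bounded below, whereas the gradient controls the
  deviation from the mean only if \<open>r * W\<close> is bounded above. Hence windows stop when
  \<open>r * W\<close> reaches a threshold, which the bounds on the ground state determine.

  In the finite gap case the difficulty is uniformity in the site: the off-diagonal entries are only
  given as positive, so lower bounds for them and for \<open>u\<close> both have to be extracted
  from boundary values of Green's functions. The link between \<open>E\<close> and the spectrum is
  membership: truncations of \<open>u\<close> put \<open>E\<close> into the half-line spectrum, so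
  the distance of an eigenvalue from the spectrum is at most its distance from
  \<open>E\<close>.\<close>

lemma sum_mult_le_L2_set:
  assumes "finite A"
  shows "(\<Sum>i\<in>A. f i * g i) \<le> L2_set f A * L2_set g A"
proof -
  have "(\<Sum>i\<in>A. f i * g i) \<le> (\<Sum>i\<in>A. \<bar>f i\<bar> * \<bar>g i\<bar>)"
    by (intro sum_mono) (metis abs_ge_self abs_mult)
  then show ?thesis using L2_set_mult_ineq[of f g A] by linarith
qed

text \<open>Bessel's inequality for the coordinate vector \<open>e\<close> at \<open>j\<close>:
  \<open>s\<close> is its orthogonal projection onto the span of the \<open>q k\<close>, and
  \<open>s j\<close> is both the squared norm of \<open>s\<close> and its inner product with
  \<open>e\<close>.\<close>

lemma bessel_coordinate:
  fixes q :: "nat \<Rightarrow> 'j \<Rightarrow> real"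
  assumes "finite J" "j \<in> J"
    and on: "\<And>k l. k < K \<Longrightarrow> l < K \<Longrightarrow> (\<Sum>i\<in>J. q k i * q l i) = (if k = l then 1 else 0)"
  shows "(\<Sum>k<K. (q k j)\<^sup>2) \<le> 1"
proof -
  define s where "s i = (\<Sum>k<K. q k j * q k i)" for i
  define e where "e i = (if i = j then 1 else 0 :: real)" for i
  have 1: "(\<Sum>i\<in>J. (e i)\<^sup>2) = 1"
    using assms by (simp add: e_def if_distrib[of "\<lambda>x. x^2"] cong: if_cong)
  have 2: "(\<Sum>i\<in>J. e i * s i) = s j"
    using assms by (simp add: e_def if_distrib[of "\<lambda>x. x * _"] cong: if_cong)
  have 3: "(\<Sum>i\<in>J. (s i)\<^sup>2) = s j"
  proof -
    have "(\<Sum>i\<in>J. (s i)\<^sup>2) = (\<Sum>i\<in>J. \<Sum>k<K. \<Sum>l<K. q k j * q l j * (q k i * q l i))"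
      by (simp add: s_def power2_eq_square sum_product algebra_simps)
    also have "\<dots> = (\<Sum>k<K. \<Sum>l<K. q k j * q l j * (\<Sum>i\<in>J. q k i * q l i))"
      by (subst sum.swap, rule sum.cong[OF refl], subst sum.swap) (simp add: sum_distrib_left)
    also have "\<dots> = (\<Sum>k<K. \<Sum>l<K. q k j * q l j * (if k = l then 1 else 0))"
      by (intro sum.cong refl) (simp add: on)
    also have "\<dots> = (\<Sum>k<K. q k j * q k j)"
      by (intro sum.cong refl) (simp add: if_distrib[of "\<lambda>x. _ * x"] cong: if_cong)
    finally show ?thesis by (simp add: s_def)
  qed
  have "0 \<le> (\<Sum>i\<in>J. (e i - s i)\<^sup>2)" by (intro sum_nonneg) simp
  also have "\<dots> = (\<Sum>i\<in>J. (e i)\<^sup>2) - 2 * (\<Sum>i\<in>J. e i * s i) + (\<Sum>i\<in>J. (s i)\<^sup>2)"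
    by (simp add: power2_diff sum.distrib sum_subtractf sum_distrib_left mult.assoc)
  finally have "s j \<le> 1" using 1 2 3 by simp
  then show ?thesis by (simp add: s_def power2_eq_square)
qed

text \<open>Coercivity says that the vector \<open>a n\<close> has distance at least
  \<open>s n\<close> from the span of the others: give \<open>a n\<close> the coefficient 1.
  Normalising its component orthogonal to the earlier vectors yields \<open>q n\<close>, whose inner
  product with \<open>a n\<close> is that distance. The spanning clause carries the induction,
  because it writes the component as a combination with coefficient 1 at \<open>n\<close>.\<close>

lemma gram_schmidt:
  fixes a :: "nat \<Rightarrow> 'j \<Rightarrow> real"
  assumes "finite J"
    and pos: "\<And>k. k < K \<Longrightarrow> s k > 0"
    and coercive: "\<And>c. (\<Sum>k<K. (s k)\<^sup>2 * (c k)\<^sup>2) \<le> (\<Sum>j\<in>J. (\<Sum>k<K. a k j * c k)\<^sup>2)"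
  shows "n \<le> K \<Longrightarrow> \<exists>q t. (\<forall>k<n. \<forall>l<n. (\<Sum>j\<in>J. q k j * q l j) = (if k = l then 1 else 0)) \<and>
    (\<forall>k<n. (\<Sum>j\<in>J. q k j * a k j) \<ge> s k) \<and>
    (\<forall>k<n. \<forall>j. q k j = (\<Sum>l<n. t k l * a l j))"
proof (induction n)
  case 0
  then show ?case by auto
next
  case (Suc n)
  then obtain q t where on: "\<And>k l. k < n \<Longrightarrow> l < n \<Longrightarrow> (\<Sum>j\<in>J. q k j * q l j) = (if k = l then 1 else 0)"
    and ge: "\<And>k. k < n \<Longrightarrow> (\<Sum>j\<in>J. q k j * a k j) \<ge> s k"
    and span: "\<And>k j. k < n \<Longrightarrow> q k j = (\<Sum>l<n. t k l * a l j)" by fastforce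
  define d where "d k = (\<Sum>j\<in>J. q k j * a n j)" for k
  define p where "p j = a n j - (\<Sum>k<n. d k * q k j)" for j
  define c where "c l = (if l < n then - (\<Sum>k<n. d k * t k l) else if l = n then 1 else 0)" for l
  have p_span: "p j = (\<Sum>l<Suc n. c l * a l j)" for j
  proof -
    have "(\<Sum>k<n. d k * q k j) = (\<Sum>k<n. \<Sum>l<n. d k * t k l * a l j)"
      by (intro sum.cong refl) (simp add: span sum_distrib_left mult.assoc)
    also have "\<dots> = (\<Sum>l<n. (\<Sum>k<n. d k * t k l) * a l j)"
      by (subst sum.swap) (simp add: sum_distrib_right)
    finally show ?thesis by (simp add: p_def c_def sum_negf)
  qed
  define P where "P = (\<Sum>j\<in>J. (p j)\<^sup>2)"
  have P_ge: "(s n)\<^sup>2 \<le> P"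
  proof -
    have "(s n)\<^sup>2 = (s n)\<^sup>2 * (c n)\<^sup>2" by (simp add: c_def)
    also have "\<dots> \<le> (\<Sum>k<K. (s k)\<^sup>2 * (c k)\<^sup>2)"
      using Suc.prems by (intro member_le_sum) auto
    also have "\<dots> \<le> (\<Sum>j\<in>J. (\<Sum>k<K. a k j * c k)\<^sup>2)" by (rule coercive)
    also have "\<dots> = P"
      unfolding P_def
    proof (intro sum.cong refl arg_cong[where f = "\<lambda>x. x^2"])
      fix j
      have "(\<Sum>k<K. a k j * c k) = (\<Sum>k<Suc n. a k j * c k)"
        using Suc.prems by (intro sum.mono_neutral_right) (auto simp: c_def)
      then show "(\<Sum>k<K. a k j * c k) = p j" by (simp add: p_span mult.commute)
    qed
    finally show ?thesis .
  qed
  have sn: "s n > 0" using pos Suc.prems by auto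
  then have Ppos: "P > 0" using P_ge by (smt (verit) zero_less_power)
  define r where "r = sqrt P"
  have rpos: "r > 0" and r2: "r * r = P" using Ppos by (auto simp: r_def)
  have r_ge: "s n \<le> r" unfolding r_def using P_ge sn by (intro real_le_rsqrt) auto
  have pq: "(\<Sum>j\<in>J. p j * q l j) = 0" if "l < n" for l
  proof -
    have "(\<Sum>j\<in>J. p j * q l j) = d l - (\<Sum>j\<in>J. \<Sum>k<n. d k * (q k j * q l j))"
      by (simp add: p_def d_def[of l] left_diff_distrib sum_subtractf sum_distrib_right mult.assoc)
        (simp add: mult.commute)
    also have "(\<Sum>j\<in>J. \<Sum>k<n. d k * (q k j * q l j)) = (\<Sum>k<n. d k * (\<Sum>j\<in>J. q k j * q l j))"
      by (subst sum.swap) (simp add: sum_distrib_left)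
    also have "\<dots> = (\<Sum>k<n. d k * (if k = l then 1 else 0))"
      using that by (intro sum.cong refl) (simp add: on)
    also have "\<dots> = d l" using that by (simp add: if_distrib[of "\<lambda>x. _ * x"] cong: if_cong)
    finally show ?thesis by simp
  qed
  have pa: "(\<Sum>j\<in>J. p j * a n j) = P"
  proof -
    have a: "a n j = p j + (\<Sum>k<n. d k * q k j)" for j by (simp add: p_def)
    have "(\<Sum>j\<in>J. p j * a n j) = (\<Sum>j\<in>J. p j * p j + (\<Sum>k<n. d k * (p j * q k j)))"
      by (intro sum.cong refl) (simp add: a ring_distribs sum_distrib_left ac_simps)
    also have "\<dots> = P + (\<Sum>k<n. d k * (\<Sum>j\<in>J. p j * q k j))"
      by (simp add: sum.distrib P_def power2_eq_square, subst sum.swap, simp add: sum_distrib_left)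
    finally show ?thesis by (simp add: pq)
  qed
  define q' where "q' = q(n := (\<lambda>j. p j / r))"
  define t' where "t' k = (if k = n then (\<lambda>l. c l / r) else (\<lambda>l. if l < n then t k l else 0))" for k
  have pq': "(\<Sum>j\<in>J. p j / r * q l j) = 0" "(\<Sum>j\<in>J. q l j * p j / r) = 0" if "l < n" for l
    using pq[OF that] rpos by (simp_all flip: sum_divide_distrib add: mult.commute)
  have pp: "(\<Sum>j\<in>J. p j * p j / (r * r)) = 1"
    using Ppos r2 by (simp flip: sum_divide_distrib add: P_def power2_eq_square)
  have "(\<Sum>j\<in>J. q' k j * q' l j) = (if k = l then 1 else 0)" if "k < Suc n" "l < Suc n" for k l
    using that on[of k l] pq' pp by (cases "k = n"; cases "l = n") (auto simp: q'_def mult.commute less_Suc_eq)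
  moreover have "(\<Sum>j\<in>J. q' k j * a k j) \<ge> s k" if "k < Suc n" for k
  proof (cases "k = n")
    case True
    have "(\<Sum>j\<in>J. q' k j * a k j) = P / r"
      by (simp add: q'_def True flip: pa sum_divide_distrib)
    also have "\<dots> = r" using r2 rpos by (metis nonzero_mult_div_cancel_right less_irrefl)
    finally show ?thesis using r_ge True by simp
  next
    case False
    then show ?thesis using that ge by (simp add: q'_def)
  qed
  moreover have "q' k j = (\<Sum>l<Suc n. t' k l * a l j)" if "k < Suc n" for k j
  proof (cases "k = n")
    case True
    then show ?thesis by (simp add: q'_def t'_def p_span sum_divide_distrib add_divide_distrib)
  next
    case False
    then show ?thesis using that by (simp add: q'_def t'_def span)
  qed
  ultimately show ?case by blast
qed

text \<open>In matrix terms, the trace norm of \<open>a\<close> is at least the sum of the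
  \<open>s k\<close> and at most the sum over \<open>j\<close> of the norms. The Gram--Schmidt basis
  takes the place of the polar decomposition and of operator monotonicity of the square root. After
  exchanging the sums, Cauchy--Schwarz in \<open>k\<close> and \<open>bessel_coordinate\<close>
  bound each \<open>j\<close>.\<close>

lemma sum_le_sum_L2_set:
  fixes a :: "nat \<Rightarrow> 'j \<Rightarrow> real"
  assumes "finite J"
    and pos: "\<And>k. k < K \<Longrightarrow> s k > 0"
    and coercive: "\<And>c. (\<Sum>k<K. (s k)\<^sup>2 * (c k)\<^sup>2) \<le> (\<Sum>j\<in>J. (\<Sum>k<K. a k j * c k)\<^sup>2)"
  shows "(\<Sum>k<K. s k) \<le> (\<Sum>j\<in>J. L2_set (\<lambda>k. a k j) {..<K})"
proof -
  obtain q t where on: "\<And>k l. k < K \<Longrightarrow> l < K \<Longrightarrow> (\<Sum>j\<in>J. q k j * q l j) = (if k = l then 1 else 0)"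
    and ge: "\<And>k. k < K \<Longrightarrow> (\<Sum>j\<in>J. q k j * a k j) \<ge> s k"
    and "\<forall>k<K. \<forall>j. q k j = (\<Sum>l<K. t k l * a l j)"
    using gram_schmidt[OF assms, of K] by blast
  have "(\<Sum>k<K. s k) \<le> (\<Sum>k<K. \<Sum>j\<in>J. q k j * a k j)" by (intro sum_mono) (simp add: ge)
  also have "\<dots> = (\<Sum>j\<in>J. \<Sum>k<K. q k j * a k j)" by (rule sum.swap)
  also have "\<dots> \<le> (\<Sum>j\<in>J. L2_set (\<lambda>k. a k j) {..<K})"
  proof (intro sum_mono)
    fix j assume j: "j \<in> J"
    have "(\<Sum>k<K. q k j * a k j) \<le> L2_set (\<lambda>k. q k j) {..<K} * L2_set (\<lambda>k. a k j) {..<K}"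
      by (rule sum_mult_le_L2_set) simp
    also have "\<dots> \<le> 1 * L2_set (\<lambda>k. a k j) {..<K}"
      using bessel_coordinate[OF assms(1) j on, of K]
      by (intro mult_right_mono) (auto simp: L2_set_def intro: sum_nonneg)
    finally show "(\<Sum>k<K. q k j * a k j) \<le> L2_set (\<lambda>k. a k j) {..<K}" by simp
  qed
  finally show ?thesis .
qed

section \<open>Windows: absorbing a potential into the gradient up to rank-one forms\<close>

lemma path_sum_abs_diff:
  fixes g :: "nat \<Rightarrow> real"
  assumes "i \<in> {m..n}" "j \<in> {m..n}"
  shows "\<bar>g j - g i\<bar> \<le> (\<Sum>k\<in>{m..<n}. \<bar>g (Suc k) - g k\<bar>)"
proof -
  have *: "\<bar>g j - g i\<bar> \<le> (\<Sum>k\<in>{m..<n}. \<bar>g (Suc k) - g k\<bar>)"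
    if "i \<le> j" "m \<le> i" "j \<le> n" for i j
  proof -
    have "\<bar>g j - g i\<bar> = \<bar>\<Sum>k\<in>{i..<j}. g (Suc k) - g k\<bar>"
      using that(1) by (simp add: sum_Suc_diff')
    also have "\<dots> \<le> (\<Sum>k\<in>{i..<j}. \<bar>g (Suc k) - g k\<bar>)" by (rule sum_abs)
    also have "\<dots> \<le> (\<Sum>k\<in>{m..<n}. \<bar>g (Suc k) - g k\<bar>)"
      using that by (intro sum_mono2) auto
    finally show ?thesis .
  qed
  show ?thesis
    using *[of i j] *[of j i] assms by (cases "i \<le> j") (auto simp: abs_minus_commute)
qed

text \<open>A discrete Poincare inequality: the deviation of \<open>g j\<close> from the mean over
  the window is at most the total variation \<open>T\<close>, and Cauchy--Schwarz over fewer than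
  \<open>r\<close> steps turns the square of \<open>T\<close> into \<open>r\<close> times the
  gradient energy.\<close>

lemma window_pointwise:
  fixes g :: "nat \<Rightarrow> real"
  assumes "j \<in> {m..n}"
  defines "r \<equiv> real (n + 1 - m)"
  shows "(g j)\<^sup>2 \<le> 2 * ((\<Sum>i\<in>{m..n}. g i) / r)\<^sup>2 + 2 * r * (\<Sum>k\<in>{m..<n}. (g (Suc k) - g k)\<^sup>2)"
proof -
  define A where "A = (\<Sum>i\<in>{m..n}. g i) / r"
  define D where "D = (\<Sum>k\<in>{m..<n}. (g (Suc k) - g k)\<^sup>2)"
  define T where "T = (\<Sum>k\<in>{m..<n}. \<bar>g (Suc k) - g k\<bar>)"
  have r: "r \<ge> 1" "r = real (card {m..n})" using assms by (auto simp: r_def)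
  have "\<bar>g j - A\<bar> = \<bar>\<Sum>i\<in>{m..n}. g j - g i\<bar> / r"
  proof -
    have "(\<Sum>i\<in>{m..n}. g j - g i) = r * g j - (\<Sum>i\<in>{m..n}. g i)"
      unfolding r(2) by (simp add: sum_subtractf)
    then have "(\<Sum>i\<in>{m..n}. g j - g i) / r = g j - A"
      using r(1) by (simp add: A_def diff_divide_distrib)
    then show ?thesis using r(1) by (metis abs_divide abs_of_nonneg order_trans zero_le_one)
  qed
  also have "\<dots> \<le> (\<Sum>i\<in>{m..n}. T) / r"
    unfolding T_def using r assms(1)
    by (intro divide_right_mono order_trans[OF sum_abs] sum_mono path_sum_abs_diff) auto
  also have "\<dots> = T" using r by simp
  finally have "(g j - A)\<^sup>2 \<le> T\<^sup>2" by (metis abs_ge_zero power2_abs power_mono)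
  also have "T\<^sup>2 \<le> D * real (card {m..<n})"
    unfolding T_def D_def using sum_squared_le_sum_of_squares[of "\<lambda>k. \<bar>g (Suc k) - g k\<bar>" "{m..<n}"] by simp
  also have "\<dots> \<le> D * r"
    by (intro mult_left_mono) (auto simp: D_def r_def intro: sum_nonneg)
  finally have "(g j - A)\<^sup>2 \<le> r * D" by (simp add: mult.commute)
  moreover have "(g j)\<^sup>2 \<le> 2 * A\<^sup>2 + 2 * (g j - A)\<^sup>2"
    using zero_le_power2[of "g j - 2 * A"] by (simp add: power2_eq_square algebra_simps)
  ultimately show ?thesis by (simp add: A_def D_def)
qed

text \<open>Summed against \<open>V\<close>, the mean becomes the square of a single linear
  functional, given by the constant vector \<open>sqrt (2 * W) / r\<close> on the window. This is
  the part that the gradient cannot absorb.\<close>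

lemma window_sum:
  fixes g V :: "nat \<Rightarrow> real"
  assumes "m \<le> n" and V: "\<And>j. j \<in> {m..n} \<Longrightarrow> V j \<ge> 0"
  defines "r \<equiv> real (n + 1 - m)" and "W \<equiv> \<Sum>j\<in>{m..n}. V j"
  shows "(\<Sum>j\<in>{m..n}. V j * (g j)\<^sup>2)
    \<le> (\<Sum>i\<in>{m..n}. sqrt (2 * W) / r * g i)\<^sup>2 + 2 * W * r * (\<Sum>k\<in>{m..<n}. (g (Suc k) - g k)\<^sup>2)"
proof -
  have W: "W \<ge> 0" unfolding W_def by (intro sum_nonneg V)
  define X where "X = 2 * ((\<Sum>i\<in>{m..n}. g i) / r)\<^sup>2 + 2 * r * (\<Sum>k\<in>{m..<n}. (g (Suc k) - g k)\<^sup>2)"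
  have "(\<Sum>j\<in>{m..n}. V j * (g j)\<^sup>2) \<le> (\<Sum>j\<in>{m..n}. V j * X)"
    unfolding X_def r_def by (intro sum_mono mult_left_mono window_pointwise V) auto
  also have "\<dots> = W * X" by (simp add: W_def sum_distrib_right)
  also have "\<dots> = (sqrt (2 * W) / r * (\<Sum>i\<in>{m..n}. g i))\<^sup>2 + 2 * W * r * (\<Sum>k\<in>{m..<n}. (g (Suc k) - g k)\<^sup>2)"
    using W by (simp add: X_def power_mult_distrib power_divide algebra_simps)
  finally show ?thesis by (simp add: sum_distrib_left)
qed

lemma L2_set_const_interval:
  assumes "m \<le> n" "c \<ge> 0"
  shows "L2_set (\<lambda>i. if i \<in> {m..n} then c else 0) {m..n} = c * sqrt (real (n + 1 - m))"
  using assms by (simp add: L2_set_def real_sqrt_mult power2_eq_square mult.commute)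

text \<open>A point mass \<open>V\<close> at the right end of a window is averaged over a length of order \<open>1 / V\<close>.\<close>

lemma window_length:
  fixes v W :: real
  assumes "v \<ge> 0" "v < \<tau>" "v \<le> W" "real L * W \<ge> \<tau>" "L \<ge> 1" "\<tau> > 0"
  obtains r where "1 \<le> r" "r \<le> L" "real r * v \<le> \<tau>" "v / real r \<le> 2 * W\<^sup>2 / \<tau>"
proof (cases "real L * v \<le> \<tau>")
  case True
  have L: "real L > 0" using assms by simp
  then have "1 / real L \<le> W / \<tau>" using assms by (simp add: field_simps)
  then have "v * (1 / real L) \<le> W * (W / \<tau>)" using assms by (intro mult_mono) auto
  then have "v / real L \<le> W\<^sup>2 / \<tau>" by (simp add: power2_eq_square)
  also have "\<dots> \<le> 2 * W\<^sup>2 / \<tau>" using assms by (simp add: divide_right_mono)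
  finally show thesis using that[of L] True assms by simp
next
  case False
  then have v: "v > 0" using assms by (smt (verit) mult_nonneg_nonpos of_nat_0_le_iff)
  \<comment> \<open>The longest admissible length. As \<open>\<tau> / v > 1\<close>, rounding down
    loses at most a factor 2, which is the 2 in the conclusion.\<close>
  define r where "r = nat \<lfloor>\<tau> / v\<rfloor>"
  have q: "\<tau> / v > 1" using v assms by (simp add: field_simps)
  have r1: "r \<ge> 1" using q by (simp add: r_def le_nat_iff)
  have rr: "real r \<le> \<tau> / v" "\<tau> / v < real r + 1" using q by (auto simp: r_def)
  have rv: "real r * v \<le> \<tau>" using rr v by (simp add: field_simps)
  then have "real r * v < real L * v" using False by linarith
  then have "r \<le> L" using v by simp
  moreover note rv
  moreover have "v / real r \<le> 2 * W\<^sup>2 / \<tau>"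
  proof -
    have "\<tau> / v \<le> 2 * real r" using rr r1 by linarith
    then have "\<tau> \<le> 2 * real r * v" using v by (simp add: field_simps)
    then have "\<tau> * v \<le> (2 * real r * v) * v" using v by (intro mult_right_mono) auto
    also have "\<dots> = 2 * v\<^sup>2 * real r" by (simp add: power2_eq_square)
    also have "\<dots> \<le> 2 * W\<^sup>2 * real r" using assms v by (intro mult_right_mono) (auto intro: power_mono)
    finally show ?thesis using r1 assms by (simp add: field_simps)
  qed
  ultimately show thesis using that[of r] r1 by simp
qed

text \<open>
  The interval starting at \<open>m\<close> is extended until length times mass exceeds \<open>\<tau>\<close>. Without its last
  site this product is still below \<open>\<tau>\<close>, so the gradient absorbs everything but the mean; the last
  site, where the mass may jump, is treated by a window of its own.
\<close>

lemma window_step: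
  fixes V :: "nat \<Rightarrow> real"
  assumes V: "\<And>j. V j \<ge> 0" and \<tau>: "\<tau> > 0"
    and ex: "\<exists>n\<ge>m. real (n + 1 - m) * (\<Sum>j\<in>{m..n}. V j) \<ge> \<tau>"
  shows "\<exists>n\<ge>m. \<exists>v w :: nat \<Rightarrow> real. (\<forall>i. i \<notin> {m..n} \<longrightarrow> v i = 0 \<and> w i = 0) \<and>
    (\<forall>g. (\<Sum>j\<in>{m..n}. V j * (g j)\<^sup>2) \<le> 4 * \<tau> * (\<Sum>k\<in>{m..<n}. (g (Suc k) - g k)\<^sup>2)
       + (\<Sum>j\<in>{m..n}. v j * g j)\<^sup>2 + (\<Sum>j\<in>{m..n}. w j * g j)\<^sup>2) \<and>
    L2_set v {m..n} + L2_set w {m..n} \<le> 4 / sqrt \<tau> * (\<Sum>j\<in>{m..n}. V j)"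
proof -
  define P where "P n \<longleftrightarrow> n \<ge> m \<and> real (n + 1 - m) * (\<Sum>j\<in>{m..n}. V j) \<ge> \<tau>" for n
  define n where "n = (LEAST n. P n)"
  have "P n" unfolding n_def by (rule LeastI_ex) (use ex P_def in auto)
  then have mn: "m \<le> n" and big: "real (n + 1 - m) * (\<Sum>j\<in>{m..n}. V j) \<ge> \<tau>" by (auto simp: P_def)
  have small: "\<not> P k" if "k < n" for k using not_less_Least that n_def by blast
  define W where "W = (\<Sum>j\<in>{m..n}. V j)"
  define D where "D g = (\<Sum>k\<in>{m..<n}. (g (Suc k) - g k)\<^sup>2)" for g :: "nat \<Rightarrow> real"
  have D0: "D g \<ge> 0" for g unfolding D_def by (intro sum_nonneg) simp
  have W0: "W \<ge> 0" unfolding W_def by (intro sum_nonneg V)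
  have Vn: "V n \<le> W" unfolding W_def using mn V by (intro member_le_sum) auto
  have left: "\<exists>v. (\<forall>i. i \<notin> {m..n} \<longrightarrow> v i = 0) \<and>
    (\<forall>g. (\<Sum>j\<in>{m..<n}. V j * (g j)\<^sup>2) \<le> 2 * \<tau> * D g + (\<Sum>j\<in>{m..n}. v j * g j)\<^sup>2) \<and>
    L2_set v {m..n} \<le> 2 / sqrt \<tau> * W"
  proof (cases "m = n")
    case True
    then show ?thesis using D0 \<tau> W0 by (intro exI[of _ "\<lambda>_. 0"]) (auto simp: L2_set_def)
  next
    case False
    define k where "k = n - 1"
    have k: "n = Suc k" "m \<le> k" using False mn by (auto simp: k_def)
    define W' where "W' = (\<Sum>j\<in>{m..k}. V j)"
    define r where "r = real (k + 1 - m)"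
    have r: "r \<ge> 1" using k by (simp add: r_def)
    have W': "0 \<le> W'" "W' \<le> W" unfolding W_def W'_def using k V by (auto intro!: sum_nonneg sum_mono2)
    have rW: "r * W' < \<tau>" using small[of k] k by (simp add: P_def r_def W'_def)
    define v where "v i = (if i \<in> {m..k} then sqrt (2 * W') / r else 0)" for i
    have "(\<Sum>j\<in>{m..<n}. V j * (g j)\<^sup>2) \<le> 2 * \<tau> * D g + (\<Sum>j\<in>{m..n}. v j * g j)\<^sup>2" for g
    proof -
      have "(\<Sum>j\<in>{m..<n}. V j * (g j)\<^sup>2) = (\<Sum>j\<in>{m..k}. V j * (g j)\<^sup>2)"
        by (simp add: k(1) atLeastLessThanSuc_atLeastAtMost)
      also have "\<dots> \<le> (\<Sum>i\<in>{m..k}. sqrt (2 * W') / r * g i)\<^sup>2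
          + 2 * W' * r * (\<Sum>i\<in>{m..<k}. (g (Suc i) - g i)\<^sup>2)"
        unfolding W'_def r_def by (intro window_sum k V)
      also have "(\<Sum>i\<in>{m..k}. sqrt (2 * W') / r * g i) = (\<Sum>j\<in>{m..n}. v j * g j)"
        unfolding v_def using k by (intro sum.mono_neutral_cong_left) auto
      also have "2 * W' * r * (\<Sum>i\<in>{m..<k}. (g (Suc i) - g i)\<^sup>2) \<le> 2 * \<tau> * D g"
        unfolding D_def
      proof (rule mult_mono)
        show "2 * W' * r \<le> 2 * \<tau>" using rW by (simp add: mult.commute)
        show "(\<Sum>i\<in>{m..<k}. (g (Suc i) - g i)\<^sup>2) \<le> (\<Sum>i\<in>{m..<n}. (g (Suc i) - g i)\<^sup>2)"
          using k by (intro sum_mono2) auto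
      qed (use \<tau> in \<open>auto intro: sum_nonneg\<close>)
      finally show ?thesis by simp
    qed
    moreover have "L2_set v {m..n} \<le> 2 / sqrt \<tau> * W"
    proof -
      have "L2_set v {m..n} = L2_set v {m..k}"
        unfolding L2_set_def using k by (auto simp: v_def intro!: sum.mono_neutral_right)
      also have "\<dots> = sqrt (2 * W') / r * sqrt r"
        unfolding v_def r_def using W' k by (intro L2_set_const_interval) auto
      also have "\<dots> = sqrt (2 * W' / r)"
        using r by (simp add: real_sqrt_divide real_div_sqrt field_simps)
      also have "\<dots> \<le> sqrt ((2 / sqrt \<tau> * W)\<^sup>2)"
      proof (rule real_sqrt_le_mono)
        \<comment> \<open>The window closes at \<open>n\<close>, so \<open>r + 1\<close> sites reach
          the threshold. With \<open>r + 1 \<le> 2 * r\<close> this bounds \<open>r\<close> from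
          below and makes the norm linear in \<open>W\<close>.\<close>
        have "\<tau> \<le> (r + 1) * W" using big k by (simp add: W_def r_def of_nat_diff add_diff_eq)
        also have "\<dots> \<le> 2 * r * W" using r W0 by (intro mult_right_mono) auto
        finally have "1 / r \<le> 2 * W / \<tau>" using r \<tau> by (simp add: field_simps)
        then have "2 * W' * (1 / r) \<le> 2 * W * (2 * W / \<tau>)" using W' W0 r by (intro mult_mono) auto
        then show "2 * W' / r \<le> (2 / sqrt \<tau> * W)\<^sup>2"
          using \<tau> by (simp add: power_mult_distrib power_divide power2_eq_square)
      qed
      finally show ?thesis using W0 \<tau> by simp
    qed
    ultimately show ?thesis using k by (intro exI[of _ v]) (auto simp: v_def)
  qed
  have right: "\<exists>w. (\<forall>i. i \<notin> {m..n} \<longrightarrow> w i = 0) \<and>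
    (\<forall>g. V n * (g n)\<^sup>2 \<le> 2 * \<tau> * D g + (\<Sum>j\<in>{m..n}. w j * g j)\<^sup>2) \<and>
    L2_set w {m..n} \<le> 2 / sqrt \<tau> * W"
  \<comment> \<open>A site of mass at least \<open>\<tau>\<close> requires no averaging: its form is
    itself rank-one, and \<open>sqrt (V n)\<close> is at most
    \<open>V n / sqrt \<tau>\<close>.\<close>
  proof (cases "V n < \<tau>")
    case True
    obtain r where r: "1 \<le> r" "r \<le> n + 1 - m" "real r * V n \<le> \<tau>" "V n / real r \<le> 2 * W\<^sup>2 / \<tau>"
      using window_length[of "V n" \<tau> W "n + 1 - m"] True V Vn big mn \<tau> unfolding W_def
      by (metis (no_types, lifting) Suc_diff_le Suc_eq_plus1 le_add2)
    define k where "k = n + 1 - r"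
    have k: "m \<le> k" "k \<le> n" "n + 1 - k = r" using r mn by (auto simp: k_def)
    define w where "w i = (if i \<in> {k..n} then sqrt (2 * V n) / real r else 0)" for i
    have "V n * (g n)\<^sup>2 \<le> 2 * \<tau> * D g + (\<Sum>j\<in>{m..n}. w j * g j)\<^sup>2" for g
    proof -
      \<comment> \<open>Replacing \<open>V\<close> on \<open>{k..n}\<close> by a point mass at
        \<open>n\<close> lets \<open>window_sum\<close> treat the last site.\<close>
      define U where "U j = (if j = n then V n else 0)" for j
      have U: "(\<Sum>j\<in>{k..n}. U j) = V n" using k by (simp add: U_def)
      have "V n * (g n)\<^sup>2 = (\<Sum>j\<in>{k..n}. U j * (g j)\<^sup>2)"
        using k by (simp add: U_def if_distrib[of "\<lambda>x. x * _"] cong: if_cong)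
      also have "\<dots> \<le> (\<Sum>i\<in>{k..n}. sqrt (2 * V n) / real r * g i)\<^sup>2
          + 2 * V n * real r * (\<Sum>i\<in>{k..<n}. (g (Suc i) - g i)\<^sup>2)"
        using window_sum[OF k(2), of U g] V unfolding U k(3) by (auto simp: U_def)
      also have "(\<Sum>i\<in>{k..n}. sqrt (2 * V n) / real r * g i) = (\<Sum>j\<in>{m..n}. w j * g j)"
        unfolding w_def using k by (intro sum.mono_neutral_cong_left) auto
      also have "2 * V n * real r * (\<Sum>i\<in>{k..<n}. (g (Suc i) - g i)\<^sup>2) \<le> 2 * \<tau> * D g"
        unfolding D_def
      proof (rule mult_mono)
        show "2 * V n * real r \<le> 2 * \<tau>" using r by (simp add: mult.commute)
        show "(\<Sum>i\<in>{k..<n}. (g (Suc i) - g i)\<^sup>2) \<le> (\<Sum>i\<in>{m..<n}. (g (Suc i) - g i)\<^sup>2)"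
          using k by (intro sum_mono2) auto
      qed (use \<tau> in \<open>auto intro: sum_nonneg\<close>)
      finally show ?thesis by simp
    qed
    moreover have "L2_set w {m..n} \<le> 2 / sqrt \<tau> * W"
    proof -
      have "(\<Sum>i\<in>{m..n}. (w i)\<^sup>2) = (\<Sum>i\<in>{k..n}. (w i)\<^sup>2)"
        using k(1,2) by (intro sum.mono_neutral_right) (auto simp: w_def)
      then have "L2_set w {m..n} = L2_set w {k..n}" by (simp add: L2_set_def)
      also have "\<dots> = sqrt (2 * V n) / real r * sqrt r"
        unfolding w_def k(3)[symmetric] using V k by (intro L2_set_const_interval) auto
      also have "\<dots> = sqrt (2 * (V n / real r))"
        using r by (simp add: real_sqrt_divide real_div_sqrt field_simps)
      also have "\<dots> \<le> sqrt ((2 / sqrt \<tau> * W)\<^sup>2)"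
        using r(4) \<tau> by (intro real_sqrt_le_mono) (simp add: power_mult_distrib power_divide)
      finally show ?thesis using W0 \<tau> by simp
    qed
    ultimately show ?thesis using k by (intro exI[of _ w]) (auto simp: w_def)
  next
    case False
    define w where "w i = (if i = n then sqrt (V n) else 0)" for i
    have "(\<Sum>j\<in>{m..n}. w j * g j) = sqrt (V n) * g n" for g
      using mn by (simp add: w_def if_distrib[of "\<lambda>x. x * _"] cong: if_cong)
    moreover have "L2_set w {m..n} = sqrt (V n)"
      using mn V by (simp add: w_def L2_set_def if_distrib[of "\<lambda>x. x^2"] cong: if_cong)
    moreover have "sqrt (V n) \<le> 2 / sqrt \<tau> * W"
    proof -
      have "sqrt (V n) * sqrt \<tau> \<le> sqrt (V n) * sqrt (V n)"
        using False V by (intro mult_left_mono) auto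
      also have "\<dots> \<le> 2 * W" using Vn V[of n] by simp
      finally show ?thesis using \<tau> by (simp add: field_simps)
    qed
    ultimately show ?thesis
      using V D0 \<tau> mn by (intro exI[of _ w]) (auto simp: w_def power_mult_distrib)
  qed
  from left obtain v where v: "\<forall>i. i \<notin> {m..n} \<longrightarrow> v i = 0"
    "\<And>g. (\<Sum>j\<in>{m..<n}. V j * (g j)\<^sup>2) \<le> 2 * \<tau> * D g + (\<Sum>j\<in>{m..n}. v j * g j)\<^sup>2"
    "L2_set v {m..n} \<le> 2 / sqrt \<tau> * W" by blast
  from right obtain w where w: "\<forall>i. i \<notin> {m..n} \<longrightarrow> w i = 0"
    "\<And>g. V n * (g n)\<^sup>2 \<le> 2 * \<tau> * D g + (\<Sum>j\<in>{m..n}. w j * g j)\<^sup>2"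
    "L2_set w {m..n} \<le> 2 / sqrt \<tau> * W" by blast
  have "(\<Sum>j\<in>{m..n}. V j * (g j)\<^sup>2) \<le> 4 * \<tau> * (\<Sum>k\<in>{m..<n}. (g (Suc k) - g k)\<^sup>2)
       + (\<Sum>j\<in>{m..n}. v j * g j)\<^sup>2 + (\<Sum>j\<in>{m..n}. w j * g j)\<^sup>2" for g
  proof -
    have "(\<Sum>j\<in>{m..n}. V j * (g j)\<^sup>2) = (\<Sum>j\<in>{m..<n}. V j * (g j)\<^sup>2) + V n * (g n)\<^sup>2"
      using mn by (simp add: sum.last_plus add.commute)
    then show ?thesis using v(2)[of g] w(2)[of g] unfolding D_def by linarith
  qed
  moreover have "L2_set v {m..n} + L2_set w {m..n} \<le> 4 / sqrt \<tau> * (\<Sum>j\<in>{m..n}. V j)"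
    using v(3) w(3) unfolding W_def by (simp add: field_simps)
  ultimately show ?thesis using mn v(1) w(1) by blast
qed

text \<open>Windows are laid end to end from site 1 until they pass \<open>N\<close>. Their
  gradients live on disjoint sets of bonds, and the bonds joining consecutive windows are dropped.
  By \<open>ex\<close> every window closes; where it closes cannot be prescribed, so
  \<open>M\<close> is only known to be large.\<close>

lemma window_decomposition:
  fixes V :: "nat \<Rightarrow> real"
  assumes V: "\<And>j. V j \<ge> 0" and \<tau>: "\<tau> > 0"
    and ex: "\<And>m. \<exists>n\<ge>m. real (n + 1 - m) * (\<Sum>j\<in>{m..n}. V j) \<ge> \<tau>"
  shows "\<exists>M\<ge>N. \<exists>vs :: (nat \<Rightarrow> real) list. (\<forall>v\<in>set vs. \<forall>i. i \<notin> {1..M} \<longrightarrow> v i = 0) \<and>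
    (\<forall>g. (\<Sum>j\<in>{1..M}. V j * (g j)\<^sup>2) \<le> 4 * \<tau> * (\<Sum>k\<in>{1..<M}. (g (Suc k) - g k)\<^sup>2)
       + (\<Sum>v\<leftarrow>vs. (\<Sum>j\<in>{1..M}. v j * g j)\<^sup>2)) \<and>
    (\<Sum>v\<leftarrow>vs. L2_set v {1..M}) \<le> 4 / sqrt \<tau> * (\<Sum>j\<in>{1..M}. V j)"
proof (induction N)
  case 0
  show ?case by (rule exI[of _ 0], simp, rule exI[of _ "[]"], simp)
next
  case (Suc N)
  then obtain M vs where M: "M \<ge> N" and vs: "\<forall>v\<in>set vs. \<forall>i. i \<notin> {1..M} \<longrightarrow> v i = 0"
    and form: "\<And>g. (\<Sum>j\<in>{1..M}. V j * (g j)\<^sup>2) \<le> 4 * \<tau> * (\<Sum>k\<in>{1..<M}. (g (Suc k) - g k)\<^sup>2)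
       + (\<Sum>v\<leftarrow>vs. (\<Sum>j\<in>{1..M}. v j * g j)\<^sup>2)"
    and norm: "(\<Sum>v\<leftarrow>vs. L2_set v {1..M}) \<le> 4 / sqrt \<tau> * (\<Sum>j\<in>{1..M}. V j)"
    by blast
  obtain n v w where n: "n \<ge> Suc M" and vw: "\<And>i. i \<notin> {Suc M..n} \<Longrightarrow> v i = 0 \<and> w i = 0"
    and form': "\<And>g. (\<Sum>j\<in>{Suc M..n}. V j * (g j)\<^sup>2) \<le> 4 * \<tau> * (\<Sum>k\<in>{Suc M..<n}. (g (Suc k) - g k)\<^sup>2)
       + (\<Sum>j\<in>{Suc M..n}. v j * g j)\<^sup>2 + (\<Sum>j\<in>{Suc M..n}. w j * g j)\<^sup>2"
    and norm': "L2_set v {Suc M..n} + L2_set w {Suc M..n} \<le> 4 / sqrt \<tau> * (\<Sum>j\<in>{Suc M..n}. V j)"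
    using window_step[of V \<tau> "Suc M", OF V \<tau> ex] by blast
  have split: "(\<Sum>j\<in>{1..n}. f j) = (\<Sum>j\<in>{1..M}. f j) + (\<Sum>j\<in>{Suc M..n}. f j)" for f :: "nat \<Rightarrow> real"
    using n by (subst sum.union_disjoint[symmetric]) (auto intro!: sum.cong)
  have grad: "(\<Sum>k\<in>{1..<M}. f k) + (\<Sum>k\<in>{Suc M..<n}. f k) \<le> (\<Sum>k\<in>{1..<n}. f k)"
    if "\<And>k. f k \<ge> 0" for f :: "nat \<Rightarrow> real"
    using n that by (subst sum.union_disjoint[symmetric]) (auto intro!: sum_mono2)
  have old: "(\<Sum>j\<in>{1..n}. v j * g j) = (\<Sum>j\<in>{1..M}. v j * g j)" "L2_set v {1..n} = L2_set v {1..M}"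
    if "v \<in> set vs" for v g
    using vs that n unfolding L2_set_def by (force intro!: sum.mono_neutral_right arg_cong[of _ _ sqrt])+
  have new: "(\<Sum>j\<in>{1..n}. v j * g j) = (\<Sum>j\<in>{Suc M..n}. v j * g j)" "L2_set v {1..n} = L2_set v {Suc M..n}"
    "(\<Sum>j\<in>{1..n}. w j * g j) = (\<Sum>j\<in>{Suc M..n}. w j * g j)" "L2_set w {1..n} = L2_set w {Suc M..n}" for g
    using vw n unfolding L2_set_def by (force intro!: sum.mono_neutral_right arg_cong[of _ _ sqrt])+
  have oldl: "(\<Sum>v\<leftarrow>vs. (\<Sum>j\<in>{1..n}. v j * g j)\<^sup>2) = (\<Sum>v\<leftarrow>vs. (\<Sum>j\<in>{1..M}. v j * g j)\<^sup>2)"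
    "(\<Sum>v\<leftarrow>vs. L2_set v {1..n}) = (\<Sum>v\<leftarrow>vs. L2_set v {1..M})" for g
    using old by (simp_all cong: map_cong)
  have "(\<Sum>j\<in>{1..n}. V j * (g j)\<^sup>2) \<le> 4 * \<tau> * (\<Sum>k\<in>{1..<n}. (g (Suc k) - g k)\<^sup>2)
       + (\<Sum>v\<leftarrow>v # w # vs. (\<Sum>j\<in>{1..n}. v j * g j)\<^sup>2)" for g
  proof -
    have "4 * \<tau> * ((\<Sum>k\<in>{1..<M}. (g (Suc k) - g k)\<^sup>2) + (\<Sum>k\<in>{Suc M..<n}. (g (Suc k) - g k)\<^sup>2))
      \<le> 4 * \<tau> * (\<Sum>k\<in>{1..<n}. (g (Suc k) - g k)\<^sup>2)"
      using \<tau> by (intro mult_left_mono grad) auto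
    then show ?thesis
      using form[of g] form'[of g]
      unfolding split[of "\<lambda>j. V j * (g j)\<^sup>2"] list.map sum_list.Cons new oldl ring_distribs by linarith
  qed
  moreover have "(\<Sum>v\<leftarrow>v # w # vs. L2_set v {1..n}) \<le> 4 / sqrt \<tau> * (\<Sum>j\<in>{1..n}. V j)"
    using norm norm' unfolding split[of V] list.map sum_list.Cons new oldl ring_distribs by linarith
  moreover have "\<forall>v\<in>set (v # w # vs). \<forall>i. i \<notin> {1..n} \<longrightarrow> v i = 0"
    using vs vw n by auto
  moreover have "n \<ge> Suc N" using n M by simp
  ultimately show ?case by blast
qed

section \<open>A Lieb--Thirring inequality over a regular ground state\<close>

lemma square_summable_tendsto_0:
  fixes x :: "nat \<Rightarrow> real"
  assumes "summable (\<lambda>n. (x n)\<^sup>2)"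
  shows "x \<longlonglongrightarrow> 0"
  using summable_LIMSEQ_zero[OF assms] by (simp add: power_tendsto_0_iff)

lemma sum_atLeast1_eq_lessThan:
  fixes f :: "nat \<Rightarrow> 'a :: comm_monoid_add"
  assumes "f 0 = 0"
  shows "(\<Sum>n\<in>{1..N}. f n) = (\<Sum>n<Suc N. f n)"
proof -
  have "{..<Suc N} = insert 0 {1..N}" by auto
  then show ?thesis using assms by simp
qed

lemma bounded_mult_tendsto_0:
  fixes a :: "nat \<Rightarrow> real"
  assumes "\<And>n. \<bar>a n\<bar> \<le> B" "x \<longlonglongrightarrow> 0"
  shows "(\<lambda>n. a n * x n) \<longlonglongrightarrow> 0"
proof (rule Lim_null_comparison)
  show "\<forall>\<^sub>F n in sequentially. norm (a n * x n) \<le> B * \<bar>x n\<bar>"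
    using assms(1) by (intro always_eventually allI) (simp add: abs_mult mult_right_mono)
  show "(\<lambda>n. B * \<bar>x n\<bar>) \<longlonglongrightarrow> 0"
    using tendsto_mult_right_zero[OF tendsto_rabs_zero[OF assms(2)]] by simp
qed

section \<open>Orthogonality of eigenvectors and the quadratic forms\<close>

lemma wronskian_sum:
  fixes x y \<alpha> \<beta> :: "nat \<Rightarrow> real"
  assumes "x 0 = 0" "y 0 = 0"
    and "\<And>n. n \<ge> 1 \<Longrightarrow> \<alpha> n * x (Suc n) + \<alpha> (n - 1) * x (n - 1) + \<beta> n * x n = E * x n"
    and "\<And>n. n \<ge> 1 \<Longrightarrow> \<alpha> n * y (Suc n) + \<alpha> (n - 1) * y (n - 1) + \<beta> n * y n = E' * y n"
  shows "(E - E') * (\<Sum>n\<in>{1..N}. x n * y n) = \<alpha> N * (x (Suc N) * y N - x N * y (Suc N))"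
proof (induction N)
  case 0
  then show ?case using assms by simp
next
  case (Suc N)
  have "E * x (Suc N) * y (Suc N) - E' * y (Suc N) * x (Suc N)
    = (\<alpha> (Suc N) * x (Suc (Suc N)) + \<alpha> N * x N) * y (Suc N)
      - (\<alpha> (Suc N) * y (Suc (Suc N)) + \<alpha> N * y N) * x (Suc N)"
    using assms(3)[of "Suc N"] assms(4)[of "Suc N"] by (simp add: algebra_simps flip: assms(3,4))
  then show ?case using Suc.IH by (simp add: algebra_simps)
qed

text \<open>The Wronskian in \<open>wronskian_sum\<close> tends to 0, because square-summable
  sequences do and \<open>\<alpha>\<close> is bounded.\<close>

lemma eigenvectors_orthogonal:
  fixes x y \<alpha> \<beta> :: "nat \<Rightarrow> real"
  assumes "x 0 = 0" "y 0 = 0" "\<And>n. \<bar>\<alpha> n\<bar> \<le> B" "E \<noteq> E'"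
    and "summable (\<lambda>n. (x n)\<^sup>2)" "summable (\<lambda>n. (y n)\<^sup>2)"
    and "\<And>n. n \<ge> 1 \<Longrightarrow> \<alpha> n * x (Suc n) + \<alpha> (n - 1) * x (n - 1) + \<beta> n * x n = E * x n"
    and "\<And>n. n \<ge> 1 \<Longrightarrow> \<alpha> n * y (Suc n) + \<alpha> (n - 1) * y (n - 1) + \<beta> n * y n = E' * y n"
  shows "(\<lambda>n. x n * y n) sums 0"
proof -
  have x: "x \<longlonglongrightarrow> 0" "(\<lambda>n. x (Suc n)) \<longlonglongrightarrow> 0" and y: "y \<longlonglongrightarrow> 0" "(\<lambda>n. y (Suc n)) \<longlonglongrightarrow> 0"
    using assms(5,6) square_summable_tendsto_0 LIMSEQ_Suc by blast+
  have "(\<lambda>N. x (Suc N) * y N - x N * y (Suc N)) \<longlonglongrightarrow> 0 * 0 - 0 * 0"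
    by (intro tendsto_intros x y)
  then have "(\<lambda>N. \<alpha> N * (x (Suc N) * y N - x N * y (Suc N))) \<longlonglongrightarrow> 0"
    by (intro bounded_mult_tendsto_0[OF assms(3)]) simp
  then have "(\<lambda>N. (E - E') * (\<Sum>n<Suc N. x n * y n)) \<longlonglongrightarrow> 0"
    using assms(1) wronskian_sum[of x y \<alpha> \<beta> E E', OF assms(1,2,7,8)]
    by (simp flip: sum_atLeast1_eq_lessThan del: sum.lessThan_Suc)
  then have "(\<lambda>N. (\<Sum>n<Suc N. x n * y n)) \<longlonglongrightarrow> 0"
    using assms(4) tendsto_mult_left_iff[of "E - E'" _ 0] by force
  then show ?thesis unfolding sums_def by (rule LIMSEQ_imp_Suc)
qed

text \<open>Substituting \<open>f = u * g\<close> removes the potential terms, since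
  \<open>u\<close> solves the equation at every site \<open>n \<ge> 1\<close>, and leaves a weighted
  gradient. The Dirichlet condition is carried by \<open>g\<close>, so the gradient sum starts with
  the bond from 0 to 1.\<close>

lemma ground_state_representation:
  fixes u g a b :: "nat \<Rightarrow> real"
  assumes "g 0 = 0"
    and "\<And>n. n \<ge> 1 \<Longrightarrow> a n * u (Suc n) + a (n - 1) * u (n - 1) + b n * u n = E * u n"
  defines "f \<equiv> \<lambda>n. u n * g n" and "w \<equiv> \<lambda>n. a n * u n * u (Suc n)"
  shows "(\<Sum>n\<in>{1..N}. f n * (a n * f (Suc n) + a (n - 1) * f (n - 1) + b n * f n - E * f n))
    = w N * g N * (g (Suc N) - g N) - (\<Sum>n<N. w n * (g (Suc n) - g n)\<^sup>2)"
proof (induction N)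
  case 0
  then show ?case using assms by simp
next
  case (Suc N)
  have *: "E * u (Suc N) = a (Suc N) * u (Suc (Suc N)) + a N * u N + b (Suc N) * u (Suc N)"
    using assms(2)[of "Suc N"] by simp
  have "f (Suc N) * (a (Suc N) * f (Suc (Suc N)) + a N * f N + b (Suc N) * f (Suc N) - E * f (Suc N))
    = f (Suc N) * (a (Suc N) * f (Suc (Suc N)) + a N * f N + b (Suc N) * f (Suc N) - (E * u (Suc N)) * g (Suc N))"
    by (simp add: f_def)
  also have "\<dots> = g (Suc N) * (w (Suc N) * (g (Suc (Suc N)) - g (Suc N)) - w N * (g (Suc N) - g N))"
    unfolding * by (simp add: f_def w_def algebra_simps)
  finally show ?case using Suc.IH by (simp add: power2_eq_square algebra_simps)
qed

text \<open>A bond occurs in the rows of both its ends, and \<open>2 * x * y \<le> x^2 + y^2\<close>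
  charges its modulus once to either end. The bond from \<open>N\<close> to \<open>N + 1\<close>
  occurs in one row only, for which the last summand corrects.\<close>

lemma perturbation_form_bound:
  fixes f da db :: "nat \<Rightarrow> real"
  assumes "da 0 = 0"
  shows "(\<Sum>n\<in>{1..N}. f n * (da n * f (Suc n) + da (n - 1) * f (n - 1) + db n * f n))
    \<le> (\<Sum>n\<in>{1..N}. (\<bar>da n\<bar> + \<bar>da (n - 1)\<bar> + \<bar>db n\<bar>) * (f n)\<^sup>2)
      + \<bar>da N\<bar> * ((f (Suc N))\<^sup>2 - (f N)\<^sup>2) / 2"
proof (induction N)
  case 0
  then show ?case using assms by simp
next
  case (Suc N)
  have *: "x * (d * y) \<le> \<bar>d\<bar> * (x\<^sup>2 + y\<^sup>2) / 2" for x y d :: real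
  proof -
    have "x * (d * y) \<le> \<bar>d\<bar> * (\<bar>x\<bar> * \<bar>y\<bar>)"
      using abs_ge_self[of "x * (d * y)"] by (simp add: abs_mult mult.left_commute)
    also have "\<dots> \<le> \<bar>d\<bar> * ((x\<^sup>2 + y\<^sup>2) / 2)"
      using sum_squares_bound[of "\<bar>x\<bar>" "\<bar>y\<bar>"] by (intro mult_left_mono) auto
    finally show ?thesis by simp
  qed
  have "f (Suc N) * (db (Suc N) * f (Suc N)) \<le> \<bar>db (Suc N)\<bar> * (f (Suc N))\<^sup>2"
    using mult_right_mono[OF abs_ge_self[of "db (Suc N)"], of "(f (Suc N))\<^sup>2"]
    by (simp add: power2_eq_square ac_simps)
  with Suc.IH *[of "f (Suc N)" "da (Suc N)" "f (Suc (Suc N))"] *[of "f (Suc N)" "da N" "f N"]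
  show ?case by (simp add: algebra_simps add_divide_distrib diff_divide_distrib)
qed

lemma sums_square_linear_combination:
  fixes x :: "nat \<Rightarrow> nat \<Rightarrow> real"
  assumes "\<And>k l. k < K \<Longrightarrow> l < K \<Longrightarrow> (\<lambda>n. x k n * x l n) sums (if k = l then 1 else 0)"
  shows "(\<lambda>n. (\<Sum>k<K. c k * x k n) * (\<Sum>k<K. d k * x k n)) sums (\<Sum>k<K. c k * d k)"
proof -
  have "(\<lambda>n. \<Sum>k<K. \<Sum>l<K. c k * d l * (x k n * x l n)) sums (\<Sum>k<K. \<Sum>l<K. c k * d l * (if k = l then 1 else 0))"
    by (intro sums_sum sums_mult assms) auto
  moreover have "(\<Sum>k<K. \<Sum>l<K. c k * d l * (if k = l then 1 else 0)) = (\<Sum>k<K. c k * d k)"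
    by (intro sum.cong refl) (simp add: if_distrib[of "\<lambda>x. _ * x"] cong: if_cong)
  ultimately show ?thesis by (simp add: sum_product algebra_simps)
qed

text \<open>Bessel's inequality by duality: the sum \<open>T\<close> of the squared coefficients is
  the inner product over \<open>A\<close> of \<open>y\<close> with \<open>f\<close>, the combination
  of the \<open>x k\<close> with these coefficients, and orthonormality on the whole half-line
  bounds the norm of \<open>f\<close> over \<open>A\<close> by \<open>sqrt T\<close>.\<close>

lemma bessel_finite_support:
  fixes x :: "nat \<Rightarrow> nat \<Rightarrow> real"
  assumes on: "\<And>k l. k < K \<Longrightarrow> l < K \<Longrightarrow> (\<lambda>n. x k n * x l n) sums (if k = l then 1 else 0)"
    and "finite A"
  shows "L2_set (\<lambda>k. \<Sum>i\<in>A. y i * x k i) {..<K} \<le> L2_set y A"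
proof -
  define t where "t k = (\<Sum>i\<in>A. y i * x k i)" for k
  define f where "f i = (\<Sum>k<K. t k * x k i)" for i
  define T where "T = (\<Sum>k<K. (t k)\<^sup>2)"
  have T0: "T \<ge> 0" unfolding T_def by (intro sum_nonneg) simp
  have "T = (\<Sum>i\<in>A. y i * f i)"
    by (simp add: T_def t_def[of] f_def power2_eq_square sum_distrib_left sum_distrib_right)
      (subst sum.swap, simp add: ac_simps)
  also have "\<dots> \<le> L2_set y A * L2_set f A" by (rule sum_mult_le_L2_set) fact
  also have "\<dots> \<le> L2_set y A * sqrt T"
  proof (rule mult_left_mono)
    have "(\<lambda>i. (f i)\<^sup>2) sums T"
      using sums_square_linear_combination[OF on, of K t t] by (simp add: f_def T_def power2_eq_square)
    then have "(\<Sum>i\<in>A. (f i)\<^sup>2) \<le> T" using \<open>finite A\<close> by (metis sums_iff sum_le_suminf zero_le_power2)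
    then show "L2_set f A \<le> sqrt T" by (simp add: L2_set_def)
  qed simp
  finally have "sqrt T * sqrt T \<le> L2_set y A * sqrt T" using T0 by simp
  then have "sqrt T \<le> L2_set y A" using T0
    by (metis L2_set_nonneg mult_right_le_imp_le order_le_less real_sqrt_ge_zero)
  then show ?thesis by (simp add: L2_set_def T_def t_def)
qed

text \<open>The form on combinations of eigenvectors satisfies the hypothesis of
  \<open>sum_le_sum_L2_set\<close> with \<open>s k = sqrt (e k) / 2\<close>, where the factor 1/2
  pays for the tail of the perturbation. The bound \<open>S\<close> on the mass is positive so that
  a positive sequence of that size can be added to \<open>V\<close>. The powers of \<open>c\<close>
  come from \<open>\<tau>\<close>, from replacing \<open>f\<close> by \<open>g\<close>, and from
  dividing the window vectors by \<open>u\<close>.\<close>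

lemma lieb_thirring_half_line:
  fixes a b u da db e :: "nat \<Rightarrow> real" and x :: "nat \<Rightarrow> nat \<Rightarrow> real"
  assumes c: "c > 0" and u: "\<And>n. c \<le> u n" "\<And>n. u n \<le> 1 / c" and a: "\<And>n. c \<le> a n" "\<And>n. a n \<le> 1 / c"
    and sol: "\<And>n. n \<ge> 1 \<Longrightarrow> a n * u (Suc n) + a (n - 1) * u (n - 1) + b n * u n = E * u n"
    and da0: "da 0 = 0" and S: "S > 0"
    and mass: "\<And>N. (\<Sum>n\<in>{1..N}. \<bar>da n\<bar> + \<bar>da (n - 1)\<bar> + \<bar>db n\<bar>) \<le> S"
    and x0: "\<And>k. k < K \<Longrightarrow> x k 0 = 0"
    and norm1: "\<And>k. k < K \<Longrightarrow> (\<lambda>n. (x k n)\<^sup>2) sums 1"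
    and eigen: "\<And>k n. k < K \<Longrightarrow> n \<ge> 1 \<Longrightarrow> (a n + da n) * x k (Suc n) +
      (a (n - 1) + da (n - 1)) * x k (n - 1) + (b n + db n) * x k n = (E + e k) * x k n"
    and e: "\<And>k. k < K \<Longrightarrow> e k > 0" "inj_on e {..<K}"
  shows "(\<Sum>k<K. sqrt (e k)) \<le> 32 / (c ^ 3 * sqrt (c ^ 3)) * S"
proof -
  \<comment> \<open>This makes the gradient coefficient \<open>4 * \<tau>\<close> of the windows
    equal to \<open>c ^ 3\<close>, the lower bound for the weights
    \<open>a n * u n * u (Suc n)\<close> of the ground state form.\<close>
  define \<tau> where "\<tau> = c ^ 3 / 4"
  have \<tau>: "\<tau> > 0" using c by (simp add: \<tau>_def)
  define V where "V n = (if n = 0 then 0 else \<bar>da n\<bar> + \<bar>da (n - 1)\<bar> + \<bar>db n\<bar>)" for n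
  have V0: "V n \<ge> 0" for n by (simp add: V_def)
  have Vsum: "(\<Sum>n\<in>{1..N}. V n) \<le> S" for N
    using mass[of N] by (simp add: V_def cong: sum.cong_simp)
  have Vsummable: "summable V"
  proof (rule summableI_nonneg_bounded)
    fix N
    have "(\<Sum>n<N. V n) \<le> (\<Sum>n<Suc N. V n)" using V0 by simp
    then show "(\<Sum>n<N. V n) \<le> S" using Vsum[of N] sum_atLeast1_eq_lessThan[of V N] by (simp add: V_def)
  qed (rule V0)
  have da_le: "\<bar>da n\<bar> \<le> S" for n
  proof (cases "n = 0")
    case False
    then have "\<bar>da n\<bar> \<le> V n" by (simp add: V_def)
    also have "\<dots> \<le> (\<Sum>n\<in>{1..n}. V n)" using False V0 by (intro member_le_sum) auto
    finally show ?thesis using Vsum[of n] by simp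
  qed (use da0 S in simp)
  define \<alpha> where "\<alpha> n = a n + da n" for n
  have \<alpha>_le: "\<bar>\<alpha> n\<bar> \<le> 1 / c + S" for n using a[of n] c da_le[of n] unfolding \<alpha>_def by linarith
  have sq: "summable (\<lambda>n. (x k n)\<^sup>2)" if "k < K" for k using norm1[OF that] sums_summable by blast
  have on: "(\<lambda>n. x k n * x l n) sums (if k = l then 1 else 0)" if "k < K" "l < K" for k l
  proof (cases "k = l")
    case True
    then show ?thesis using norm1[OF that(1)] by (simp add: power2_eq_square)
  next
    case False
    then have "E + e k \<noteq> E + e l" using e(2) that by (auto simp: inj_on_def)
    then have "(\<lambda>n. x k n * x l n) sums 0"
      using that eigen
      by (intro eigenvectors_orthogonal[of "x k" "x l" \<alpha> "1 / c + S" "E + e k" "E + e l" "\<lambda>n. b n + db n"] x0 sq \<alpha>_le)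
        (auto simp: \<alpha>_def)
    then show ?thesis using False by simp
  qed
  \<comment> \<open>The geometric sequence keeps \<open>V'\<close> positive, so that every window
    closes even where the perturbation vanishes; it costs at most another \<open>S\<close>. The
    division accounts for \<open>(u n)\<^sup>2 \<le> 1 / c\<^sup>2\<close>.\<close>
  define V' where "V' n = (V n + S * (1/2) ^ n) / c\<^sup>2" for n
  have V'0: "V' n \<ge> 0" for n using V0 S by (simp add: V'_def)
  have geom: "(\<Sum>n\<in>{1..N}. (1/2::real) ^ n) \<le> 1" for N
  proof -
    have "(\<Sum>n\<in>{1..N}. (1/2::real) ^ n) = 1 - (1/2) ^ N" by (induction N) auto
    then show ?thesis by simp
  qed
  have V'sum: "(\<Sum>n\<in>{1..N}. V' n) \<le> 2 * S / c\<^sup>2" for N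
  proof -
    have "(\<Sum>n\<in>{1..N}. V' n) = ((\<Sum>n\<in>{1..N}. V n) + S * (\<Sum>n\<in>{1..N}. (1/2) ^ n)) / c\<^sup>2"
      by (simp add: V'_def sum.distrib sum_distrib_left flip: sum_divide_distrib)
    also have "\<dots> \<le> (S + S * 1) / c\<^sup>2"
      using S by (intro divide_right_mono add_mono mult_left_mono Vsum geom) auto
    finally show ?thesis by simp
  qed
  have ex: "\<exists>n\<ge>m. real (n + 1 - m) * (\<Sum>j\<in>{m..n}. V' j) \<ge> \<tau>" for m
  proof -
    have Vm: "V' m > 0" using V0[of m] S c by (simp add: V'_def add_nonneg_pos)
    obtain n where n: "real n > \<tau> / V' m" using reals_Archimedean2 by blast
    have "\<tau> \<le> real n * V' m" using n Vm by (simp add: field_simps)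
    also have "\<dots> \<le> real (m + n + 1 - m) * (\<Sum>j\<in>{m..m+n}. V' j)"
      using V'0 by (intro mult_mono member_le_sum) auto
    finally show ?thesis by (intro exI[of _ "m + n"]) auto
  qed
  show ?thesis
  proof (cases "K = 0")
    case True
    then show ?thesis using S c by simp
  next
    case False
    \<comment> \<open>The windows cover a finite stretch, and beyond it \<open>\<theta>\<close>
      absorbs the potential. Three quarters of the smallest \<open>e k\<close> still leave
      \<open>e k - \<theta> \<ge> e k / 4\<close>, the square of
      \<open>sqrt (e k) / 2\<close>.\<close>
    define \<theta> where "\<theta> = 3 / 4 * Min (e ` {..<K})"
    have "Min (e ` {..<K}) \<in> e ` {..<K}" using False by (intro Min_in) auto
    then have \<theta>: "\<theta> > 0" using e(1) by (auto simp: \<theta>_def)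
    have \<theta>_le: "e k / 4 \<le> e k - \<theta>" if "k < K" for k
    proof -
      have "Min (e ` {..<K}) \<le> e k" using that by (intro Min_le) auto
      then show ?thesis by (simp add: \<theta>_def)
    qed
    obtain N0 where N0: "\<And>m n. m \<ge> N0 \<Longrightarrow> norm (\<Sum>i\<in>{m..<n}. V i) < \<theta>"
      using Vsummable \<theta> unfolding summable_Cauchy by blast
    obtain M vs where M: "M \<ge> N0" and vs: "\<forall>v\<in>set vs. \<forall>i. i \<notin> {1..M} \<longrightarrow> v i = 0"
      and window: "\<And>g. (\<Sum>j\<in>{1..M}. V' j * (g j)\<^sup>2) \<le> 4 * \<tau> * (\<Sum>k\<in>{1..<M}. (g (Suc k) - g k)\<^sup>2)
        + (\<Sum>v\<leftarrow>vs. (\<Sum>j\<in>{1..M}. v j * g j)\<^sup>2)"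
      and vnorm: "(\<Sum>v\<leftarrow>vs. L2_set v {1..M}) \<le> 4 / sqrt \<tau> * (\<Sum>j\<in>{1..M}. V' j)"
      using window_decomposition[OF V'0 \<tau> ex, where N = N0] by blast
    \<comment> \<open>The action of the \<open>j\<close>-th window vector, which applies to
      \<open>g = f / u\<close>, on the \<open>k\<close>-th eigenvector.\<close>
    define A where "A k j = (\<Sum>i\<in>{1..M}. (vs ! j) i / u i * x k i)" for k j
    have form: "(\<Sum>k<K. (sqrt (e k) / 2)\<^sup>2 * (d k)\<^sup>2) \<le> (\<Sum>j<length vs. (\<Sum>k<K. A k j * d k)\<^sup>2)" for d
    proof -
      define f where "f n = (\<Sum>k<K. d k * x k n)" for n
      define h where "h n = (\<Sum>k<K. d k * e k * x k n)" for n
      define g where "g n = f n / u n" for n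
      define w where "w n = a n * u n * u (Suc n)" for n
      define R where "R = (\<Sum>j<length vs. (\<Sum>k<K. A k j * d k)\<^sup>2)"
      define d2 where "d2 = (\<Sum>k<K. (d k)\<^sup>2)"
      have upos: "u n > 0" for n using u(1)[of n] c by simp
      have apos: "a n > 0" for n using a(1)[of n] c by simp
      have fg: "f = (\<lambda>n. u n * g n)" using upos by (auto simp: g_def fun_eq_iff less_imp_neq[symmetric])
      have w3: "w n \<ge> c ^ 3" for n
      proof -
        have "c * c * c \<le> a n * u n * u (Suc n)" using u a c upos[of n] upos[of "Suc n"] apos[of n]
          by (intro mult_mono) (auto intro: less_imp_le)
        then show ?thesis by (simp add: w_def power3_eq_cube)
      qed
      have w_le: "\<bar>w n\<bar> \<le> 1 / c * (1 / c) * (1 / c)" for n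
      proof -
        have "w n \<le> 1 / c * (1 / c) * (1 / c)" unfolding w_def
          using u a[of n] c upos[of n] upos[of "Suc n"] apos[of n]
          by (intro mult_mono) (auto intro: less_imp_le)
        moreover have "w n > 0" using w3[of n] c by (smt (verit) zero_less_power)
        ultimately show ?thesis by simp
      qed
      have f0: "f 0 = 0" "g 0 = 0" using x0 by (auto simp: f_def g_def)
      have eq: "(a n + da n) * f (Suc n) + (a (n - 1) + da (n - 1)) * f (n - 1) + (b n + db n) * f n
        = E * f n + h n" if "n \<ge> 1" for n
      proof -
        have "(a n + da n) * f (Suc n) + (a (n - 1) + da (n - 1)) * f (n - 1) + (b n + db n) * f n
          = (\<Sum>k<K. d k * ((a n + da n) * x k (Suc n) + (a (n - 1) + da (n - 1)) * x k (n - 1) + (b n + db n) * x k n))"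
          by (simp add: f_def sum_distrib_left sum.distrib algebra_simps)
        also have "\<dots> = (\<Sum>k<K. d k * ((E + e k) * x k n))"
          using that by (intro sum.cong refl arg_cong2[where f = "(*)"] eigen) auto
        finally show ?thesis by (simp add: f_def h_def sum_distrib_left sum.distrib algebra_simps)
      qed
      have fsums: "(\<lambda>n. (f n)\<^sup>2) sums d2"
        using sums_square_linear_combination[OF on, of K d d] by (simp add: f_def d2_def power2_eq_square)
      have f_le: "(f n)\<^sup>2 \<le> d2" for n
        using fsums sum_le_suminf[of "\<lambda>n. (f n)\<^sup>2" "{n}"] by (auto simp: sums_iff)
      have flim: "f \<longlonglongrightarrow> 0" using fsums square_summable_tendsto_0 sums_summable by blast
      have fh: "(\<lambda>n. f n * h n) sums (\<Sum>k<K. d k * (d k * e k))"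
        unfolding f_def h_def by (rule sums_square_linear_combination[OF on])
      define Q where "Q N = (\<Sum>n\<in>{1..N}. f n * h n)" for N
      have Qlim: "Q \<longlonglongrightarrow> (\<Sum>k<K. d k * (d k * e k))"
      proof -
        have "Q = (\<lambda>N. \<Sum>n<Suc N. f n * h n)"
          unfolding Q_def using f0 by (intro ext sum_atLeast1_eq_lessThan) simp
        then show ?thesis using LIMSEQ_Suc[OF fh[unfolded sums_def]] by (simp only:)
      qed
      \<comment> \<open>The boundary terms at \<open>N\<close> of both summations by parts; they
        vanish in the limit because \<open>f\<close> and \<open>g\<close> tend to 0.\<close>
      define \<eta> where "\<eta> N = w N * (g N * (g (Suc N) - g N)) + \<bar>da N\<bar> * (((f (Suc N))\<^sup>2 - (f N)\<^sup>2) / 2)" for N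
      have glim: "g \<longlonglongrightarrow> 0"
      proof -
        have "(\<lambda>n. (1 / u n) * f n) \<longlonglongrightarrow> 0"
          by (rule bounded_mult_tendsto_0[of _ "1 / c", OF _ flim])
            (use upos u(1) c in \<open>auto simp: divide_simps less_imp_le\<close>)
        then show ?thesis by (simp add: g_def[abs_def])
      qed
      have \<eta>lim: "\<eta> \<longlonglongrightarrow> 0 + 0"
        unfolding \<eta>_def
      proof (intro tendsto_add bounded_mult_tendsto_0[OF w_le] bounded_mult_tendsto_0[of "\<lambda>n. \<bar>da n\<bar>" S])
        have "(\<lambda>n. g n * (g (Suc n) - g n)) \<longlonglongrightarrow> 0 * (0 - 0)" by (intro tendsto_intros glim LIMSEQ_Suc)
        then show "(\<lambda>n. g n * (g (Suc n) - g n)) \<longlonglongrightarrow> 0" by simp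
        have "(\<lambda>n. ((f (Suc n))\<^sup>2 - (f n)\<^sup>2) / 2) \<longlonglongrightarrow> (0\<^sup>2 - 0\<^sup>2) / 2" by (intro tendsto_intros flim LIMSEQ_Suc) auto
        then show "(\<lambda>n. ((f (Suc n))\<^sup>2 - (f n)\<^sup>2) / 2) \<longlonglongrightarrow> 0" by simp
      qed (use da_le in auto)
      have Rg: "(\<Sum>v\<leftarrow>vs. (\<Sum>j\<in>{1..M}. v j * g j)\<^sup>2) = R"
      proof -
        have "(\<Sum>k<K. A k j * d k) = (\<Sum>i\<in>{1..M}. (vs ! j) i * g i)" for j
          by (simp add: A_def g_def f_def sum_distrib_left sum_distrib_right sum_divide_distrib)
            (subst sum.swap, simp add: ac_simps)
        then show ?thesis unfolding R_def by (simp add: sum_list_sum_nth atLeast0LessThan)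
      qed
      have QN: "Q N \<le> R + \<theta> * d2 + \<eta> N" if "N \<ge> M" for N
      proof -
        have "Q N = (\<Sum>n\<in>{1..N}. f n * (a n * f (Suc n) + a (n - 1) * f (n - 1) + b n * f n - E * f n))
            + (\<Sum>n\<in>{1..N}. f n * (da n * f (Suc n) + da (n - 1) * f (n - 1) + db n * f n))"
          unfolding Q_def sum.distrib[symmetric]
        proof (intro sum.cong refl)
          fix n assume "n \<in> {1..N}"
          then have "h n = (a n + da n) * f (Suc n) + (a (n - 1) + da (n - 1)) * f (n - 1) + (b n + db n) * f n - E * f n"
            using eq[of n] by simp
          then show "f n * h n = f n * (a n * f (Suc n) + a (n - 1) * f (n - 1) + b n * f n - E * f n) +
              f n * (da n * f (Suc n) + da (n - 1) * f (n - 1) + db n * f n)"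
            by (simp only: distrib_left[symmetric]) (simp add: ring_distribs)
        qed
        also have "(\<Sum>n\<in>{1..N}. f n * (a n * f (Suc n) + a (n - 1) * f (n - 1) + b n * f n - E * f n))
            = w N * g N * (g (Suc N) - g N) - (\<Sum>n<N. w n * (g (Suc n) - g n)\<^sup>2)"
          using ground_state_representation[of g a u b E N, OF f0(2) sol] unfolding fg w_def by simp
        also have "(\<Sum>n\<in>{1..N}. f n * (da n * f (Suc n) + da (n - 1) * f (n - 1) + db n * f n))
            \<le> (\<Sum>n\<in>{1..N}. (\<bar>da n\<bar> + \<bar>da (n - 1)\<bar> + \<bar>db n\<bar>) * (f n)\<^sup>2) + \<bar>da N\<bar> * ((f (Suc N))\<^sup>2 - (f N)\<^sup>2) / 2"
          by (rule perturbation_form_bound) (rule da0)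
        also have "(\<Sum>n\<in>{1..N}. (\<bar>da n\<bar> + \<bar>da (n - 1)\<bar> + \<bar>db n\<bar>) * (f n)\<^sup>2) = (\<Sum>n\<in>{1..N}. V n * (f n)\<^sup>2)"
          by (intro sum.cong refl) (simp add: V_def)
        also have "\<dots> = (\<Sum>n\<in>{1..M}. V n * (f n)\<^sup>2) + (\<Sum>n\<in>{Suc M..<Suc N}. V n * (f n)\<^sup>2)"
          using that by (subst sum.union_disjoint[symmetric]) (auto intro!: sum.cong)
        also have "(\<Sum>n\<in>{Suc M..<Suc N}. V n * (f n)\<^sup>2) \<le> \<theta> * d2"
        proof -
          have "(\<Sum>n\<in>{Suc M..<Suc N}. V n * (f n)\<^sup>2) \<le> (\<Sum>n\<in>{Suc M..<Suc N}. V n) * d2"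
            unfolding sum_distrib_right by (intro sum_mono mult_left_mono f_le V0)
          also have "\<dots> \<le> \<theta> * d2"
            using N0[of "Suc M" "Suc N"] M by (intro mult_right_mono) (auto simp: d2_def intro: sum_nonneg)
          finally show ?thesis .
        qed
        also have "(\<Sum>n\<in>{1..M}. V n * (f n)\<^sup>2) \<le> (\<Sum>n\<in>{1..M}. V' n * (g n)\<^sup>2)"
        proof (intro sum_mono)
          fix n
          have "V n * (f n)\<^sup>2 = V n * (u n)\<^sup>2 * (g n)\<^sup>2" by (simp add: fg power_mult_distrib)
          also have "\<dots> \<le> V' n * (g n)\<^sup>2"
          proof (rule mult_right_mono)
            have "(u n)\<^sup>2 \<le> (1 / c)\<^sup>2" using u(2)[of n] upos[of n] by (intro power_mono) auto
            then have "V n * (u n)\<^sup>2 \<le> V n * (1 / c)\<^sup>2" by (intro mult_left_mono V0)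
            also have "\<dots> \<le> V' n" using S by (simp add: V'_def power_divide divide_right_mono)
            finally show "V n * (u n)\<^sup>2 \<le> V' n" .
          qed simp
          finally show "V n * (f n)\<^sup>2 \<le> V' n * (g n)\<^sup>2" .
        qed
        also have "\<dots> \<le> c ^ 3 * (\<Sum>k\<in>{1..<M}. (g (Suc k) - g k)\<^sup>2) + R"
          using window[of g] unfolding Rg by (simp add: \<tau>_def)
        also have "c ^ 3 * (\<Sum>k\<in>{1..<M}. (g (Suc k) - g k)\<^sup>2) \<le> (\<Sum>n<N. w n * (g (Suc n) - g n)\<^sup>2)"
        proof -
          have "c ^ 3 * (\<Sum>k\<in>{1..<M}. (g (Suc k) - g k)\<^sup>2) \<le> (\<Sum>k\<in>{1..<M}. w k * (g (Suc k) - g k)\<^sup>2)"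
            unfolding sum_distrib_left by (intro sum_mono mult_right_mono w3) auto
          also have "\<dots> \<le> (\<Sum>n<N. w n * (g (Suc n) - g n)\<^sup>2)"
            using that order_trans[OF _ w3] c by (intro sum_mono2) auto
          finally show ?thesis .
        qed
        finally show ?thesis by (simp add: \<eta>_def algebra_simps)
      qed
      have "(\<Sum>k<K. d k * (d k * e k)) \<le> R + \<theta> * d2 + 0"
      proof (rule LIMSEQ_le[OF Qlim])
        show "(\<lambda>N. R + \<theta> * d2 + \<eta> N) \<longlonglongrightarrow> R + \<theta> * d2 + 0"
          using \<eta>lim by (intro tendsto_intros) simp
      qed (use QN in blast)
      then have "(\<Sum>k<K. (e k - \<theta>) * (d k)\<^sup>2) \<le> R"
        by (simp add: right_diff_distrib d2_def sum_distrib_left left_diff_distrib sum_subtractf power2_eq_square ac_simps)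
      moreover have "(\<Sum>k<K. (sqrt (e k) / 2)\<^sup>2 * (d k)\<^sup>2) \<le> (\<Sum>k<K. (e k - \<theta>) * (d k)\<^sup>2)"
        using e(1) \<theta>_le by (intro sum_mono mult_right_mono) (auto simp: power_divide less_imp_le)
      ultimately show ?thesis unfolding R_def by linarith
    qed
    have "(\<Sum>k<K. sqrt (e k) / 2) \<le> (\<Sum>j<length vs. L2_set (\<lambda>k. A k j) {..<K})"
      using e(1) by (intro sum_le_sum_L2_set form) auto
    also have "\<dots> \<le> (\<Sum>j<length vs. L2_set (vs ! j) {1..M} / c)"
    proof (intro sum_mono)
      fix j
      have "L2_set (\<lambda>k. A k j) {..<K} \<le> L2_set (\<lambda>i. (vs ! j) i / u i) {1..M}"
        unfolding A_def by (rule bessel_finite_support[OF on]) auto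
      also have "\<dots> \<le> L2_set (\<lambda>i. \<bar>(vs ! j) i\<bar> / c) {1..M}"
      proof -
        have "((vs ! j) i / u i)\<^sup>2 \<le> (\<bar>(vs ! j) i\<bar> / c)\<^sup>2" for i
          unfolding power_divide power2_abs using u(1)[of i] c by (intro divide_left_mono power_mono) auto
        then show ?thesis unfolding L2_set_def by (intro real_sqrt_le_mono sum_mono)
      qed
      also have "\<dots> = L2_set (vs ! j) {1..M} / c"
        using c by (simp add: L2_set_def power_divide real_sqrt_divide flip: sum_divide_distrib)
      finally show "L2_set (\<lambda>k. A k j) {..<K} \<le> L2_set (vs ! j) {1..M} / c" .
    qed
    also have "\<dots> = (\<Sum>v\<leftarrow>vs. L2_set v {1..M}) / c"
      by (simp add: sum_list_sum_nth atLeast0LessThan sum_divide_distrib)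
    also have "\<dots> \<le> 4 / sqrt \<tau> * (2 * S / c\<^sup>2) / c"
      using c \<tau> by (intro divide_right_mono order_trans[OF vnorm] mult_left_mono V'sum) auto
    also have "\<dots> = 16 / (c ^ 3 * sqrt (c ^ 3)) * S"
      by (simp add: \<tau>_def real_sqrt_divide power2_eq_square power3_eq_cube)
    finally show ?thesis by (simp flip: sum_divide_distrib)
  qed
qed

section \<open>Ground states of periodic Jacobi matrices\<close>

text \<open>Cantor's diagonal argument over a countable index type. It supplies the periodic
  maximiser and later the limit of the rescaled Green's functions.\<close>

lemma pointwise_convergent_subsequence:
  fixes f :: "nat \<Rightarrow> 'i :: countable \<Rightarrow> real"
  assumes "\<And>k i. \<bar>f k i\<bar> \<le> B i"
  obtains r l where "strict_mono r" "\<And>i. (\<lambda>k. f (r k) i) \<longlonglongrightarrow> l i"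
proof -
  let ?P = "\<lambda>n s. convergent (\<lambda>k. f (s k) (from_nat n :: 'i))"
  interpret D: subseqs ?P
  proof
    fix n :: nat and s :: "nat \<Rightarrow> nat"
    have "bounded (range (\<lambda>k. f (s k) (from_nat n :: 'i)))"
      by (rule boundedI[of _ "B (from_nat n)"]) (use assms in auto)
    then obtain l r where "strict_mono r" "((\<lambda>k. f (s k) (from_nat n :: 'i)) \<circ> r) \<longlonglongrightarrow> l"
      using bounded_imp_convergent_subsequence by blast
    then show "\<exists>r'. strict_mono r' \<and> ?P n (s \<circ> r')"
      by (auto simp: convergent_def o_def)
  qed
  have "convergent (\<lambda>k. f (D.diagseq k) i)" for i
  proof -
    have "?P (to_nat i) (D.diagseq \<circ> (+) (Suc (to_nat i)))"
    proof (rule D.diagseq_holds)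
      fix r s :: "nat \<Rightarrow> nat" and n
      assume "strict_mono r" "?P n s"
      then show "?P n (s \<circ> r)"
        using convergent_subseq_convergent[of "\<lambda>k. f (s k) (from_nat n)" r] by (simp add: o_def)
    qed
    then have "convergent (\<lambda>k. f (D.diagseq (k + Suc (to_nat i))) i)"
      by (simp add: o_def add.commute)
    then show ?thesis using convergent_ignore_initial_segment by blast
  qed
  then have "\<forall>i. \<exists>l. (\<lambda>k. f (D.diagseq k) i) \<longlonglongrightarrow> l" by (simp add: convergent_def)
  then obtain l where "\<And>i. (\<lambda>k. f (D.diagseq k) i) \<longlonglongrightarrow> l i" by metis
  then show thesis using that D.subseq_diagseq by blast
qed

text \<open>One constant \<open>c\<close> bounds \<open>u\<close> and the off-diagonal entries on
  both sides, because the eigenvalue bound is a function of \<open>c\<close> alone. The lower edge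
  is covered by passing to \<open>- b\<close> with \<open>a\<close> unchanged, which amounts to
  alternating the signs of a solution and negating \<open>E\<close>.\<close>

definition regular_ground_state :: "(int \<Rightarrow> int \<Rightarrow> real) \<Rightarrow> (int \<Rightarrow> real) \<Rightarrow> real \<Rightarrow> bool" where
  "regular_ground_state a b E \<longleftrightarrow> (\<exists>u c. c > 0 \<and> (\<forall>n. c \<le> u n \<and> u n \<le> 1 / c) \<and>
     (\<forall>n. c \<le> a n (n + 1) \<and> a n (n + 1) \<le> 1 / c) \<and>
     (\<forall>n. a n (n + 1) * u (n + 1) + a (n - 1) n * u (n - 1) + b n * u n = E * u n))"

text \<open>The first-order condition at a maximum: \<open>t = A / D\<close> with \<open>D\<close>
  larger than the modulus of \<open>C\<close> is small enough for the linear term to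
  dominate.\<close>

lemma zero_of_quadratic_le:
  fixes A C :: real
  assumes "\<And>t. 2 * t * A + t\<^sup>2 * C \<le> 0"
  shows "A = 0"
proof -
  define D where "D = \<bar>C\<bar> + 1"
  have D: "D > 0" "\<bar>C\<bar> < D" by (auto simp: D_def)
  have "2 * (A / D) * A + (A / D)\<^sup>2 * C \<le> 0" by (rule assms)
  then have "(2 * (A / D) * A + (A / D)\<^sup>2 * C) * D\<^sup>2 \<le> 0" using D by (simp add: mult_nonpos_nonneg)
  moreover have "(2 * (A / D) * A + (A / D)\<^sup>2 * C) * D\<^sup>2 = A\<^sup>2 * (2 * D + C)"
    using D by (simp add: power2_eq_square field_simps)
  ultimately have "A\<^sup>2 * (2 * D + C) \<le> 0" by simp
  moreover have "2 * D + C > 0" using D by linarith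
  ultimately have "A\<^sup>2 \<le> 0" by (simp add: mult_le_0_iff)
  then show ?thesis by simp
qed

lemma periodic_multiple:
  fixes h :: "int \<Rightarrow> 'a"
  assumes "\<And>l. h (l + p) = h l"
  shows "h (l + k * p) = h l"
proof (induction k rule: int_induct[where k = 0])
  case (step1 i)
  then show ?case using assms[of "l + i * p"] by (simp add: algebra_simps)
next
  case (step2 i)
  then show ?case using assms[of "l + (i - 1) * p"] by (simp add: algebra_simps)
qed simp

lemma periodic_mod:
  fixes h :: "int \<Rightarrow> 'a"
  assumes "\<And>l. h (l + p) = h l"
  shows "h (l mod p) = h l"
  using periodic_multiple[of h p "l mod p" "l div p", OF assms] by (simp add: mod_div_mult_eq add.commute)

lemma periodic_sum_shift:
  fixes h :: "int \<Rightarrow> real"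
  assumes "p \<ge> 1" "\<And>l. h (l + p) = h l"
  shows "(\<Sum>l\<in>{0..<p}. h (l + 1)) = (\<Sum>l\<in>{0..<p}. h l)"
proof -
  have "(\<Sum>l\<in>{0..<p}. h (l + 1)) = (\<Sum>l\<in>{1..<p+1}. h l)"
    by (rule sum.reindex_bij_witness[of _ "\<lambda>l. l - 1" "\<lambda>l. l + 1"]) auto
  also have "{1..<p+1} = insert p {1..<p}" using assms(1) by auto
  also have "sum h \<dots> = h 0 + sum h {1..<p}" using assms(2)[of 0] by simp
  also have "\<dots> = sum h (insert 0 {1..<p})" by simp
  also have "insert 0 {1..<p} = {0..<p}" using assms(1) by auto
  finally show ?thesis .
qed

text \<open>A discrete strong maximum principle: at a zero of \<open>u\<close> the equation makes a
  sum of two nonnegative terms vanish, so both neighbours are zeros and the zero spreads over the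
  line.\<close>

lemma positive_of_nonneg_solution:
  fixes \<alpha> \<beta> u :: "int \<Rightarrow> real"
  assumes \<alpha>: "\<And>n. \<alpha> n > 0" and u: "\<And>n. u n \<ge> 0"
    and eq: "\<And>n. \<alpha> n * u (n + 1) + \<alpha> (n - 1) * u (n - 1) = \<beta> n * u n"
    and "u m \<noteq> 0"
  shows "u n > 0"
proof (rule ccontr)
  assume "\<not> u n > 0"
  then have un: "u n = 0" using u[of n] by simp
  have step: "u (k + 1) = 0 \<and> u (k - 1) = 0" if "u k = 0" for k
  proof -
    have "\<alpha> k * u (k + 1) + \<alpha> (k - 1) * u (k - 1) = 0" using eq[of k] that by simp
    moreover have "\<alpha> k * u (k + 1) \<ge> 0" "\<alpha> (k - 1) * u (k - 1) \<ge> 0"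
      using \<alpha> u by (simp_all add: less_imp_le)
    ultimately have "\<alpha> k * u (k + 1) = 0" "\<alpha> (k - 1) * u (k - 1) = 0" by linarith+
    then show ?thesis using \<alpha>[of k] \<alpha>[of "k - 1"] by simp
  qed
  have "u m = 0"
    by (induction m rule: int_induct[where k = n]) (use un step in auto)
  then show False using assms(4) by simp
qed

text \<open>
  The top of the spectrum on the space of periodic sequences: a maximiser of the quadratic form
  may be taken nonnegative and is then a positive periodic solution on the whole line.
\<close>

lemma periodic_perron:
  fixes \<alpha> \<beta> :: "int \<Rightarrow> real"
  assumes p: "p \<ge> 1" and \<alpha>p: "\<And>l. \<alpha> (l + p) = \<alpha> l" and \<beta>p: "\<And>l. \<beta> (l + p) = \<beta> l" and \<alpha>: "\<And>l. \<alpha> l > 0"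
  obtains x E where "\<And>l. x (l + p) = x l" "\<And>l. x l > 0"
    "\<And>l. \<alpha> l * x (l + 1) + \<alpha> (l - 1) * x (l - 1) + \<beta> l * x l = E * x l"
proof -
  define I where "I = {0..<p}"
  have I: "finite I" by (simp add: I_def)
  define P where "P x \<longleftrightarrow> (\<forall>l. x (l + p) = x l)" for x :: "int \<Rightarrow> real"
  define F where "F x = (\<Sum>l\<in>I. 2 * \<alpha> l * x l * x (l + 1) + \<beta> l * (x l)\<^sup>2)" for x
  define N where "N x = (\<Sum>l\<in>I. (x l)\<^sup>2)" for x :: "int \<Rightarrow> real"
  define X where "X = {x. P x \<and> N x = 1}"
  have x_le: "\<bar>x l\<bar> \<le> 1" if "x \<in> X" for x l
  proof -
    have "(x (l mod p))\<^sup>2 \<le> N x"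
      unfolding N_def using p by (intro member_le_sum) (auto simp: I_def)
    moreover have "x (l mod p) = x l" using that by (intro periodic_mod) (auto simp: X_def P_def)
    ultimately show ?thesis using that by (simp add: X_def abs_square_le_1)
  qed
  have F_le: "F x \<le> (\<Sum>l\<in>I. 2 * \<alpha> l + \<bar>\<beta> l\<bar>)" if "x \<in> X" for x
    unfolding F_def
  proof (intro sum_mono add_mono)
    fix l
    have "x l * x (l + 1) \<le> \<bar>x l\<bar> * \<bar>x (l + 1)\<bar>" by (metis abs_ge_self abs_mult)
    also have "\<dots> \<le> 1 * 1" using x_le[OF that] by (intro mult_mono) auto
    finally show "2 * \<alpha> l * x l * x (l + 1) \<le> 2 * \<alpha> l"
      using \<alpha>[of l] by (simp add: mult.assoc mult_left_le)
    have "\<beta> l * (x l)\<^sup>2 \<le> \<bar>\<beta> l\<bar> * (x l)\<^sup>2" by (intro mult_right_mono) auto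
    also have "\<dots> \<le> \<bar>\<beta> l\<bar> * 1" using x_le[OF that, of l] by (intro mult_left_mono) (auto simp: abs_square_le_1)
    finally show "\<beta> l * (x l)\<^sup>2 \<le> \<bar>\<beta> l\<bar>" by simp
  qed
  have bdd: "bdd_above (F ` X)" using F_le by (auto simp: bdd_above_def)
  define E where "E = Sup (F ` X)"
  have "(\<lambda>l. 1 / sqrt p) \<in> X"
    using p by (simp add: X_def P_def N_def I_def power_divide)
  then have XE: "X \<noteq> {}" by auto
  have "\<exists>x\<in>X. F x > E - 1 / Suc k" for k
    using less_cSupE[of "E - 1 / Suc k" "F ` X"] XE by (auto simp: E_def)
  then obtain y where y: "\<And>k. y k \<in> X" "\<And>k. F (y k) > E - 1 / Suc k" by metis
  obtain r z where r: "strict_mono r" and z: "\<And>i. (\<lambda>k. y (r k) i) \<longlonglongrightarrow> z i"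
    using pointwise_convergent_subsequence[of y "\<lambda>_. 1"] x_le y(1) by blast
  have zX: "z \<in> X"
  proof -
    have "z (l + p) = z l" for l
      using LIMSEQ_unique[OF z[of l]] z[of "l + p"] y(1) by (simp add: X_def P_def)
    moreover have "(\<lambda>k. N (y (r k))) \<longlonglongrightarrow> N z" unfolding N_def by (intro tendsto_intros z)
    then have "N z = 1" using y(1) LIMSEQ_unique[of "\<lambda>_. 1"] by (auto simp: X_def)
    ultimately show ?thesis by (simp add: X_def P_def)
  qed
  have "F z \<ge> E"
  proof (rule LIMSEQ_le)
    show "(\<lambda>k. F (y (r k))) \<longlonglongrightarrow> F z" unfolding F_def by (intro tendsto_intros z)
    have "(\<lambda>k. E - 1 / Suc (r k)) \<longlonglongrightarrow> E - 0"
      using LIMSEQ_subseq_LIMSEQ[OF LIMSEQ_inverse_real_of_nat r]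
      by (intro tendsto_intros) (simp add: o_def inverse_eq_divide)
    then show "(\<lambda>k. E - 1 / Suc (r k)) \<longlonglongrightarrow> E" by simp
  qed (use y(2) in \<open>auto intro: less_imp_le\<close>)
  \<comment> \<open>Absolute values preserve the norm and can only raise the form, as every
    \<open>\<alpha> l\<close> is positive.\<close>
  define x where "x l = \<bar>z l\<bar>" for l
  have xX: "x \<in> X" using zX by (auto simp: X_def x_def P_def N_def)
  then have xP: "x (l + p) = x l" for l by (auto simp: X_def P_def)
  have le: "F y \<le> E * N y" if "P y" for y
  proof (cases "N y = 0")
    case True
    then have "y l = 0" if "l \<in> I" for l using that I by (auto simp: N_def sum_nonneg_eq_0_iff)
    then show ?thesis using True by (simp add: F_def)
  next
    case False
    moreover have "N y \<ge> 0" by (auto simp: N_def intro: sum_nonneg)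
    ultimately have pos: "N y > 0" by simp
    define s where "s = 1 / sqrt (N y)"
    have s2: "s\<^sup>2 = 1 / N y" using pos by (simp add: s_def power_divide)
    have "N (\<lambda>l. s * y l) = s\<^sup>2 * N y" by (simp add: N_def power_mult_distrib sum_distrib_left)
    then have "(\<lambda>l. s * y l) \<in> X" using that pos s2 by (simp add: X_def P_def)
    then have "F (\<lambda>l. s * y l) \<le> E" unfolding E_def by (intro cSup_upper bdd) auto
    moreover have "F (\<lambda>l. s * y l) = s\<^sup>2 * F y"
      by (simp add: F_def sum_distrib_left power2_eq_square algebra_simps)
    ultimately show ?thesis using pos s2 by (simp add: field_simps)
  qed
  have Fx: "F x \<ge> E"
  proof -
    have "F z \<le> F x"
      unfolding F_def x_def
    proof (intro sum_mono add_mono)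
      fix l
      have "z l * z (l + 1) \<le> \<bar>z l\<bar> * \<bar>z (l + 1)\<bar>" by (metis abs_ge_self abs_mult)
      then show "2 * \<alpha> l * z l * z (l + 1) \<le> 2 * \<alpha> l * \<bar>z l\<bar> * \<bar>z (l + 1)\<bar>"
        using \<alpha>[of l] by (simp add: mult.assoc)
    qed simp
    then show ?thesis using \<open>F z \<ge> E\<close> by simp
  qed
  define J where "J l = \<alpha> l * x (l + 1) + \<alpha> (l - 1) * x (l - 1) + \<beta> l * x l" for l
  have Jp: "J (l + p) = J l" for l
    using xP[of "l + 1"] xP[of "l - 1"] \<alpha>p[of "l - 1"] by (simp add: J_def xP \<alpha>p \<beta>p algebra_simps)
  have J_eq: "J j = E * x j" if j: "j \<in> I" for j
  proof -
    \<comment> \<open>The test direction is the indicator of a residue class, so that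
      \<open>x + t * d\<close> stays periodic.\<close>
    define d where "d l = (if l mod p = j then 1 else 0 :: real)" for l
    have dp: "d (l + p) = d l" for l by (simp add: d_def)
    have dI: "d l = (if l = j then 1 else 0)" if "l \<in> I" for l using that by (auto simp: d_def I_def)
    have "2 * t * (J j - E * x j) + t\<^sup>2 * (F d - E) \<le> 0" for t
    proof -
      have Ny: "N (\<lambda>l. x l + t * d l) = 1 + 2 * t * x j + t\<^sup>2"
      proof -
        have "N (\<lambda>l. x l + t * d l) = (\<Sum>l\<in>I. (x l)\<^sup>2 + (if l = j then 2 * t * x l + t\<^sup>2 else 0))"
          unfolding N_def by (intro sum.cong refl) (auto simp: dI power2_eq_square algebra_simps)
        then show ?thesis using j I xX by (simp add: sum.distrib X_def N_def)
      qed
      \<comment> \<open>Moving the summation by one site over a full period turns the coupling to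
        \<open>d (l + 1)\<close> into the term of \<open>J\<close> with
        \<open>\<alpha> (l - 1)\<close>.\<close>
      have shift: "(\<Sum>l\<in>I. \<alpha> l * x l * d (l + 1)) = (\<Sum>l\<in>I. \<alpha> (l - 1) * x (l - 1) * d l)"
        unfolding I_def using periodic_sum_shift[of p "\<lambda>l. \<alpha> (l - 1) * x (l - 1) * d l", OF p]
          \<alpha>p[of "_ - 1"] xP[of "_ - 1"] dp by (simp add: algebra_simps)
      have "F (\<lambda>l. x l + t * d l) = F x + 2 * t * ((\<Sum>l\<in>I. \<alpha> l * x l * d (l + 1))
          + (\<Sum>l\<in>I. (\<alpha> l * x (l + 1) + \<beta> l * x l) * d l)) + t\<^sup>2 * F d"
        by (simp add: F_def sum_distrib_left algebra_simps power2_eq_square flip: sum.distrib)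
      also have "(\<Sum>l\<in>I. \<alpha> l * x l * d (l + 1)) + (\<Sum>l\<in>I. (\<alpha> l * x (l + 1) + \<beta> l * x l) * d l) = (\<Sum>l\<in>I. J l * d l)"
        unfolding shift by (simp add: J_def algebra_simps flip: sum.distrib)
      also have "\<dots> = (\<Sum>l\<in>I. if l = j then J l else 0)" by (intro sum.cong refl) (simp add: dI)
      also have "\<dots> = J j" using j I by simp
      finally have "F x + 2 * t * J j + t\<^sup>2 * F d \<le> E * (1 + 2 * t * x j + t\<^sup>2)"
        using le[of "\<lambda>l. x l + t * d l"] Ny by (simp add: P_def xP dp)
      then show ?thesis using Fx by (simp add: algebra_simps)
    qed
    from zero_of_quadratic_le[OF this] show ?thesis by simp
  qed
  have eq: "J l = E * x l" for l
  proof -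
    have "J (l mod p) = E * x (l mod p)" using p by (intro J_eq) (auto simp: I_def)
    then show ?thesis using periodic_mod[of J p l, OF Jp] periodic_mod[of x p l, OF xP] by simp
  qed
  have "\<exists>m. x m \<noteq> 0"
  proof (rule ccontr)
    assume "\<nexists>m. x m \<noteq> 0"
    then show False using xX by (simp add: X_def N_def)
  qed
  then obtain m where "x m \<noteq> 0" by blast
  then have "x l > 0" for l
    using eq by (intro positive_of_nonneg_solution[of \<alpha> x "\<lambda>l. E - \<beta> l" m l] \<alpha>)
      (auto simp: x_def J_def algebra_simps)
  then show thesis using that[of x E] xP eq by (simp add: J_def)
qed

lemma periodic_bounds:
  fixes h :: "int \<Rightarrow> real"
  assumes "p \<ge> 1" "\<And>l. h (l + p) = h l" "\<And>l. h l > 0"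
  obtains c where "c > 0" "\<And>l. c \<le> h l" "\<And>l. h l \<le> 1 / c"
proof -
  have h: "h l \<in> h ` {0..<p}" for l
    using periodic_mod[of h p l] assms by (metis atLeastLessThan_iff imageI mod_pos_pos_trivial
        Euclidean_Rings.pos_mod_bound Euclidean_Rings.pos_mod_sign zero_less_one order_less_le_trans)
  define A where "A = Min (h ` {0..<p})"
  define B where "B = Max (h ` {0..<p})"
  have "A \<in> h ` {0..<p}" unfolding A_def using assms(1) by (intro Min_in) auto
  then have A: "A > 0" using assms(3) by auto
  have AB: "A \<le> h l" "h l \<le> B" for l unfolding A_def B_def using h by auto
  have B: "B > 0" using AB[of 0] assms(3)[of 0] by simp
  show thesis
  proof (rule that[of "min A (1 / B)"])
    show "h l \<le> 1 / min A (1 / B)" for l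
    proof -
      have "B \<le> 1 / min A (1 / B)" using A B by (simp add: le_divide_eq min_def field_simps)
      then show ?thesis using AB(2)[of l] by simp
    qed
  qed (use A B AB in \<open>auto simp: min.coboundedI1\<close>)
qed

lemma periodic_regular_ground_state:
  assumes "periodic_jacobi a b"
  shows "\<exists>E. regular_ground_state a b E"
proof -
  define \<alpha> where "\<alpha> l = a l (l + 1)" for l
  obtain p where p: "p \<ge> 1" and ap: "\<And>l. \<alpha> (l + p) = \<alpha> l" and bp: "\<And>l. b (l + p) = b l"
    using assms unfolding periodic_jacobi_def \<alpha>_def by (auto simp: algebra_simps)
  have \<alpha>: "\<alpha> l > 0" for l using assms by (auto simp: periodic_jacobi_def jacobi_parameters_def \<alpha>_def)
  obtain x E where x: "\<And>l. x (l + p) = x l" "\<And>l. x l > 0"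
    "\<And>l. \<alpha> l * x (l + 1) + \<alpha> (l - 1) * x (l - 1) + b l * x l = E * x l"
    using periodic_perron[of p \<alpha> b, OF p ap bp \<alpha>] by metis
  obtain c where c: "c > 0" "\<And>l. c \<le> x l" "\<And>l. x l \<le> 1 / c" using periodic_bounds[of p x, OF p x(1,2)] by blast
  obtain d where d: "d > 0" "\<And>l. d \<le> \<alpha> l" "\<And>l. \<alpha> l \<le> 1 / d" using periodic_bounds[of p \<alpha>, OF p ap \<alpha>] by blast
  define e where "e = min c d"
  have e: "e > 0" "e \<le> c" "e \<le> d" "1 / c \<le> 1 / e" "1 / d \<le> 1 / e"
    using c d by (auto simp: e_def intro!: divide_left_mono)
  have "e \<le> x n \<and> x n \<le> 1 / e" "e \<le> \<alpha> n \<and> \<alpha> n \<le> 1 / e" for n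
    using e c(2,3)[of n] d(2,3)[of n] by linarith+
  then show ?thesis
    unfolding regular_ground_state_def using e(1) x(3)
    by (intro exI[of _ E] exI[of _ x] exI[of _ e]) (auto simp: \<alpha>_def)
qed

section \<open>Square-summable sequences and tridiagonal operators\<close>

lemma ell2_sum_le:
  assumes "\<phi> \<in> ell2 UNIV" "finite F"
  shows "(\<Sum>i\<in>F. (cmod (\<phi> i))\<^sup>2) \<le> (ell2_norm UNIV \<phi>)\<^sup>2"
proof -
  have "(\<Sum>i\<in>F. (cmod (\<phi> i))\<^sup>2) \<le> (\<Sum>\<^sub>\<infinity>i. (cmod (\<phi> i))\<^sup>2)"
    using assms by (intro finite_sum_le_infsum) (auto simp: ell2_def)
  moreover have "(\<Sum>\<^sub>\<infinity>i. (cmod (\<phi> i))\<^sup>2) \<ge> 0" by (intro infsum_nonneg) auto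
  ultimately show ?thesis by (simp add: ell2_norm_def)
qed

lemma ell2_norm_nonneg [simp]: "ell2_norm S \<phi> \<ge> 0"
  by (simp add: ell2_norm_def infsum_nonneg)

lemma ell2_norm_power2: "(ell2_norm S \<phi>)\<^sup>2 = (\<Sum>\<^sub>\<infinity>i\<in>S. (cmod (\<phi> i))\<^sup>2)"
  by (simp add: ell2_norm_def infsum_nonneg)

lemma ell2_L2_set_le:
  assumes "\<phi> \<in> ell2 UNIV" "finite F"
  shows "L2_set (\<lambda>i. cmod (\<phi> i)) F \<le> ell2_norm UNIV \<phi>"
  unfolding L2_set_def using ell2_sum_le[OF assms] by (simp add: real_le_lsqrt)

text \<open>For sums, dominated sequences, shifts and unit vectors, this obtains membership and the
  norm bound together from estimates of \<open>L2_set\<close> on finite sets.\<close>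

lemma ell2_bounded_partial_sums:
  assumes "\<And>F. finite F \<Longrightarrow> L2_set (\<lambda>i. cmod (\<phi> i)) F \<le> B"
  shows "\<phi> \<in> ell2 UNIV" "ell2_norm UNIV \<phi> \<le> B"
proof -
  have B: "B \<ge> 0" using assms[of "{}"] by simp
  have le: "(\<Sum>i\<in>F. (cmod (\<phi> i))\<^sup>2) \<le> B\<^sup>2" if "finite F" for F
  proof -
    have "(L2_set (\<lambda>i. cmod (\<phi> i)) F)\<^sup>2 \<le> B\<^sup>2" using assms[OF that] by (intro power_mono) auto
    then show ?thesis by (simp add: L2_set_def sum_nonneg)
  qed
  have s: "(\<lambda>i. (cmod (\<phi> i))\<^sup>2) summable_on UNIV"
    by (rule nonneg_bounded_partial_sums_imp_summable_on[of _ _ "B\<^sup>2"])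
      (auto intro!: eventually_finite_subsets_at_top_weakI le)
  then show "\<phi> \<in> ell2 UNIV" by (simp add: ell2_def)
  have "(\<Sum>\<^sub>\<infinity>i. (cmod (\<phi> i))\<^sup>2) \<le> B\<^sup>2" by (rule infsum_le_finite_sums[OF s]) (use le in auto)
  then show "ell2_norm UNIV \<phi> \<le> B" using B by (simp add: ell2_norm_def real_le_lsqrt)
qed

lemma cmod_le_ell2_norm:
  assumes "\<phi> \<in> ell2 UNIV"
  shows "cmod (\<phi> i) \<le> ell2_norm UNIV \<phi>"
  using ell2_L2_set_le[OF assms, of "{i}"] by (simp add: L2_set_def)

lemma ell2_add:
  assumes "\<phi> \<in> ell2 UNIV" "\<psi> \<in> ell2 UNIV"
  shows "(\<lambda>i. \<phi> i + \<psi> i) \<in> ell2 UNIV"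
    and "ell2_norm UNIV (\<lambda>i. \<phi> i + \<psi> i) \<le> ell2_norm UNIV \<phi> + ell2_norm UNIV \<psi>"
proof -
  have *: "L2_set (\<lambda>i. cmod (\<phi> i + \<psi> i)) F \<le> ell2_norm UNIV \<phi> + ell2_norm UNIV \<psi>" if "finite F" for F
  proof -
    have "L2_set (\<lambda>i. cmod (\<phi> i + \<psi> i)) F \<le> L2_set (\<lambda>i. cmod (\<phi> i) + cmod (\<psi> i)) F"
      by (intro L2_set_mono norm_triangle_ineq) auto
    also have "\<dots> \<le> L2_set (\<lambda>i. cmod (\<phi> i)) F + L2_set (\<lambda>i. cmod (\<psi> i)) F" by (rule L2_set_triangle_ineq)
    also have "\<dots> \<le> ell2_norm UNIV \<phi> + ell2_norm UNIV \<psi>"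
      using that assms by (intro add_mono ell2_L2_set_le)
    finally show ?thesis .
  qed
  show "(\<lambda>i. \<phi> i + \<psi> i) \<in> ell2 UNIV"
    "ell2_norm UNIV (\<lambda>i. \<phi> i + \<psi> i) \<le> ell2_norm UNIV \<phi> + ell2_norm UNIV \<psi>"
    by (rule ell2_bounded_partial_sums[OF *], assumption)+
qed

lemma ell2_dominated:
  assumes "\<phi> \<in> ell2 UNIV" "\<And>i. cmod (\<psi> i) \<le> B * cmod (\<phi> i)" "B \<ge> 0"
  shows "\<psi> \<in> ell2 UNIV" "ell2_norm UNIV \<psi> \<le> B * ell2_norm UNIV \<phi>"
proof -
  have *: "L2_set (\<lambda>i. cmod (\<psi> i)) F \<le> B * ell2_norm UNIV \<phi>" if "finite F" for F
  proof -
    have "L2_set (\<lambda>i. cmod (\<psi> i)) F \<le> L2_set (\<lambda>i. B * cmod (\<phi> i)) F" by (intro L2_set_mono assms) auto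
    also have "\<dots> = B * L2_set (\<lambda>i. cmod (\<phi> i)) F" using assms(3) by (simp add: L2_set_right_distrib)
    also have "\<dots> \<le> B * ell2_norm UNIV \<phi>" using assms that by (intro mult_left_mono ell2_L2_set_le)
    finally show ?thesis .
  qed
  show "\<psi> \<in> ell2 UNIV" "ell2_norm UNIV \<psi> \<le> B * ell2_norm UNIV \<phi>"
    by (rule ell2_bounded_partial_sums[OF *], assumption)+
qed

lemma ell2_scale:
  assumes "\<phi> \<in> ell2 UNIV"
  shows "(\<lambda>i. z * \<phi> i) \<in> ell2 UNIV" "ell2_norm UNIV (\<lambda>i. z * \<phi> i) = cmod z * ell2_norm UNIV \<phi>"
proof -
  show "(\<lambda>i. z * \<phi> i) \<in> ell2 UNIV"
    by (rule ell2_dominated(1)[OF assms, of _ "cmod z"]) (auto simp: norm_mult)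
  show "ell2_norm UNIV (\<lambda>i. z * \<phi> i) = cmod z * ell2_norm UNIV \<phi>"
    by (simp add: ell2_norm_def norm_mult power_mult_distrib infsum_cmult_right' real_sqrt_mult)
qed

lemma ell2_diff:
  assumes "\<phi> \<in> ell2 UNIV" "\<psi> \<in> ell2 UNIV"
  shows "(\<lambda>i. \<phi> i - \<psi> i) \<in> ell2 UNIV"
    and "ell2_norm UNIV (\<lambda>i. \<phi> i - \<psi> i) \<le> ell2_norm UNIV \<phi> + ell2_norm UNIV \<psi>"
  using ell2_add[OF assms(1) ell2_scale(1)[OF assms(2), of "-1"]] ell2_scale(2)[OF assms(2), of "-1"] by auto

lemma ell2_cnj:
  assumes "\<phi> \<in> ell2 UNIV"
  shows "(\<lambda>i. cnj (\<phi> i)) \<in> ell2 UNIV"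
  using assms by (simp add: ell2_def)

lemma ell2_shift:
  fixes \<phi> :: "int \<Rightarrow> complex"
  assumes "\<phi> \<in> ell2 UNIV"
  shows "(\<lambda>i. \<phi> (i + k)) \<in> ell2 UNIV" "ell2_norm UNIV (\<lambda>i. \<phi> (i + k)) \<le> ell2_norm UNIV \<phi>"
proof -
  have *: "L2_set (\<lambda>i. cmod (\<phi> (i + k))) F \<le> ell2_norm UNIV \<phi>" if "finite F" for F
  proof -
    have "L2_set (\<lambda>i. cmod (\<phi> (i + k))) F = L2_set (\<lambda>i. cmod (\<phi> i)) ((\<lambda>i. i + k) ` F)"
      unfolding L2_set_def by (subst sum.reindex) auto
    also have "\<dots> \<le> ell2_norm UNIV \<phi>" using that assms by (intro ell2_L2_set_le) auto
    finally show ?thesis .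
  qed
  show "(\<lambda>i. \<phi> (i + k)) \<in> ell2 UNIV" "ell2_norm UNIV (\<lambda>i. \<phi> (i + k)) \<le> ell2_norm UNIV \<phi>"
    by (rule ell2_bounded_partial_sums[OF *], assumption)+
qed

lemma unit_seq_ell2: "unit_seq n \<in> ell2 UNIV" "ell2_norm UNIV (unit_seq n) = 1"
proof -
  have "L2_set (\<lambda>i. cmod (unit_seq n i)) F \<le> 1" if "finite F" for F
    using that by (simp add: L2_set_def unit_seq_def if_distrib[of "\<lambda>x. x^2"] if_distrib[of cmod] cong: if_cong)
  then show 1: "unit_seq n \<in> ell2 UNIV" and "ell2_norm UNIV (unit_seq n) = 1"
    using ell2_bounded_partial_sums[of "unit_seq n" 1] cmod_le_ell2_norm[of "unit_seq n" n]
    by (auto simp: unit_seq_def)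
qed

lemma ell2_inner_abs_summable:
  assumes "\<phi> \<in> ell2 UNIV" "\<psi> \<in> ell2 UNIV"
  shows "(\<lambda>i. cmod (cnj (\<phi> i) * \<psi> i)) summable_on UNIV"
proof (rule nonneg_bounded_partial_sums_imp_summable_on[of _ _ "ell2_norm UNIV \<phi> * ell2_norm UNIV \<psi>"])
  show "\<forall>\<^sub>F F in finite_subsets_at_top UNIV. (\<Sum>i\<in>F. cmod (cnj (\<phi> i) * \<psi> i)) \<le> ell2_norm UNIV \<phi> * ell2_norm UNIV \<psi>"
  proof (rule eventually_finite_subsets_at_top_weakI)
    fix F :: "'a set" assume F: "finite F"
    have "(\<Sum>i\<in>F. cmod (cnj (\<phi> i) * \<psi> i)) \<le> L2_set (\<lambda>i. cmod (\<phi> i)) F * L2_set (\<lambda>i. cmod (\<psi> i)) F"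
      using L2_set_mult_ineq[of "\<lambda>i. cmod (\<phi> i)" "\<lambda>i. cmod (\<psi> i)" F] by (simp add: norm_mult)
    also have "\<dots> \<le> ell2_norm UNIV \<phi> * ell2_norm UNIV \<psi>"
      using assms F by (intro mult_mono ell2_L2_set_le) auto
    finally show "(\<Sum>i\<in>F. cmod (cnj (\<phi> i) * \<psi> i)) \<le> ell2_norm UNIV \<phi> * ell2_norm UNIV \<psi>" .
  qed
qed auto

lemma ell2_inner_summable:
  assumes "\<phi> \<in> ell2 UNIV" "\<psi> \<in> ell2 UNIV"
  shows "(\<lambda>i. cnj (\<phi> i) * \<psi> i) summable_on UNIV"
  by (rule abs_summable_summable[OF ell2_inner_abs_summable[OF assms]])

lemma ell2_cauchy_schwarz:
  assumes "\<phi> \<in> ell2 UNIV" "\<psi> \<in> ell2 UNIV"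
  shows "cmod (ell2_inner UNIV \<phi> \<psi>) \<le> ell2_norm UNIV \<phi> * ell2_norm UNIV \<psi>"
proof -
  have "cmod (ell2_inner UNIV \<phi> \<psi>) \<le> (\<Sum>\<^sub>\<infinity>i. cmod (cnj (\<phi> i) * \<psi> i))"
    unfolding ell2_inner_def by (rule norm_infsum_bound[OF ell2_inner_abs_summable[OF assms]])
  also have "\<dots> \<le> ell2_norm UNIV \<phi> * ell2_norm UNIV \<psi>"
  proof (rule infsum_le_finite_sums[OF ell2_inner_abs_summable[OF assms]])
    fix F :: "'a set" assume F: "finite F"
    have "(\<Sum>i\<in>F. cmod (cnj (\<phi> i) * \<psi> i)) \<le> L2_set (\<lambda>i. cmod (\<phi> i)) F * L2_set (\<lambda>i. cmod (\<psi> i)) F"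
      using L2_set_mult_ineq[of "\<lambda>i. cmod (\<phi> i)" "\<lambda>i. cmod (\<psi> i)" F] by (simp add: norm_mult)
    also have "\<dots> \<le> ell2_norm UNIV \<phi> * ell2_norm UNIV \<psi>"
      using assms F by (intro mult_mono ell2_L2_set_le) auto
    finally show "(\<Sum>i\<in>F. cmod (cnj (\<phi> i) * \<psi> i)) \<le> ell2_norm UNIV \<phi> * ell2_norm UNIV \<psi>" .
  qed
  finally show ?thesis .
qed

lemma ell2_inner_scale:
  shows "ell2_inner UNIV \<phi> (\<lambda>i. z * \<psi> i) = z * ell2_inner UNIV \<phi> \<psi>"
    and "ell2_inner UNIV (\<lambda>i. z * \<phi> i) \<psi> = cnj z * ell2_inner UNIV \<phi> \<psi>"
  by (simp_all add: ell2_inner_def mult.assoc mult.left_commute[of _ z] infsum_cmult_right')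

lemma ell2_inner_add:
  assumes "\<phi> \<in> ell2 UNIV" "\<psi> \<in> ell2 UNIV" "\<zeta> \<in> ell2 UNIV"
  shows "ell2_inner UNIV \<phi> (\<lambda>i. \<psi> i + \<zeta> i) = ell2_inner UNIV \<phi> \<psi> + ell2_inner UNIV \<phi> \<zeta>"
    and "ell2_inner UNIV (\<lambda>i. \<phi> i + \<psi> i) \<zeta> = ell2_inner UNIV \<phi> \<zeta> + ell2_inner UNIV \<psi> \<zeta>"
  using ell2_inner_summable[OF assms(1,2)] ell2_inner_summable[OF assms(1,3)] ell2_inner_summable[OF assms(2,3)]
  by (simp_all add: ell2_inner_def ring_distribs infsum_add)

lemma ell2_inner_diff:
  assumes "\<phi> \<in> ell2 UNIV" "\<psi> \<in> ell2 UNIV" "\<zeta> \<in> ell2 UNIV"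
  shows "ell2_inner UNIV \<phi> (\<lambda>i. \<psi> i - \<zeta> i) = ell2_inner UNIV \<phi> \<psi> - ell2_inner UNIV \<phi> \<zeta>"
    and "ell2_inner UNIV (\<lambda>i. \<phi> i - \<psi> i) \<zeta> = ell2_inner UNIV \<phi> \<zeta> - ell2_inner UNIV \<psi> \<zeta>"
  using ell2_inner_add(1)[OF assms(1,2) ell2_scale(1)[OF assms(3), of "-1"]]
    ell2_inner_add(2)[OF assms(1) ell2_scale(1)[OF assms(2), of "-1"] assms(3)]
    ell2_inner_scale[where z = "-1"] by simp_all

lemma ell2_inner_self:
  assumes "\<phi> \<in> ell2 UNIV"
  shows "ell2_inner UNIV \<phi> \<phi> = complex_of_real ((ell2_norm UNIV \<phi>)\<^sup>2)"
proof -
  have "(\<lambda>i. cnj (\<phi> i) * \<phi> i) = (\<lambda>i. complex_of_real ((cmod (\<phi> i))\<^sup>2))"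
    by (rule ext) (simp add: mult.commute complex_norm_square del: of_real_power)
  moreover have "((\<lambda>i. (cmod (\<phi> i))\<^sup>2) has_sum (\<Sum>\<^sub>\<infinity>i. (cmod (\<phi> i))\<^sup>2)) UNIV"
    using assms by (simp add: ell2_def)
  then have "((\<lambda>i. complex_of_real ((cmod (\<phi> i))\<^sup>2)) has_sum complex_of_real (\<Sum>\<^sub>\<infinity>i. (cmod (\<phi> i))\<^sup>2)) UNIV"
    by (simp only: has_sum_of_real_iff)
  ultimately show ?thesis unfolding ell2_inner_def ell2_norm_power2 by (simp only: infsumI)
qed

lemma ell2_inner_unit_left: "ell2_inner UNIV (unit_seq n) \<phi> = \<phi> n"
proof -
  have "ell2_inner UNIV (unit_seq n) \<phi> = (\<Sum>\<^sub>\<infinity>i\<in>{n}. cnj (unit_seq n i) * \<phi> i)"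
    unfolding ell2_inner_def by (intro infsum_cong_neutral) (auto simp: unit_seq_def)
  then show ?thesis by (simp add: unit_seq_def)
qed

lemma ell2_inner_unit_right: "ell2_inner UNIV \<phi> (unit_seq n) = cnj (\<phi> n)"
proof -
  have "ell2_inner UNIV \<phi> (unit_seq n) = (\<Sum>\<^sub>\<infinity>i\<in>{n}. cnj (\<phi> i) * unit_seq n i)"
    unfolding ell2_inner_def by (intro infsum_cong_neutral) (auto simp: unit_seq_def)
  then show ?thesis by (simp add: unit_seq_def)
qed

lemma ell2_norm_eq_0_imp:
  assumes "\<phi> \<in> ell2 UNIV" "ell2_norm UNIV \<phi> = 0"
  shows "\<phi> i = 0"
  using cmod_le_ell2_norm[OF assms(1), of i] assms(2) by simp

text \<open>The off-diagonal entries may have either sign, so that negatives are covered.\<close>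

definition tridiagonal :: "(int \<Rightarrow> real) \<Rightarrow> (int \<Rightarrow> real) \<Rightarrow> (int \<Rightarrow> complex) \<Rightarrow> (int \<Rightarrow> complex)" where
  "tridiagonal \<alpha> \<beta> \<phi> = (\<lambda>l. of_real (\<alpha> l) * \<phi> (l + 1) + of_real (\<alpha> (l - 1)) * \<phi> (l - 1) + of_real (\<beta> l) * \<phi> l)"

lemma jacobi_op_UNIV_eq_tridiagonal:
  assumes "\<And>l m. \<bar>l - m\<bar> = 1 \<Longrightarrow> a l m = a m l"
  shows "jacobi_op UNIV a b = tridiagonal (\<lambda>l. a l (l + 1)) b"
proof (intro ext)
  fix \<phi> :: "int \<Rightarrow> complex" and l :: int
  have "{m. m \<in> UNIV \<and> \<bar>m - l\<bar> = 1} = {l + 1, l - 1}" by auto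
  moreover have "a l (l - 1) = a (l - 1) l" by (rule assms) simp
  ultimately show "jacobi_op UNIV a b \<phi> l = tridiagonal (\<lambda>l. a l (l + 1)) b \<phi> l"
    by (simp add: jacobi_op_def tridiagonal_def)
qed

locale bounded_tridiagonal =
  fixes \<alpha> \<beta> :: "int \<Rightarrow> real" and M :: real
  assumes \<alpha>_le: "\<And>l. \<bar>\<alpha> l\<bar> \<le> M" and \<beta>_le: "\<And>l. \<bar>\<beta> l\<bar> \<le> M" and M_pos: "M > 0"
begin

abbreviation "T \<equiv> tridiagonal \<alpha> \<beta>"
abbreviation "ip \<equiv> ell2_inner (UNIV :: int set)"
abbreviation "nrm \<equiv> ell2_norm (UNIV :: int set)"
abbreviation "H \<equiv> ell2 (UNIV :: int set)"

lemma T_bounded: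
  assumes "\<phi> \<in> H"
  shows "T \<phi> \<in> H" "nrm (T \<phi>) \<le> 3 * M * nrm \<phi>"
proof -
  have *: "(\<lambda>l. of_real (c l) * \<phi> (l + k)) \<in> H \<and> nrm (\<lambda>l. of_real (c l) * \<phi> (l + k)) \<le> M * nrm \<phi>"
    if "\<And>l. \<bar>c l\<bar> \<le> M" for c k
  proof -
    note s = ell2_shift[OF assms, of k]
    have "cmod (of_real (c l) * \<phi> (l + k)) \<le> M * cmod (\<phi> (l + k))" for l
      using that[of l] by (simp add: norm_mult mult_right_mono)
    from ell2_dominated[OF s(1) this] M_pos s(2) show ?thesis
      by (smt (verit, ccfv_SIG) mult_left_mono)
  qed
  have eq: "T \<phi> = (\<lambda>l. (of_real (\<alpha> l) * \<phi> (l + 1) + of_real (\<alpha> (l - 1)) * \<phi> (l + (-1))) + of_real (\<beta> l) * \<phi> (l + 0))"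
    by (simp add: tridiagonal_def)
  note p = *[of \<alpha> 1, OF \<alpha>_le] *[of "\<lambda>l. \<alpha> (l - 1)" "-1", OF \<alpha>_le] *[of \<beta> 0, OF \<beta>_le]
  note p12 = ell2_add[OF conjunct1[OF p(1)] conjunct1[OF p(2)]]
  note p123 = ell2_add[OF p12(1) conjunct1[OF p(3)]]
  show "T \<phi> \<in> H" unfolding eq by (rule p123(1))
  show "nrm (T \<phi>) \<le> 3 * M * nrm \<phi>" unfolding eq using p123(2) p12(2) p by linarith
qed

lemma T_linear:
  "T (\<lambda>i. \<phi> i + \<psi> i) = (\<lambda>i. T \<phi> i + T \<psi> i)" "T (\<lambda>i. \<phi> i - \<psi> i) = (\<lambda>i. T \<phi> i - T \<psi> i)"
  "T (\<lambda>i. z * \<phi> i) = (\<lambda>i. z * T \<phi> i)" "T (\<lambda>i. cnj (\<phi> i)) = (\<lambda>i. cnj (T \<phi> i))"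
  by (auto simp: tridiagonal_def algebra_simps)

text \<open>Reindexing by one site exchanges the two hopping terms, and the coefficients are
  real.\<close>

lemma T_symmetric:
  assumes "\<phi> \<in> H" "\<psi> \<in> H"
  shows "ip \<phi> (T \<psi>) = ip (T \<phi>) \<psi>"
proof -
  have scaled: "(\<lambda>l. of_real (c l) * \<zeta> (l + k)) \<in> H" if "\<And>l. \<bar>c l\<bar> \<le> M" "\<zeta> \<in> H" for c k \<zeta>
    by (rule ell2_dominated(1)[OF ell2_shift(1)[OF that(2), of k], of _ M])
      (use that M_pos in \<open>auto simp: norm_mult intro: mult_right_mono\<close>)
  have expand: "ip \<zeta> (T \<xi>) = (\<Sum>\<^sub>\<infinity>l. cnj (\<zeta> l) * (of_real (\<alpha> l) * \<xi> (l + 1)))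
     + (\<Sum>\<^sub>\<infinity>l. cnj (\<zeta> l) * (of_real (\<alpha> (l - 1)) * \<xi> (l - 1))) + (\<Sum>\<^sub>\<infinity>l. cnj (\<zeta> l) * (of_real (\<beta> l) * \<xi> l))"
    if z: "\<zeta> \<in> H" and x: "\<xi> \<in> H" for \<zeta> \<xi>
  proof -
    have p: "(\<lambda>l. of_real (\<alpha> l) * \<xi> (l + 1)) \<in> H" "(\<lambda>l. of_real (\<alpha> (l - 1)) * \<xi> (l - 1)) \<in> H"
      "(\<lambda>l. of_real (\<beta> l) * \<xi> l) \<in> H"
      using scaled[of \<alpha> \<xi> 1, OF \<alpha>_le x] scaled[of "\<lambda>l. \<alpha> (l - 1)" \<xi> "-1", OF \<alpha>_le x] scaled[of \<beta> \<xi> 0, OF \<beta>_le x]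
      by simp_all
    have "ip \<zeta> (T \<xi>) = ip \<zeta> (\<lambda>l. of_real (\<alpha> l) * \<xi> (l + 1)) + ip \<zeta> (\<lambda>l. of_real (\<alpha> (l - 1)) * \<xi> (l - 1))
      + ip \<zeta> (\<lambda>l. of_real (\<beta> l) * \<xi> l)"
      unfolding tridiagonal_def ell2_inner_add(1)[OF z ell2_add(1)[OF p(1,2)] p(3)] ell2_inner_add(1)[OF z p(1,2)] ..
    then show ?thesis by (simp add: ell2_inner_def)
  qed
  have shift: "(\<Sum>\<^sub>\<infinity>l. cnj (\<zeta> l) * (of_real (\<alpha> (l - 1)) * \<xi> (l - 1)))
     = (\<Sum>\<^sub>\<infinity>l. cnj (\<zeta> (l + 1)) * (of_real (\<alpha> l) * \<xi> l))" for \<zeta> \<xi> :: "int \<Rightarrow> complex"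
    by (rule infsum_reindex_bij_witness[of _ "\<lambda>l. l + 1" "\<lambda>l. l - 1"]) auto
  have conj: "ip (T \<phi>) \<psi> = cnj (ip \<psi> (T \<phi>))"
    unfolding ell2_inner_def by (subst infsum_cnj[symmetric]) (simp add: mult.commute)
  show ?thesis
    unfolding conj expand[OF assms] expand[OF assms(2,1)] shift
    by (simp only: complex_cnj_add infsum_cnj[symmetric] complex_cnj_mult complex_cnj_cnj complex_cnj_complex_of_real)
      (simp only: ac_simps)
qed

end

section \<open>Resolvents of tridiagonal operators\<close>

context bounded_tridiagonal
begin

abbreviation "res z \<equiv> resolvent UNIV T z"
abbreviation "spec \<equiv> spectrum UNIV T"
abbreviation "green z n m \<equiv> res z (unit_seq m) n"

lemma shifted_H: "\<phi> \<in> H \<Longrightarrow> shifted T z \<phi> \<in> H"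
  unfolding shifted_def by (intro ell2_diff T_bounded ell2_scale)

lemma resolvent:
  assumes "z \<notin> spec" "\<phi> \<in> H"
  shows "res z \<phi> \<in> H" "shifted T z (res z \<phi>) = \<phi>"
proof -
  have b: "bij_betw (shifted T z) H H" using assms by (simp add: spectrum_def)
  then have "\<phi> \<in> shifted T z ` H" using assms by (simp add: bij_betw_def)
  then show "res z \<phi> \<in> H" "shifted T z (res z \<phi>) = \<phi>"
    unfolding resolvent_def by (simp_all add: inv_into_into f_inv_into_f)
qed

lemma resolvent_unique:
  assumes "z \<notin> spec" "\<psi> \<in> H" "shifted T z \<psi> = \<phi>"
  shows "res z \<phi> = \<psi>"
proof -
  have "inj_on (shifted T z) H" using assms by (simp add: spectrum_def bij_betw_def)
  then show ?thesis using assms by (simp add: resolvent_def flip: assms(3))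
qed

lemma resolvent_bound:
  assumes "z \<notin> spec"
  obtains K where "K > 0" "\<And>\<phi>. \<phi> \<in> H \<Longrightarrow> nrm \<phi> \<le> K * nrm (shifted T z \<phi>)"
proof -
  obtain K where K: "\<And>\<phi>. \<phi> \<in> H \<Longrightarrow> nrm \<phi> \<le> K * nrm (shifted T z \<phi>)"
    using assms by (auto simp: spectrum_def)
  show thesis
  proof (rule that[of "\<bar>K\<bar> + 1"])
    fix \<phi> :: "int \<Rightarrow> complex" assume "\<phi> \<in> H"
    then have "nrm \<phi> \<le> K * nrm (shifted T z \<phi>)" by (rule K)
    also have "\<dots> \<le> (\<bar>K\<bar> + 1) * nrm (shifted T z \<phi>)" by (intro mult_right_mono) auto
    finally show "nrm \<phi> \<le> (\<bar>K\<bar> + 1) * nrm (shifted T z \<phi>)" .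
  qed simp
qed

lemma resolvent_T:
  assumes "z \<notin> spec" "\<phi> \<in> H"
  shows "T (res z \<phi>) i = \<phi> i + z * res z \<phi> i"
  using fun_cong[OF resolvent(2)[OF assms], of i] by (simp add: shifted_def algebra_simps)

lemma form_real: "\<phi> \<in> H \<Longrightarrow> Im (ip \<phi> (T \<phi>)) = 0"
proof -
  assume "\<phi> \<in> H"
  then have "ip \<phi> (T \<phi>) = cnj (ip \<phi> (T \<phi>))"
    using T_symmetric[of \<phi> \<phi>] unfolding ell2_inner_def
    by (subst infsum_cnj[symmetric]) (simp add: mult.commute)
  then have "Im (ip \<phi> (T \<phi>)) = - Im (ip \<phi> (T \<phi>))" by (metis cnj.simps(2))
  then show ?thesis by simp
qed

text \<open>Write \<open>\<phi> = (T - z) \<psi>\<close> with \<open>\<psi> = res z \<phi>\<close>.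
  Imaginary parts then give the Herglotz property, and at real points outside the hull of the
  spectrum the bounds on the form of \<open>T\<close> give the sign of the resolvent.\<close>

lemma resolvent_form:
  assumes "z \<notin> spec" "\<phi> \<in> H"
  shows "ip \<phi> (res z \<phi>) = ip (res z \<phi>) (T (res z \<phi>)) - cnj z * (nrm (res z \<phi>))\<^sup>2"
proof -
  note r = resolvent[OF assms]
  have "ip \<phi> (res z \<phi>) = ip (shifted T z (res z \<phi>)) (res z \<phi>)" by (simp add: r(2))
  also have "\<dots> = ip (T (res z \<phi>)) (res z \<phi>) - cnj z * ip (res z \<phi>) (res z \<phi>)"
    unfolding shifted_def using r(1)
    by (simp add: ell2_inner_diff(2) T_bounded ell2_scale ell2_inner_scale)
  finally show ?thesis using T_symmetric[OF r(1) r(1)] ell2_inner_self[OF r(1)] by simp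
qed

lemma Im_resolvent_form:
  assumes "z \<notin> spec" "\<phi> \<in> H"
  shows "Im (ip \<phi> (res z \<phi>)) = Im z * (nrm (res z \<phi>))\<^sup>2"
  using resolvent_form[OF assms] form_real[OF resolvent(1)[OF assms]] by simp

lemma resolvent_norm_pos:
  assumes "z \<notin> spec" "\<phi> \<in> H" "\<phi> n \<noteq> 0"
  shows "nrm (res z \<phi>) > 0"
proof (rule ccontr)
  assume "\<not> nrm (res z \<phi>) > 0"
  then have 0: "nrm (res z \<phi>) = 0" using ell2_norm_nonneg[of UNIV "res z \<phi>"] by linarith
  have "res z \<phi> i = 0" for i by (rule ell2_norm_eq_0_imp[OF resolvent(1)[OF assms(1,2)] 0])
  then have "T (res z \<phi>) n = 0" by (simp add: tridiagonal_def)
  with resolvent_T[OF assms(1,2), of n] show False using \<open>\<And>i. res z \<phi> i = 0\<close> assms(3) by simp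
qed

lemma resolvent_decay:
  assumes "z \<notin> spec" "\<phi> \<in> H" "cmod z \<ge> 6 * M"
  shows "nrm (res z \<phi>) \<le> 2 * nrm \<phi> / cmod z"
proof -
  note r = resolvent[OF assms(1,2)]
  have "(\<lambda>i. z * res z \<phi> i) = (\<lambda>i. T (res z \<phi>) i - \<phi> i)"
    using resolvent_T[OF assms(1,2)] by auto
  then have "cmod z * nrm (res z \<phi>) \<le> nrm (T (res z \<phi>)) + nrm \<phi>"
    using ell2_scale(2)[OF r(1), of z] ell2_diff(2)[OF T_bounded(1)[OF r(1)] assms(2)] by simp
  also have "\<dots> \<le> 3 * M * nrm (res z \<phi>) + nrm \<phi>" using T_bounded(2)[OF r(1)] by simp
  also have "\<dots> \<le> cmod z / 2 * nrm (res z \<phi>) + nrm \<phi>"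
    using assms(3) by (intro add_mono mult_right_mono) auto
  finally have "cmod z * nrm (res z \<phi>) \<le> 2 * nrm \<phi>" by simp
  moreover have "cmod z > 0" using assms(3) M_pos by linarith
  ultimately show ?thesis by (simp add: field_simps)
qed

lemma resolvent_identity:
  assumes "z \<notin> spec" "w \<notin> spec" "\<phi> \<in> H"
  shows "res z \<phi> i - res w \<phi> i = (z - w) * res z (res w \<phi>) i"
proof -
  note w = resolvent[OF assms(2,3)]
  note z = resolvent[OF assms(1) w(1)]
  have "res z \<phi> = (\<lambda>i. res w \<phi> i + (z - w) * res z (res w \<phi>) i)"
  proof (rule resolvent_unique[OF assms(1)])
    show "(\<lambda>i. res w \<phi> i + (z - w) * res z (res w \<phi>) i) \<in> H" using w z by (intro ell2_add ell2_scale)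
    show "shifted T z (\<lambda>i. res w \<phi> i + (z - w) * res z (res w \<phi>) i) = \<phi>"
    proof
      fix i
      show "shifted T z (\<lambda>i. res w \<phi> i + (z - w) * res z (res w \<phi>) i) i = \<phi> i"
        unfolding shifted_def T_linear resolvent_T[OF assms(2,3)] resolvent_T[OF assms(1) w(1)]
        by (simp add: algebra_simps)
    qed
  qed
  then show ?thesis by (simp add: fun_eq_iff)
qed

text \<open>By the resolvent identity the difference quotient at \<open>w\<close> is
  \<open>res z\<close> applied to \<open>res w \<phi>\<close>. Within distance
  \<open>1 / (2 * K)\<close> of \<open>w\<close> the resolvents are bounded by \<open>2 * K\<close>,
  so a second use of the identity gives convergence to \<open>res w (res w \<phi>)\<close>.\<close>

lemma resolvent_has_derivative:
  assumes "open U" "U \<inter> spec = {}" "w \<in> U" "\<phi> \<in> H"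
  shows "((\<lambda>z. res z \<phi> n) has_field_derivative res w (res w \<phi>) n) (at w)"
proof -
  have w: "w \<notin> spec" using assms by auto
  obtain K where K: "K > 0" "\<And>\<phi>. \<phi> \<in> H \<Longrightarrow> nrm \<phi> \<le> K * nrm (shifted T w \<phi>)"
    using resolvent_bound[OF w] by blast
  obtain e where e: "e > 0" "ball w e \<subseteq> U" using assms open_contains_ball by blast
  define d where "d = min e (1 / (2 * K))"
  have d: "d > 0" using e K by (simp add: d_def)
  have bound: "nrm (res z \<psi>) \<le> 2 * K * nrm \<psi>" if "dist z w < d" "\<psi> \<in> H" for z \<psi>
  proof -
    have z: "z \<notin> spec" using that e assms by (auto simp: d_def dist_commute)
    note r = resolvent[OF z that(2)]
    have "shifted T w (res z \<psi>) = (\<lambda>i. \<psi> i + (z - w) * res z \<psi> i)"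
      by (rule ext) (simp add: shifted_def resolvent_T[OF z that(2)] algebra_simps)
    then have "nrm (shifted T w (res z \<psi>)) \<le> nrm \<psi> + cmod (z - w) * nrm (res z \<psi>)"
      using ell2_add(2)[OF that(2) ell2_scale(1)[OF r(1), of "z - w"]] ell2_scale(2)[OF r(1)] by simp
    also have "\<dots> \<le> nrm \<psi> + 1 / (2 * K) * nrm (res z \<psi>)"
      using that(1) by (intro add_mono mult_right_mono) (auto simp: d_def dist_norm)
    finally have "nrm (res z \<psi>) \<le> K * (nrm \<psi> + 1 / (2 * K) * nrm (res z \<psi>))"
      using K(2)[OF r(1)] K(1) by (meson mult_left_mono order_less_imp_le order_trans)
    also have "\<dots> = K * nrm \<psi> + nrm (res z \<psi>) / 2" using K(1) by (simp add: field_simps)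
    finally show ?thesis by simp
  qed
  define \<zeta> where "\<zeta> = res w (res w \<phi>)"
  have H1: "res w \<phi> \<in> H" "\<zeta> \<in> H" unfolding \<zeta>_def using w assms(4) by (auto intro: resolvent)
  have "((\<lambda>z. (res z \<phi> n - res w \<phi> n) / (z - w)) \<longlongrightarrow> \<zeta> n) (at w)"
  proof (rule Lim_transform_within_open)
    show "open (ball w d)" "w \<in> ball w d" using d by auto
    fix z assume z: "z \<in> ball w d" "z \<noteq> w"
    then have "z \<notin> spec" using e assms by (auto simp: d_def)
    then show "res z (res w \<phi>) n = (res z \<phi> n - res w \<phi> n) / (z - w)"
      using resolvent_identity[OF _ w assms(4), of z n] z by simp
  next
    show "((\<lambda>z. res z (res w \<phi>) n) \<longlongrightarrow> \<zeta> n) (at w)"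
    proof (rule LIM_zero_cancel)
      show "((\<lambda>z. res z (res w \<phi>) n - \<zeta> n) \<longlongrightarrow> 0) (at w)"
      proof (rule Lim_null_comparison)
        have "\<forall>\<^sub>F z in at w. dist z w < d" using d by (auto simp: eventually_at)
        then show "\<forall>\<^sub>F z in at w. norm (res z (res w \<phi>) n - \<zeta> n) \<le> cmod (z - w) * (2 * K * nrm \<zeta>)"
        proof eventually_elim
          case (elim z)
          then have z: "z \<notin> spec" using e assms by (auto simp: d_def dist_commute)
          have "norm (res z (res w \<phi>) n - \<zeta> n) = cmod (z - w) * cmod (res z \<zeta> n)"
            using resolvent_identity[OF z w H1(1), of n]
            by (simp add: \<zeta>_def norm_minus_commute norm_mult)
          also have "\<dots> \<le> cmod (z - w) * (2 * K * nrm \<zeta>)"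
            using bound[OF elim H1(2)] cmod_le_ell2_norm[OF resolvent(1)[OF z H1(2)], of n]
            by (intro mult_left_mono) auto
          finally show ?case .
        qed
        have "((\<lambda>z. cmod (z - w) * (2 * K * nrm \<zeta>)) \<longlongrightarrow> cmod (w - w) * (2 * K * nrm \<zeta>)) (at w)"
          by (intro tendsto_intros)
        then show "((\<lambda>z. cmod (z - w) * (2 * K * nrm \<zeta>)) \<longlongrightarrow> 0) (at w)" by simp
      qed
    qed
  qed
  then show ?thesis by (simp add: has_field_derivative_iff \<zeta>_def)
qed

lemma resolvent_holomorphic:
  assumes "open U" "U \<inter> spec = {}" "\<phi> \<in> H"
  shows "(\<lambda>z. res z \<phi> n) holomorphic_on U"
  using resolvent_has_derivative[OF assms(1,2) _ assms(3)] assms(1)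
  by (meson field_differentiable_def holomorphic_on_def field_differentiable_at_within)

lemma green_eq:
  assumes "z \<notin> spec"
  shows "of_real (\<alpha> n) * green z (n + 1) m + of_real (\<alpha> (n - 1)) * green z (n - 1) m + of_real (\<beta> n) * green z n m
    = z * green z n m + (if n = m then 1 else 0)"
  using resolvent_T[OF assms unit_seq_ell2(1), of m n] by (simp add: tridiagonal_def unit_seq_def)

lemma resolvent_cnj:
  assumes "z \<notin> spec" "cnj z \<notin> spec" "\<phi> \<in> H"
  shows "res (cnj z) (\<lambda>i. cnj (\<phi> i)) = (\<lambda>i. cnj (res z \<phi> i))"
proof (rule resolvent_unique[OF assms(2)])
  show "(\<lambda>i. cnj (res z \<phi> i)) \<in> H" by (intro ell2_cnj resolvent assms)
  show "shifted T (cnj z) (\<lambda>i. cnj (res z \<phi> i)) = (\<lambda>i. cnj (\<phi> i))"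
    by (rule ext) (simp add: shifted_def T_linear resolvent_T[OF assms(1,3)])
qed

lemma green_cnj:
  assumes "z \<notin> spec" "cnj z \<notin> spec"
  shows "green (cnj z) n m = cnj (green z n m)"
proof -
  have "(\<lambda>i. cnj (unit_seq m i)) = unit_seq m" by (auto simp: unit_seq_def)
  then show ?thesis using resolvent_cnj[OF assms unit_seq_ell2(1), of m] by (simp add: fun_eq_iff)
qed

text \<open>Self-adjointness exchanges the sites at the price of passing to \<open>cnj z\<close>,
  and reality of the coefficients leads back to \<open>z\<close>.\<close>

lemma green_symmetric:
  assumes "z \<notin> spec" "cnj z \<notin> spec"
  shows "green z n m = green z m n"
proof -
  note u = unit_seq_ell2(1)
  let ?f = "res (cnj z) (unit_seq n)" and ?g = "res z (unit_seq m)"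
  have f: "?f \<in> H" and g: "?g \<in> H" by (intro resolvent(1) assms u)+
  have "cnj (green (cnj z) m n) = ip ?f (unit_seq m)" by (simp add: ell2_inner_unit_right)
  also have "\<dots> = ip ?f (shifted T z ?g)" by (simp add: resolvent(2)[OF assms(1) u])
  also have "\<dots> = ip ?f (T ?g) - z * ip ?f ?g"
    unfolding shifted_def using f g by (simp add: ell2_inner_diff(1) T_bounded ell2_scale ell2_inner_scale)
  also have "\<dots> = ip (T ?f) ?g - ip (\<lambda>i. cnj z * ?f i) ?g" using T_symmetric[OF f g] by (simp add: ell2_inner_scale)
  also have "\<dots> = ip (shifted T (cnj z) ?f) ?g"
    unfolding shifted_def using f g by (simp add: ell2_inner_diff(2) T_bounded ell2_scale)
  also have "\<dots> = green z n m" by (simp add: resolvent(2)[OF assms(2) u] ell2_inner_unit_left)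
  finally show ?thesis using green_cnj[OF assms, where n = m and m = n] by simp
qed

text \<open>
  The supremum \<open>E\<close> of the form lies in the spectrum: \<open>A = E - T\<close> is nonnegative, hence
  \<open>\<parallel>A \<phi>\<parallel>\<^sup>2 \<le> N \<langle>\<phi>, A \<phi>\<rangle>\<close>, and the right-hand side is arbitrarily small on unit vectors.
\<close>

lemma form_sup_in_spectrum:
  obtains E where "complex_of_real E \<in> spec" "\<And>\<phi>. \<phi> \<in> H \<Longrightarrow> Re (ip \<phi> (T \<phi>)) \<le> E * (nrm \<phi>)\<^sup>2"
proof -
  define F where "F \<phi> = Re (ip \<phi> (T \<phi>))" for \<phi>
  define X where "X = {\<phi> \<in> H. nrm \<phi> = 1}"
  have Fle: "\<bar>F \<phi>\<bar> \<le> 3 * M * (nrm \<phi>)\<^sup>2" if "\<phi> \<in> H" for \<phi>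
  proof -
    have "\<bar>F \<phi>\<bar> \<le> nrm \<phi> * nrm (T \<phi>)"
      unfolding F_def using ell2_cauchy_schwarz[OF that T_bounded(1)[OF that]] abs_Re_le_cmod order_trans by blast
    also have "\<dots> \<le> nrm \<phi> * (3 * M * nrm \<phi>)" using T_bounded(2)[OF that] by (intro mult_left_mono) auto
    finally show ?thesis by (simp add: power2_eq_square ac_simps)
  qed
  have bdd: "bdd_above (F ` X)"
    using Fle by (intro bdd_aboveI[of _ "3 * M"]) (fastforce simp: X_def)
  have "unit_seq 0 \<in> X" by (simp add: X_def unit_seq_ell2)
  then have ne: "X \<noteq> {}" by auto
  define E where "E = Sup (F ` X)"
  have le: "F \<phi> \<le> E * (nrm \<phi>)\<^sup>2" if "\<phi> \<in> H" for \<phi>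
  proof (cases "nrm \<phi> = 0")
    case True
    then show ?thesis using Fle[OF that] by simp
  next
    case False
    then have pos: "nrm \<phi> > 0" using ell2_norm_nonneg[of UNIV \<phi>] by linarith
    define z where "z = complex_of_real (1 / nrm \<phi>)"
    have "(\<lambda>i. z * \<phi> i) \<in> X" using ell2_scale[OF that, of z] pos by (simp add: X_def z_def norm_divide)
    then have "F (\<lambda>i. z * \<phi> i) \<le> E" unfolding E_def by (intro cSup_upper bdd) auto
    moreover have "F (\<lambda>i. z * \<phi> i) = F \<phi> / (nrm \<phi>)\<^sup>2"
    proof -
      have "ip (\<lambda>i. z * \<phi> i) (T (\<lambda>i. z * \<phi> i)) = z * (cnj z * ip \<phi> (T \<phi>))"
        by (simp only: T_linear ell2_inner_scale)
      then show ?thesis by (simp add: F_def z_def power2_eq_square)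
    qed
    ultimately show ?thesis using pos by (simp add: field_simps)
  qed
  have "complex_of_real E \<in> spec"
  proof (rule ccontr)
    assume "complex_of_real E \<notin> spec"
    then obtain K where K: "K > 0" "\<And>\<phi>. \<phi> \<in> H \<Longrightarrow> nrm \<phi> \<le> K * nrm (shifted T E \<phi>)"
      using resolvent_bound by blast
    \<comment> \<open>Here \<open>A\<close> is \<open>T - E\<close>, the negative of the operator
      described above, so its form is at most 0.\<close>
    define A where "A \<phi> = shifted T (complex_of_real E) \<phi>" for \<phi>
    define N where "N = 3 * M + \<bar>E\<bar>"
    have N: "N > 0" using M_pos by (simp add: N_def)
    have A_H: "A \<phi> \<in> H" if "\<phi> \<in> H" for \<phi> unfolding A_def using that by (rule shifted_H)
    have A_norm: "nrm (A \<phi>) \<le> N * nrm \<phi>" if "\<phi> \<in> H" for \<phi>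
      unfolding A_def shifted_def N_def
      using ell2_diff(2)[OF T_bounded(1)[OF that] ell2_scale(1)[OF that, of E]] T_bounded(2)[OF that]
        ell2_scale(2)[OF that, of E] by (simp add: distrib_right)
    have ip_A: "ip \<zeta> (A \<xi>) = ip \<zeta> (T \<xi>) - E * ip \<zeta> \<xi>" if "\<zeta> \<in> H" "\<xi> \<in> H" for \<zeta> \<xi>
      unfolding A_def shifted_def using that by (simp add: ell2_inner_diff(1) T_bounded ell2_scale ell2_inner_scale)
    have A_sym: "ip \<zeta> (A \<xi>) = ip (A \<zeta>) \<xi>" if "\<zeta> \<in> H" "\<xi> \<in> H" for \<zeta> \<xi>
      unfolding ip_A[OF that] using that
      by (simp add: A_def shifted_def ell2_inner_diff(2) T_bounded ell2_scale ell2_inner_scale T_symmetric)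
    have A_neg: "Re (ip \<phi> (A \<phi>)) \<le> 0" if "\<phi> \<in> H" for \<phi>
      using le[OF that] unfolding ip_A[OF that that] ell2_inner_self[OF that] by (simp add: F_def)
    \<comment> \<open>Expand the nonpositive form at \<open>\<phi> + A \<phi> / N\<close>; as
      \<open>N\<close> dominates the norm of \<open>A\<close>, the quadratic term takes back only
      half of the linear one.\<close>
    have key: "(nrm (A \<phi>))\<^sup>2 \<le> N * (- Re (ip \<phi> (A \<phi>)))" if "\<phi> \<in> H" for \<phi>
    proof -
      define t where "t = complex_of_real (1 / N)"
      have h: "A \<phi> \<in> H" "A (A \<phi>) \<in> H" using that A_H by auto
      have h': "(\<lambda>i. t * A \<phi> i) \<in> H" "(\<lambda>i. \<phi> i + t * A \<phi> i) \<in> H" "(\<lambda>i. t * A (A \<phi>) i) \<in> H"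
        using that h by (auto intro!: ell2_add ell2_scale)
      have lin: "A (\<lambda>i. \<phi> i + t * A \<phi> i) = (\<lambda>i. A \<phi> i + t * A (A \<phi>) i)"
        by (rule ext) (simp add: A_def shifted_def T_linear algebra_simps)
      have "ip (\<lambda>i. \<phi> i + t * A \<phi> i) (A (\<lambda>i. \<phi> i + t * A \<phi> i))
        = ip \<phi> (A \<phi>) + t * ip \<phi> (A (A \<phi>)) + cnj t * ip (A \<phi>) (A \<phi>) + cnj t * t * ip (A \<phi>) (A (A \<phi>))"
        unfolding lin using that h h'
        by (simp add: ell2_inner_add ell2_add ell2_inner_scale algebra_simps)
      also have "ip \<phi> (A (A \<phi>)) = ip (A \<phi>) (A \<phi>)" by (rule A_sym[OF that h(1)])
      finally have "Re (ip \<phi> (A \<phi>)) + 2 / N * (nrm (A \<phi>))\<^sup>2 + Re (ip (A \<phi>) (A (A \<phi>))) / N\<^sup>2 \<le> 0"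
        using A_neg[OF h'(2)] ell2_inner_self[OF h(1)] by (simp add: t_def power2_eq_square)
      moreover have "Re (ip (A \<phi>) (A (A \<phi>))) / N\<^sup>2 \<ge> - ((nrm (A \<phi>))\<^sup>2 / N)"
      proof -
        have "cmod (ip (A \<phi>) (A (A \<phi>))) \<le> nrm (A \<phi>) * nrm (A (A \<phi>))" by (rule ell2_cauchy_schwarz[OF h])
        also have "\<dots> \<le> nrm (A \<phi>) * (N * nrm (A \<phi>))" using A_norm[OF h(1)] by (intro mult_left_mono) auto
        finally have "- Re (ip (A \<phi>) (A (A \<phi>))) \<le> N * (nrm (A \<phi>))\<^sup>2"
          using abs_Re_le_cmod[of "ip (A \<phi>) (A (A \<phi>))"] by (simp add: power2_eq_square ac_simps)
        then show ?thesis using N by (simp add: field_simps power2_eq_square)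
      qed
      ultimately have "(nrm (A \<phi>))\<^sup>2 / N \<le> - Re (ip \<phi> (A \<phi>))" by (simp add: field_simps)
      then show ?thesis using N by (simp add: field_simps)
    qed
    \<comment> \<open>This closeness to the supremum makes \<open>K * nrm (A \<phi>)\<close> less
      than 1, while the resolvent bound on a unit vector forces it to be at least 1.\<close>
    have "E - 1 / (2 * N * K\<^sup>2) < Sup (F ` X)" using N K(1) by (simp add: E_def)
    then obtain \<phi> where \<phi>: "\<phi> \<in> X" "F \<phi> > E - 1 / (2 * N * K\<^sup>2)"
      using less_cSupE[of _ "F ` X"] ne by auto
    then have h: "\<phi> \<in> H" "nrm \<phi> = 1" by (auto simp: X_def)
    have "- Re (ip \<phi> (A \<phi>)) < 1 / (2 * N * K\<^sup>2)"
      using \<phi>(2) h unfolding ip_A[OF h(1) h(1)] ell2_inner_self[OF h(1)] by (simp add: F_def)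
    then have "N * (- Re (ip \<phi> (A \<phi>))) < N * (1 / (2 * N * K\<^sup>2))" using N by (intro mult_strict_left_mono)
    also have "\<dots> = 1 / (2 * K\<^sup>2)" using N by simp
    finally have "(nrm (A \<phi>))\<^sup>2 < 1 / (2 * K\<^sup>2)" using key[OF h(1)] by linarith
    then have "(K * nrm (A \<phi>))\<^sup>2 < 1" using K(1) by (simp add: field_simps power2_eq_square)
    moreover have "K * nrm (A \<phi>) \<ge> 1" using K(2)[OF h(1)] h(2) by (simp add: A_def)
    ultimately show False using one_le_power[of "K * nrm (A \<phi>)" 2] by linarith
  qed
  then show thesis using that le by (auto simp: F_def)
qed

end

section \<open>Holomorphic functions on the upper half-plane\<close>

text \<open>The three sides off the real axis have total length \<open>4 * R\<close> and consist of
  points of modulus at least \<open>R\<close>, where \<open>f\<close> is at most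
  \<open>B\<close>.\<close>

lemma rectpath_split:
  assumes R: "R > 0" and f: "(f has_contour_integral I) (rectpath (of_real (-R)) (Complex R R))"
    and cont: "continuous_on (path_image (rectpath (of_real (-R)) (Complex R R))) f"
    and bound: "\<And>w. Im w \<ge> 0 \<Longrightarrow> cmod w \<ge> R \<Longrightarrow> cmod (f w) \<le> B" and B: "B \<ge> 0"
  shows "(\<lambda>t. f (of_real t)) integrable_on {-R..R}"
    and "cmod (I - integral {-R..R} (\<lambda>t. f (of_real t))) \<le> 4 * R * B"
proof -
  let ?a = "of_real (-R) :: complex" and ?b = "of_real R :: complex" and ?c = "Complex R R" and ?d = "Complex (-R) R"
  have rp: "rectpath ?a ?c = linepath ?a ?b +++ linepath ?b ?c +++ linepath ?c ?d +++ linepath ?d ?a"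
    by (simp add: rectpath_def Let_def complex_of_real_def)
  have im: "path_image (rectpath ?a ?c) = closed_segment ?a ?b \<union> closed_segment ?b ?c \<union> closed_segment ?c ?d \<union> closed_segment ?d ?a"
    unfolding rp by (simp add: path_image_join Un_assoc)
  have int: "f contour_integrable_on linepath ?a ?b" "f contour_integrable_on linepath ?b ?c"
    "f contour_integrable_on linepath ?c ?d" "f contour_integrable_on linepath ?d ?a"
    using im by (auto intro!: contour_integrable_continuous_linepath continuous_on_subset[OF cont])
  have "((f has_contour_integral (contour_integral (linepath ?a ?b) f + (contour_integral (linepath ?b ?c) f
      + (contour_integral (linepath ?c ?d) f + contour_integral (linepath ?d ?a) f)))) (rectpath ?a ?c))"
    unfolding rp by (intro has_contour_integral_join has_contour_integral_integral int valid_path_join) auto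
  then have I: "I = contour_integral (linepath ?a ?b) f + (contour_integral (linepath ?b ?c) f
      + (contour_integral (linepath ?c ?d) f + contour_integral (linepath ?d ?a) f))"
    using f has_contour_integral_unique by blast
  have "(f has_contour_integral contour_integral (linepath ?a ?b) f) (linepath ?a ?b)"
    by (rule has_contour_integral_integral[OF int(1)])
  then have "((\<lambda>t. f (of_real t)) has_integral contour_integral (linepath ?a ?b) f) {-R..R}"
    using R by (subst (asm) has_contour_integral_linepath_Reals_iff) auto
  then show "(\<lambda>t. f (of_real t)) integrable_on {-R..R}"
    and bot: "cmod (I - integral {-R..R} (\<lambda>t. f (of_real t))) \<le> 4 * R * B"
  proof -
    assume h: "((\<lambda>t. f (of_real t)) has_integral contour_integral (linepath ?a ?b) f) {-R..R}"
    then show "(\<lambda>t. f (of_real t)) integrable_on {-R..R}" by blast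
    have right: "cmod (contour_integral (linepath ?b ?c) f) \<le> B * cmod (?c - ?b)"
    proof (rule has_contour_integral_bound_linepath[OF has_contour_integral_integral[OF int(2)] B])
      fix w assume "w \<in> closed_segment ?b ?c"
      then have "Re w = R" "Im w \<ge> 0"
        using R by (auto simp: closed_segment_same_Re closed_segment_eq_real_ivl)
      then show "cmod (f w) \<le> B" using abs_Re_le_cmod[of w] R by (intro bound) auto
    qed
    have top: "cmod (contour_integral (linepath ?c ?d) f) \<le> B * cmod (?d - ?c)"
    proof (rule has_contour_integral_bound_linepath[OF has_contour_integral_integral[OF int(3)] B])
      fix w assume "w \<in> closed_segment ?c ?d"
      then have "Im w = R" using R by (auto simp: closed_segment_same_Im)
      then show "cmod (f w) \<le> B" using abs_Im_le_cmod[of w] R by (intro bound) auto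
    qed
    have left: "cmod (contour_integral (linepath ?d ?a) f) \<le> B * cmod (?a - ?d)"
    proof (rule has_contour_integral_bound_linepath[OF has_contour_integral_integral[OF int(4)] B])
      fix w assume "w \<in> closed_segment ?d ?a"
      then have "Re w = - R" "Im w \<ge> 0"
        using R by (auto simp: closed_segment_same_Re closed_segment_eq_real_ivl)
      then show "cmod (f w) \<le> B" using abs_Re_le_cmod[of w] R by (intro bound) auto
    qed
    have len: "cmod (?c - ?b) = R" "cmod (?d - ?c) = 2 * R" "cmod (?a - ?d) = R"
      using R by (simp_all add: cmod_def real_sqrt_mult)
    have "I - integral {-R..R} (\<lambda>t. f (of_real t)) = contour_integral (linepath ?b ?c) f
      + (contour_integral (linepath ?c ?d) f + contour_integral (linepath ?d ?a) f)"
      using h by (simp add: I integral_unique)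
    also have "cmod \<dots> \<le> B * R + (B * (2 * R) + B * R)"
      using right top left unfolding len by (intro order_trans[OF norm_triangle_ineq] add_mono) auto
    finally show "cmod (I - integral {-R..R} (\<lambda>t. f (of_real t))) \<le> 4 * R * B" by (simp add: algebra_simps)
  qed
qed

text \<open>
  Subtracting the conjugate of Cauchy's theorem at the reflected point \<open>cnj z\<close> leaves only the
  imaginary part of \<open>h\<close> under the integral over the real axis.
\<close>

lemma half_plane_representation:
  assumes hol: "h holomorphic_on {w. Im w > - d}" and d: "d > 0" and z: "Im z > 0"
    and decay: "\<And>w. Im w \<ge> 0 \<Longrightarrow> cmod w \<ge> R0 \<Longrightarrow> cmod (h w) \<le> K / cmod w" and K: "K \<ge> 0"
    and R: "R \<ge> R0" "R > 0" "R > 2 * cmod z"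
  shows "cmod (h z - integral {-R..R} (\<lambda>t. of_real (Im (h (of_real t))) / (of_real t - z)) / pi) \<le> 8 * K / R"
proof -
  \<comment> \<open>Capping the depth of the strip by \<open>Im z\<close> keeps \<open>cnj z\<close>
    outside \<open>S\<close>, so that \<open>G\<close> is holomorphic on \<open>S\<close>.\<close>
  define e where "e = min d (Im z)"
  define S where "S = {w. Im w > - e}"
  define \<gamma> where "\<gamma> = rectpath (of_real (-R)) (Complex R R)"
  have e: "e > 0" using d z by (simp add: e_def)
  have S: "convex S" "open S"
    unfolding S_def by (auto intro: convex_halfspace_Im_gt open_halfspace_Im_gt)
  have holS: "h holomorphic_on S" by (rule holomorphic_on_subset[OF hol]) (auto simp: S_def e_def)
  have zbox: "z \<in> box (of_real (-R)) (Complex R R)"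
    using R z abs_Re_le_cmod[of z] abs_Im_le_cmod[of z] by (auto simp: in_box_complex_iff)
  have image: "path_image \<gamma> \<subseteq> S"
  proof
    fix w assume "w \<in> path_image \<gamma>"
    then have "w \<in> cbox (of_real (-R)) (Complex R R)"
      unfolding \<gamma>_def using path_image_rectpath_subset_cbox[of "of_real (-R)" "Complex R R"] R by auto
    then show "w \<in> S" using e by (auto simp: in_cbox_complex_iff S_def)
  qed
  have znot: "z \<notin> path_image \<gamma>"
    unfolding \<gamma>_def using R zbox by (subst path_image_rectpath_cbox_minus_box) auto
  have closed: "pathfinish \<gamma> = pathstart \<gamma>" "valid_path \<gamma>" by (simp_all add: \<gamma>_def)
  define F where "F w = h w / (w - z)" for w
  define G where "G w = h w / (w - cnj z)" for w
  have "z \<in> S" using z e by (auto simp: S_def)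
  then have F: "(F has_contour_integral (2 * pi * \<i> * h z)) \<gamma>"
    using Cauchy_integral_formula_convex_simple[OF S(1) holS _ closed(2) _ closed(1), of z] S(2) image znot
      winding_number_rectpath[OF zbox] by (simp add: F_def[abs_def] \<gamma>_def interior_open subset_Diff_insert)
  have zc: "cnj z \<notin> S" by (auto simp: S_def e_def)
  have holG: "G holomorphic_on S" unfolding G_def using zc by (intro holomorphic_intros holS) auto
  then have G: "(G has_contour_integral 0) \<gamma>" by (rule Cauchy_theorem_convex_simple[OF _ S(1) closed(2) image closed(1)])
  have contF: "continuous_on (path_image \<gamma>) F" unfolding F_def
    using znot by (intro continuous_intros continuous_on_subset[OF holomorphic_on_imp_continuous_on[OF holS] image]) auto
  have contG: "continuous_on (path_image \<gamma>) G"
    by (rule continuous_on_subset[OF holomorphic_on_imp_continuous_on[OF holG] image])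
  have bound: "cmod (h w / (w - z')) \<le> 2 * K / R\<^sup>2" if "Im w \<ge> 0" "cmod w \<ge> R" "cmod z' = cmod z" for w z'
  proof -
    have "cmod (h w) \<le> K / cmod w" using that R by (intro decay) auto
    also have "\<dots> \<le> K / R" using that R K by (intro divide_left_mono mult_pos_pos) linarith+
    finally have 1: "cmod (h w) \<le> K / R" .
    have 2: "cmod (w - z') \<ge> R / 2" using norm_triangle_ineq2[of w z'] that R by linarith
    have "cmod (h w) / cmod (w - z') \<le> (K / R) / (R / 2)" using 1 2 R K by (intro frac_le) auto
    then show ?thesis by (simp add: norm_divide power2_eq_square mult.commute)
  qed
  have B0: "0 \<le> 2 * K / R\<^sup>2" using K by simp
  note f = rectpath_split[OF R(2) F[unfolded \<gamma>_def] contF[unfolded \<gamma>_def] _ B0]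
  note g = rectpath_split[OF R(2) G[unfolded \<gamma>_def] contG[unfolded \<gamma>_def] _ B0]
  have f1: "(\<lambda>t. F (of_real t)) integrable_on {-R..R}"
    and f2: "cmod (2 * pi * \<i> * h z - integral {-R..R} (\<lambda>t. F (of_real t))) \<le> 4 * R * (2 * K / R\<^sup>2)"
    by (rule f; use bound[of _ z] in \<open>simp add: F_def\<close>)+
  have g1: "(\<lambda>t. G (of_real t)) integrable_on {-R..R}"
    and g2: "cmod (0 - integral {-R..R} (\<lambda>t. G (of_real t))) \<le> 4 * R * (2 * K / R\<^sup>2)"
    by (rule g; use bound[of _ "cnj z"] in \<open>simp add: G_def\<close>)+
  define P where "P = integral {-R..R} (\<lambda>t. of_real (Im (h (of_real t))) / (of_real t - z))"
  have g1': "(\<lambda>t. cnj (G (of_real t))) integrable_on {-R..R}"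
    using g1 by (simp add: integrable_on_cnj_iff)
  have gc: "integral {-R..R} (\<lambda>t. cnj (G (of_real t))) = cnj (integral {-R..R} (\<lambda>t. G (of_real t)))"
    by (simp add: integral_cnj)
  have "integral {-R..R} (\<lambda>t. F (of_real t)) - integral {-R..R} (\<lambda>t. cnj (G (of_real t)))
    = integral {-R..R} (\<lambda>t. F (of_real t) - cnj (G (of_real t)))"
    using f1 g1' by (simp add: integral_diff)
  also have "\<dots> = integral {-R..R} (\<lambda>t. 2 * \<i> * (of_real (Im (h (of_real t))) / (of_real t - z)))"
  proof -
    have "F (of_real t) - cnj (G (of_real t)) = 2 * \<i> * (of_real (Im (h (of_real t))) / (of_real t - z))" for t
    proof -
      have "F (of_real t) - cnj (G (of_real t)) = (h (of_real t) - cnj (h (of_real t))) / (of_real t - z)"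
        by (simp add: F_def G_def diff_divide_distrib)
      also have "h (of_real t) - cnj (h (of_real t)) = 2 * \<i> * of_real (Im (h (of_real t)))"
        by (simp add: complex_eq_iff)
      finally show ?thesis by simp
    qed
    then show ?thesis by simp
  qed
  also have "\<dots> = 2 * \<i> * P" unfolding P_def by (rule integral_mult_right)
  finally have eq: "integral {-R..R} (\<lambda>t. F (of_real t)) - cnj (integral {-R..R} (\<lambda>t. G (of_real t))) = 2 * \<i> * P"
    by (simp add: gc)
  have "2 * pi * \<i> * h z - 2 * \<i> * P = (2 * pi * \<i> * h z - integral {-R..R} (\<lambda>t. F (of_real t)))
    + cnj (integral {-R..R} (\<lambda>t. G (of_real t)))"
    unfolding eq[symmetric] by simp
  also have "cmod \<dots> \<le> 4 * R * (2 * K / R\<^sup>2) + 4 * R * (2 * K / R\<^sup>2)"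
    using f2 g2 by (intro order_trans[OF norm_triangle_ineq] add_mono) auto
  also have "\<dots> = 16 * K / R" using R by (simp add: power2_eq_square)
  finally have "cmod (2 * pi * \<i> * h z - 2 * \<i> * P) \<le> 16 * K / R" .
  moreover have "2 * pi * \<i> * h z - 2 * \<i> * P = (2 * pi * \<i>) * (h z - P / pi)" by (simp add: field_simps)
  ultimately have "2 * pi * cmod (h z - P / pi) \<le> 16 * K / R" by (simp add: norm_mult)
  moreover have "2 * cmod (h z - P / pi) \<le> 2 * pi * cmod (h z - P / pi)"
    using pi_gt3 by (intro mult_right_mono) auto
  ultimately show ?thesis unfolding P_def by simp
qed

lemma le_of_le_add_inverse:
  fixes X Y c :: real
  assumes "\<And>R. R > Rm \<Longrightarrow> X \<le> Y + c / R"
  shows "X \<le> Y"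
proof -
  have "((\<lambda>R. Y + c / R) \<longlongrightarrow> Y + 0) at_top"
    by (intro tendsto_intros real_tendsto_divide_at_top[OF tendsto_const] filterlim_ident)
  then show ?thesis
    using assms by (intro tendsto_lowerbound[of "\<lambda>R. Y + c / R" Y at_top X])
      (auto intro: eventually_mono[OF eventually_gt_at_top[of Rm]])
qed

text \<open>Raising the argument by \<open>e\<close> gives a function holomorphic across the real
  axis, as \<open>half_plane_representation\<close> requires. The decay survives because moving up
  from the closed upper half-plane increases the modulus.\<close>

lemma half_plane_shift:
  assumes hol: "f holomorphic_on {w. Im w > 0}" and e: "e > 0"
    and decay: "\<And>w. Im w > 0 \<Longrightarrow> cmod w \<ge> R0 \<Longrightarrow> cmod (f w) \<le> K / cmod w" and K: "K \<ge> 0" and R0: "R0 > 0"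
  defines "h \<equiv> \<lambda>w. f (w + \<i> * of_real e)"
  shows "h holomorphic_on {w. Im w > - e}"
    and "\<And>w. Im w \<ge> 0 \<Longrightarrow> cmod w \<ge> R0 \<Longrightarrow> cmod (h w) \<le> K / cmod w"
    and "continuous_on UNIV (\<lambda>t. h (of_real t))"
proof -
  show hh: "h holomorphic_on {w. Im w > - e}" unfolding h_def
    by (rule holomorphic_on_compose_gen[OF _ hol, unfolded o_def]) (auto intro!: holomorphic_intros)
  show "cmod (h w) \<le> K / cmod w" if w: "Im w \<ge> 0" "cmod w \<ge> R0" for w
  proof -
    have "(cmod w)\<^sup>2 \<le> (cmod (w + \<i> * of_real e))\<^sup>2"
      using w e by (simp add: cmod_power2 power_mono)
    then have le: "cmod w \<le> cmod (w + \<i> * of_real e)" by (rule power2_le_imp_le) simp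
    have "cmod (h w) \<le> K / cmod (w + \<i> * of_real e)"
      unfolding h_def using w e le by (intro decay) auto
    also have "\<dots> \<le> K / cmod w" using le w R0 K by (intro divide_left_mono mult_pos_pos) linarith+
    finally show ?thesis .
  qed
  show "continuous_on UNIV (\<lambda>t. h (of_real t))"
    by (rule continuous_on_compose2[OF holomorphic_on_imp_continuous_on[OF hh]])
      (use e in \<open>auto intro!: continuous_intros\<close>)
qed

lemma holomorphic_vertical_limit:
  assumes "f holomorphic_on {w. Im w > 0}" "Im z > 0"
  shows "(\<lambda>k. f (z + \<i> * of_real (inverse (real (Suc k))))) \<longlonglongrightarrow> f z"
proof -
  have "isCont f z"
    using holomorphic_on_imp_continuous_on[OF assms(1)] assms(2) open_halfspace_Im_gt[of 0]
    by (simp add: continuous_on_eq_continuous_at)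
  moreover have "(\<lambda>k. z + \<i> * of_real (inverse (real (Suc k)))) \<longlonglongrightarrow> z + \<i> * of_real 0"
    by (intro tendsto_intros LIMSEQ_inverse_real_of_nat)
  ultimately show ?thesis using isCont_tendsto_compose by fastforce
qed

lemma at_right_0_imp_LIMSEQ:
  fixes g :: "real \<Rightarrow> 'a :: topological_space"
  assumes "(g \<longlongrightarrow> l) (at_right 0)"
  shows "(\<lambda>k. g (inverse (real (Suc k)))) \<longlonglongrightarrow> l"
proof (rule filterlim_compose[OF assms])
  show "filterlim (\<lambda>k. inverse (real (Suc k))) (at_right 0) sequentially"
    unfolding filterlim_at using LIMSEQ_inverse_real_of_nat by auto
qed

text \<open>The representation is applied to the shifts \<open>h k\<close>. Off
  \<open>\<Gamma>\<close> their imaginary parts on the axis disappear in the limit by dominated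
  convergence. On \<open>\<Gamma>\<close>, which has measure at most
  \<open>\<beta> - \<alpha>\<close>, they are at most \<open>B\<close> and the kernel is at most
  \<open>1 / \<delta>\<close>.\<close>

lemma half_plane_upper_bound:
  assumes hol: "f holomorphic_on {w. Im w > 0}"
    and decay: "\<And>w. Im w > 0 \<Longrightarrow> cmod w \<ge> R0 \<Longrightarrow> cmod (f w) \<le> K / cmod w" and K: "K \<ge> 0" and R0: "R0 > 0"
    and B: "\<And>w. Im w > 0 \<Longrightarrow> \<bar>Im (f w)\<bar> \<le> B"
    and \<Gamma>: "\<Gamma> \<in> sets lborel" "\<Gamma> \<subseteq> {\<alpha>..\<beta>}" "\<alpha> \<le> \<beta>"
    and ae: "AE t in lborel. t \<notin> \<Gamma> \<longrightarrow> ((\<lambda>\<epsilon>. Im (f (Complex t \<epsilon>))) \<longlongrightarrow> 0) (at_right 0)"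
    and z: "Im z > 0" and \<delta>: "\<delta> > 0" "\<And>t. t \<in> \<Gamma> \<Longrightarrow> \<delta> \<le> cmod (of_real t - z)"
  shows "cmod (f z) \<le> B * (\<beta> - \<alpha>) / \<delta>"
proof (rule le_of_le_add_inverse[of "max R0 (2 * cmod z)" _ _ "8 * K"])
  fix R assume R: "R > max R0 (2 * cmod z)"
  then have R': "R \<ge> R0" "R > 0" "R > 2 * cmod z" using R0 by auto
  define e where "e k = inverse (real (Suc k))" for k
  define h where "h k w = f (w + \<i> * of_real (e k))" for k w
  have e: "e k > 0" for k by (simp add: e_def)
  note h = half_plane_shift[OF hol e decay K R0, folded h_def]
  define q where "q k t = \<bar>Im (h k (of_real t))\<bar> / cmod (of_real t - z)" for k t
  define s where "s k t = indicator ({-R..R} - \<Gamma>) t * q k t" for k t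
  have den: "cmod (of_real t - z) \<ge> Im z" for t
    using abs_Im_le_cmod[of "of_real t - z"] by simp
  have den': "of_real t - z \<noteq> 0" for t using den[of t] z by auto
  have B0: "B \<ge> 0" using B[OF z] by linarith
  have hB: "\<bar>Im (h k (of_real t))\<bar> \<le> B" for k t unfolding h_def using e by (intro B) simp
  have q_le: "q k t \<le> B / Im z" for k t
    unfolding q_def using hB[of k t] den[of t] z B0 by (intro frac_le) auto
  have qmeas: "q k \<in> borel_measurable borel" for k
    unfolding q_def using h(3)[of k] den' by (intro borel_measurable_continuous_onI continuous_intros) auto
  have int_const: "integrable lborel (\<lambda>t. indicat_real {-R..R} t * (B / Im z))"
    by (intro Bochner_Integration.integrable_mult_left) (auto simp: emeasure_lborel_Icc_eq)
  have lim: "(\<lambda>k. integral\<^sup>L lborel (s k)) \<longlonglongrightarrow> integral\<^sup>L lborel (\<lambda>_ :: real. 0)"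
  proof (rule integral_dominated_convergence[where w = "\<lambda>t. indicator {-R..R} t * (B / Im z)"])
    show "AE t in lborel. (\<lambda>k. s k t) \<longlonglongrightarrow> 0"
      using ae
    proof eventually_elim
      case (elim t)
      show ?case
      proof (cases "t \<in> \<Gamma>")
        case False
        have "(\<lambda>k. Im (f (Complex t (e k)))) \<longlonglongrightarrow> 0"
          unfolding e_def using elim False by (intro at_right_0_imp_LIMSEQ) auto
        then have "(\<lambda>k. indicator ({-R..R} - \<Gamma>) t * (\<bar>Im (f (Complex t (e k)))\<bar> / cmod (of_real t - z)))
          \<longlonglongrightarrow> indicator ({-R..R} - \<Gamma>) t * (\<bar>0\<bar> / cmod (of_real t - z))"
          using den'[of t] by (intro tendsto_intros) auto
        then show ?thesis by (simp add: s_def q_def h_def Complex_eq)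
      qed (simp add: s_def)
    qed
    show "AE t in lborel. norm (s k t) \<le> indicator {-R..R} t * (B / Im z)" for k
      using q_le[of k] B0 z by (intro AE_I2) (auto simp: s_def q_def indicator_def)
    show "s k \<in> borel_measurable lborel" for k unfolding s_def using qmeas \<Gamma>(1) by measurable
    show "integrable lborel (\<lambda>t. indicator {-R..R} t * (B / Im z))" by (rule int_const)
  qed simp
  have int_s: "integrable lborel (s k)" for k
  proof (rule Bochner_Integration.integrable_bound[of _ "\<lambda>t. indicator {-R..R} t * (B / Im z)"])
    show "AE t in lborel. norm (s k t) \<le> norm (indicator {-R..R} t * (B / Im z) :: real)"
      using q_le[of k] z B0 by (intro AE_I2) (auto simp: s_def q_def indicator_def)
    show "s k \<in> borel_measurable lborel" unfolding s_def using qmeas \<Gamma>(1) by measurable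
  qed (rule int_const)
  have fin: "emeasure lborel \<Gamma> < \<infinity>"
  proof -
    have "emeasure lborel \<Gamma> \<le> emeasure lborel {\<alpha>..\<beta>}" using \<Gamma> by (intro emeasure_mono) auto
    also have "\<dots> < \<infinity>" using \<Gamma>(3) by simp
    finally show ?thesis .
  qed
  have meas: "measure lborel \<Gamma> \<le> \<beta> - \<alpha>"
    using measure_mono_fmeasurable[of \<Gamma> "{\<alpha>..\<beta>}" lborel] \<Gamma> by (simp add: fmeasurable_def)
  have main: "cmod (h k z) \<le> integral\<^sup>L lborel (s k) + B * (\<beta> - \<alpha>) / \<delta> + 8 * K / R" for k
  proof -
    define P where "P = integral {-R..R} (\<lambda>t. of_real (Im (h k (of_real t))) / (of_real t - z))"
    have rep: "cmod (h k z - P / pi) \<le> 8 * K / R"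
      unfolding P_def by (rule half_plane_representation[OF h(1) e z h(2) K R'])
    have "set_integrable lborel {-R..R} (\<lambda>t. of_real (Im (h k (of_real t))) / (of_real t - z) :: complex)"
      by (rule borel_integrable_atLeastAtMost', intro continuous_intros continuous_on_subset[OF h(3)]) (use den' in auto)
    then have "P = (LINT t:{-R..R}|lborel. of_real (Im (h k (of_real t))) / (of_real t - z))"
      unfolding P_def by (simp add: set_borel_integral_eq_integral)
    then have "cmod P \<le> (LINT t|lborel. cmod (indicator {-R..R} t *\<^sub>R (of_real (Im (h k (of_real t))) / (of_real t - z))))"
      unfolding set_lebesgue_integral_def by (simp only: integral_norm_bound)
    also have "\<dots> \<le> (LINT t|lborel. s k t + indicator \<Gamma> t * (B / \<delta>))"
    proof (rule integral_mono)
      show "integrable lborel (\<lambda>t. cmod (indicator {-R..R} t *\<^sub>R (of_real (Im (h k (of_real t))) / (of_real t - z))))"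
        using \<open>set_integrable lborel {-R..R} _\<close> unfolding set_integrable_def by (rule integrable_norm)
      show "integrable lborel (\<lambda>t. s k t + indicator \<Gamma> t * (B / \<delta>))"
        using fin \<Gamma>(1) by (intro Bochner_Integration.integrable_add int_s) auto
      fix t
      have "q k t \<le> B / \<delta>" if "t \<in> \<Gamma>"
        unfolding q_def using hB[of k t] \<delta>(2)[OF that] \<delta>(1) B0 by (intro frac_le) auto
      moreover have "q k t \<ge> 0" by (simp add: q_def)
      ultimately show "cmod (indicator {-R..R} t *\<^sub>R (of_real (Im (h k (of_real t))) / (of_real t - z)))
          \<le> s k t + indicator \<Gamma> t * (B / \<delta>)"
        using B0 \<delta>(1) by (auto simp: s_def q_def indicator_def norm_divide)
    qed
    also have "\<dots> = integral\<^sup>L lborel (s k) + measure lborel \<Gamma> * (B / \<delta>)"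
      using fin \<Gamma>(1) by (subst Bochner_Integration.integral_add) (auto intro: int_s)
    also have "\<dots> \<le> integral\<^sup>L lborel (s k) + (\<beta> - \<alpha>) * (B / \<delta>)"
      using meas B0 \<delta>(1) by (intro add_left_mono mult_right_mono) auto
    finally have P: "cmod P \<le> integral\<^sup>L lborel (s k) + (\<beta> - \<alpha>) * (B / \<delta>)" .
    have "cmod (h k z) \<le> cmod (h k z - P / pi) + cmod (P / pi)"
      by (metis diff_add_cancel norm_triangle_ineq)
    also have "cmod (P / pi) \<le> cmod P / 1"
      unfolding norm_divide using pi_gt3 by (intro divide_left_mono) auto
    finally show ?thesis using rep P by (simp add: mult.commute)
  qed
  have "(\<lambda>k. cmod (h k z)) \<longlonglongrightarrow> cmod (f z)"
    unfolding h_def e_def by (intro tendsto_norm holomorphic_vertical_limit hol z)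
  moreover have "(\<lambda>k. integral\<^sup>L lborel (s k) + B * (\<beta> - \<alpha>) / \<delta> + 8 * K / R)
    \<longlonglongrightarrow> 0 + B * (\<beta> - \<alpha>) / \<delta> + 8 * K / R"
    using lim by (intro tendsto_intros) simp
  ultimately have "cmod (f z) \<le> 0 + B * (\<beta> - \<alpha>) / \<delta> + 8 * K / R"
    by (rule LIMSEQ_le) (use main in auto)
  then show "cmod (f z) \<le> B * (\<beta> - \<alpha>) / \<delta> + 8 * K / R" by simp
qed

text \<open>Up to the factor \<open>1 / pi\<close>, the imaginary part of the representation at
  \<open>\<i> * Y\<close> is a Poisson integral of nonnegative values. It may be restricted to
  \<open>A\<close>, where the kernel is at least \<open>Y / (\<Lambda>^2 + Y^2)\<close>. Cutting the
  values off at \<open>m\<close> supplies a dominating function even if they are unbounded.\<close>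

lemma half_plane_lower_bound:
  assumes hol: "f holomorphic_on {w. Im w > 0}"
    and decay: "\<And>w. Im w > 0 \<Longrightarrow> cmod w \<ge> R0 \<Longrightarrow> cmod (f w) \<le> K / cmod w" and K: "K \<ge> 0" and R0: "R0 > 0"
    and pos: "\<And>w. Im w > 0 \<Longrightarrow> Im (f w) \<ge> 0"
    and A: "A \<in> sets lborel" "A \<subseteq> {-\<Lambda>..\<Lambda>}" and m: "m \<ge> 0" and Y: "Y > 0"
    and ae: "AE t in lborel. t \<in> A \<longrightarrow> (\<exists>l\<ge>m. ((\<lambda>\<epsilon>. Im (f (Complex t \<epsilon>))) \<longlongrightarrow> l) (at_right 0))"
  shows "m * measure lborel A * (Y / (\<Lambda>\<^sup>2 + Y\<^sup>2)) \<le> pi * Im (f (\<i> * of_real Y))"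
proof (rule le_of_le_add_inverse[of "max (max R0 \<bar>\<Lambda>\<bar>) (2 * Y)" _ _ "pi * (8 * K)"])
  define z where "z = \<i> * complex_of_real Y"
  have z: "Im z > 0" "cmod z = Y" using Y by (auto simp: z_def norm_mult)
  fix R assume R: "R > max (max R0 \<bar>\<Lambda>\<bar>) (2 * Y)"
  then have R': "R \<ge> R0" "R > 0" "R > 2 * cmod z" "R > \<bar>\<Lambda>\<bar>" using R0 z by auto
  define e where "e k = inverse (real (Suc k))" for k
  define h where "h k w = f (w + \<i> * of_real (e k))" for k w
  have e: "e k > 0" for k by (simp add: e_def)
  note h = half_plane_shift[OF hol e decay K R0, folded h_def]
  define s where "s k t = indicator A t * min (Im (h k (of_real t))) m" for k t
  have hpos: "Im (h k (of_real t)) \<ge> 0" for k t unfolding h_def using e by (intro pos) simp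
  have den': "of_real t - z \<noteq> 0" for t using Y by (auto simp: z_def complex_eq_iff)
  have fin: "emeasure lborel A < \<infinity>"
  proof -
    have "emeasure lborel A \<le> emeasure lborel {-\<Lambda>..\<Lambda>}" using A by (intro emeasure_mono) auto
    also have "\<dots> < \<infinity>" by (simp add: emeasure_lborel_Icc_eq)
    finally show ?thesis .
  qed
  have smeas: "s k \<in> borel_measurable lborel" for k
  proof -
    have "(\<lambda>t. min (Im (h k (of_real t))) m) \<in> borel_measurable borel"
      using h(3)[of k] by (intro borel_measurable_continuous_onI continuous_intros) auto
    then show ?thesis unfolding s_def using A(1) by measurable
  qed
  have intA: "integrable lborel (\<lambda>t. indicator A t * m)" using fin A(1) by auto
  have s_le: "norm (s k t) \<le> indicator A t * m" for k t
    using hpos[of k t] m by (auto simp: s_def indicator_def)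
  have lim: "(\<lambda>k. integral\<^sup>L lborel (s k)) \<longlonglongrightarrow> integral\<^sup>L lborel (\<lambda>t. indicator A t * m)"
  proof (rule integral_dominated_convergence[where w = "\<lambda>t. indicator A t * m"])
    show "AE t in lborel. (\<lambda>k. s k t) \<longlonglongrightarrow> indicator A t * m"
      using ae
    proof eventually_elim
      case (elim t)
      show ?case
      proof (cases "t \<in> A")
        case True
        then obtain l where l: "l \<ge> m" "((\<lambda>\<epsilon>. Im (f (Complex t \<epsilon>))) \<longlongrightarrow> l) (at_right 0)" using elim by blast
        have "(\<lambda>k. min (Im (f (Complex t (e k)))) m) \<longlonglongrightarrow> min l m"
          unfolding e_def by (intro tendsto_min at_right_0_imp_LIMSEQ l) auto
        then show ?thesis using True l(1) by (simp add: s_def h_def Complex_eq min_absorb2)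
      qed (simp add: s_def)
    qed
  qed (use smeas intA s_le A(1) in auto)
  have int_s: "integrable lborel (s k)" for k
    using m s_le[of k] by (intro Bochner_Integration.integrable_bound[OF intA smeas]) auto
  define y where "y = Y / (\<Lambda>\<^sup>2 + Y\<^sup>2)"
  have y: "y > 0" using Y by (simp add: y_def add_nonneg_pos)
  have main: "integral\<^sup>L lborel (s k) * y \<le> pi * Im (h k z) + pi * (8 * K / R)" for k
  proof -
    define g where "g t = of_real (Im (h k (of_real t))) / (of_real t - z)" for t
    define P where "P = integral {-R..R} g"
    have rep: "cmod (h k z - P / pi) \<le> 8 * K / R"
      unfolding P_def g_def by (rule half_plane_representation[OF h(1) e z(1) h(2) K R'(1-3)])
    have si: "set_integrable lborel {-R..R} g" unfolding g_def
      by (rule borel_integrable_atLeastAtMost', intro continuous_intros continuous_on_subset[OF h(3)]) (use den' in auto)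
    then have P: "P = (LINT t:{-R..R}|lborel. g t)"
      unfolding P_def by (simp add: set_borel_integral_eq_integral)
    have "integral\<^sup>L lborel (s k) * y = (LINT t|lborel. s k t * y)" by simp
    also have "\<dots> \<le> (LINT t|lborel. Im (indicator {-R..R} t *\<^sub>R g t))"
    proof (rule integral_mono)
      show "integrable lborel (\<lambda>t. s k t * y)" using int_s by simp
      show "integrable lborel (\<lambda>t. Im (indicator {-R..R} t *\<^sub>R g t))"
        using si unfolding set_integrable_def by (rule integrable_Im)
      fix t
      have g: "Im (g t) = Im (h k (of_real t)) * (Y / (t\<^sup>2 + Y\<^sup>2))"
        by (simp add: g_def z_def Im_divide)
      have g0: "Im (g t) \<ge> 0" unfolding g using hpos[of k t] Y by (intro mult_nonneg_nonneg) auto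
      show "s k t * y \<le> Im (indicator {-R..R} t *\<^sub>R g t)"
      proof (cases "t \<in> A")
        case True
        then have t: "\<bar>t\<bar> \<le> \<bar>\<Lambda>\<bar>" using A(2) by fastforce
        then have "t\<^sup>2 \<le> \<Lambda>\<^sup>2" using abs_le_square_iff by blast
        then have "y \<le> Y / (t\<^sup>2 + Y\<^sup>2)" unfolding y_def using Y
            by (intro divide_left_mono mult_pos_pos add_nonneg_pos) auto
        then have "min (Im (h k (of_real t))) m * y \<le> Im (g t)"
          unfolding g using hpos[of k t] y by (intro mult_mono) auto
        then show ?thesis using True t R'(4) by (auto simp: s_def indicator_def)
      qed (use g0 in \<open>auto simp: s_def indicator_def\<close>)
    qed
    also have "\<dots> = Im P"
      using si unfolding P set_lebesgue_integral_def set_integrable_def by (simp only: integral_Im)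
    also have "\<dots> \<le> pi * (Im (h k z) + 8 * K / R)"
    proof -
      have "Im (P / pi) \<le> Im (h k z) + 8 * K / R"
        using rep abs_Im_le_cmod[of "h k z - P / pi"] by simp
      then show ?thesis using pi_gt_zero by (simp add: field_simps)
    qed
    finally show ?thesis by (simp add: distrib_left)
  qed
  have "(\<lambda>k. integral\<^sup>L lborel (s k) * y) \<longlonglongrightarrow> integral\<^sup>L lborel (\<lambda>t. indicator A t * m) * y"
    by (intro tendsto_intros lim)
  moreover have "(\<lambda>k. pi * Im (h k z) + pi * (8 * K / R)) \<longlonglongrightarrow> pi * Im (f z) + pi * (8 * K / R)"
    unfolding h_def e_def by (intro tendsto_intros holomorphic_vertical_limit hol z)
  ultimately have "integral\<^sup>L lborel (\<lambda>t. indicator A t * m) * y \<le> pi * Im (f z) + pi * (8 * K / R)"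
    by (rule LIMSEQ_le) (use main in auto)
  also have "integral\<^sup>L lborel (\<lambda>t. indicator A t * m) = measure lborel A * m" using fin A(1) by simp
  finally show "m * measure lborel A * (Y / (\<Lambda>\<^sup>2 + Y\<^sup>2)) \<le> pi * Im (f (\<i> * of_real Y)) + pi * (8 * K) / R"
    by (simp add: y_def z_def mult.commute)
qed

section \<open>Comparison with the Herglotz function of an interval\<close>

lemma csqrt_quadrant:
  assumes "Im z \<noteq> 0"
  shows "Re (csqrt z) > 0" "Im z > 0 \<Longrightarrow> Im (csqrt z) > 0" "Im z < 0 \<Longrightarrow> Im (csqrt z) < 0"
proof -
  have "\<bar>Re z\<bar>\<^sup>2 < (cmod z)\<^sup>2" using assms by (simp add: cmod_power2)
  then have "\<bar>Re z\<bar> < cmod z" by (rule power2_less_imp_less) simp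
  then have "cmod z + Re z > 0" "cmod z - Re z > 0" by linarith+
  then show "Re (csqrt z) > 0" "Im z > 0 \<Longrightarrow> Im (csqrt z) > 0" "Im z < 0 \<Longrightarrow> Im (csqrt z) < 0"
    using assms by (auto simp: csqrt.simps)
qed

lemma csqrt_minus:
  assumes "Im z > 0"
  shows "csqrt z = \<i> * csqrt (- z)"
proof (rule csqrt_unique)
  show "(\<i> * csqrt (- z))\<^sup>2 = z" by (simp add: power_mult_distrib)
  show "0 < Re (\<i> * csqrt (- z)) \<or> Re (\<i> * csqrt (- z)) = 0 \<and> 0 \<le> Im (\<i> * csqrt (- z))"
    using csqrt_quadrant(3)[of "- z"] assms by simp
qed

lemma csqrt_tendsto_pos:
  assumes "(f \<longlongrightarrow> complex_of_real x) F" "x > 0"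
  shows "((\<lambda>t. csqrt (f t)) \<longlongrightarrow> complex_of_real (sqrt x)) F"
proof -
  have "complex_of_real x \<notin> \<real>\<^sub>\<le>\<^sub>0" using assms(2) by simp
  then have "isCont csqrt (complex_of_real x)" by (rule continuous_at_csqrt)
  from isCont_tendsto_compose[OF this assms(1)] show ?thesis
    using assms(2) by (simp add: csqrt_of_real_nonneg)
qed

text \<open>The branch of \<open>sqrt ((z - lo) (z - hi))\<close> behaving like \<open>z\<close> at infinity.\<close>

definition band_sqrt :: "real \<Rightarrow> real \<Rightarrow> complex \<Rightarrow> complex" where
  "band_sqrt lo hi z = csqrt (z - of_real lo) * csqrt (z - of_real hi)"

lemma vertical_tendsto: "((\<lambda>\<epsilon>. Complex t \<epsilon>) \<longlongrightarrow> of_real t) (at_right 0)"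
proof -
  have "((\<lambda>\<epsilon>. of_real t + \<i> * of_real \<epsilon>) \<longlongrightarrow> of_real t + \<i> * of_real 0) (at_right 0)"
    by (intro tendsto_intros)
  then show ?thesis by (simp add: Complex_eq)
qed

lemma vertical_eventually: "\<forall>\<^sub>F \<epsilon> in at_right 0. Im (Complex t \<epsilon>) > 0"
  by (simp add: eventually_at_right_less)

lemma band_sqrt_limits:
  assumes "lo < hi"
  shows "t > hi \<Longrightarrow> ((\<lambda>\<epsilon>. band_sqrt lo hi (Complex t \<epsilon>)) \<longlongrightarrow> of_real (sqrt ((t - lo) * (t - hi)))) (at_right 0)"
    and "lo < t \<Longrightarrow> t < hi \<Longrightarrow>
      ((\<lambda>\<epsilon>. band_sqrt lo hi (Complex t \<epsilon>)) \<longlongrightarrow> \<i> * of_real (sqrt ((t - lo) * (hi - t)))) (at_right 0)"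
    and "t < lo \<Longrightarrow> ((\<lambda>\<epsilon>. band_sqrt lo hi (Complex t \<epsilon>)) \<longlongrightarrow> - of_real (sqrt ((lo - t) * (hi - t)))) (at_right 0)"
proof -
  have right: "((\<lambda>\<epsilon>. csqrt (Complex t \<epsilon> - of_real c)) \<longlongrightarrow> of_real (sqrt (t - c))) (at_right 0)" if "c < t" for c
    using tendsto_diff[OF vertical_tendsto[of t] tendsto_const[of "of_real c"]] that
    by (intro csqrt_tendsto_pos) auto
  \<comment> \<open>Left of \<open>c\<close> the argument tends to the branch cut of
    \<open>csqrt\<close>; \<open>csqrt_minus\<close> moves it to the positive half-line, where
    \<open>csqrt\<close> is continuous.\<close>
  have left: "((\<lambda>\<epsilon>. csqrt (Complex t \<epsilon> - of_real c)) \<longlongrightarrow> \<i> * of_real (sqrt (c - t))) (at_right 0)" if "t < c" for c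
  proof -
    have "((\<lambda>\<epsilon>. csqrt (of_real c - Complex t \<epsilon>)) \<longlongrightarrow> of_real (sqrt (c - t))) (at_right 0)"
      using tendsto_diff[OF tendsto_const[of "of_real c"] vertical_tendsto[of t]] that
      by (intro csqrt_tendsto_pos) auto
    then have "((\<lambda>\<epsilon>. \<i> * csqrt (of_real c - Complex t \<epsilon>)) \<longlongrightarrow> \<i> * of_real (sqrt (c - t))) (at_right 0)"
      by (intro tendsto_intros)
    then show ?thesis
    proof (rule Lim_transform_eventually)
      show "\<forall>\<^sub>F \<epsilon> in at_right 0. \<i> * csqrt (of_real c - Complex t \<epsilon>) = csqrt (Complex t \<epsilon> - of_real c)"
        using vertical_eventually[of t]
      proof eventually_elim
        case (elim \<epsilon>)
        then show ?case using csqrt_minus[of "Complex t \<epsilon> - of_real c"] by simp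
      qed
    qed
  qed
  show "t > hi \<Longrightarrow> ((\<lambda>\<epsilon>. band_sqrt lo hi (Complex t \<epsilon>)) \<longlongrightarrow> of_real (sqrt ((t - lo) * (t - hi)))) (at_right 0)"
    using tendsto_mult[OF right[of lo] right[of hi]] assms by (simp add: band_sqrt_def real_sqrt_mult)
  show "lo < t \<Longrightarrow> t < hi \<Longrightarrow>
      ((\<lambda>\<epsilon>. band_sqrt lo hi (Complex t \<epsilon>)) \<longlongrightarrow> \<i> * of_real (sqrt ((t - lo) * (hi - t)))) (at_right 0)"
    using tendsto_mult[OF right[of lo] left[of hi]] by (simp add: band_sqrt_def real_sqrt_mult mult.left_commute)
  show "t < lo \<Longrightarrow> ((\<lambda>\<epsilon>. band_sqrt lo hi (Complex t \<epsilon>)) \<longlongrightarrow> - of_real (sqrt ((lo - t) * (hi - t)))) (at_right 0)"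
  proof -
    have eq: "\<i> * of_real p * (\<i> * of_real q) = - of_real (p * q)" for p q by (simp add: complex_eq_iff)
    assume "t < lo"
    then show ?thesis
      using tendsto_mult[OF left[of lo] left[of hi]] assms unfolding eq band_sqrt_def real_sqrt_mult by simp
  qed
qed

lemma Im_band_sqrt_pos:
  assumes "Im z > 0"
  shows "Im (band_sqrt lo hi z) > 0"
  using csqrt_quadrant[of "z - of_real lo"] csqrt_quadrant[of "z - of_real hi"] assms
  by (simp add: band_sqrt_def add_pos_pos)

lemma band_sqrt_holomorphic: "band_sqrt lo hi holomorphic_on {w. Im w > 0}"
  unfolding band_sqrt_def
  by (intro holomorphic_intros) (auto simp: complex_nonpos_Reals_iff)

text \<open>For the two roots \<open>p\<close> and \<open>q\<close>,
  \<open>(p - q) * (p + q) = hi - lo\<close>. Both lie in the open first quadrant, so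
  \<open>cmod q \<le> cmod (p + q)\<close> and \<open>(p - q) * q\<close> has modulus at most
  \<open>hi - lo\<close>. The rest of \<open>p * q - z\<close> is the constant
  \<open>- hi\<close>.\<close>

lemma band_sqrt_asymptotic:
  assumes "Im z > 0" "lo \<le> hi"
  shows "cmod (band_sqrt lo hi z - z) \<le> hi - lo + \<bar>hi\<bar>"
proof -
  let ?p = "csqrt (z - of_real lo)" and ?q = "csqrt (z - of_real hi)"
  have p: "Re ?p > 0" "Im ?p > 0" and q: "Re ?q > 0" "Im ?q > 0"
    using csqrt_quadrant[of "z - of_real lo"] csqrt_quadrant[of "z - of_real hi"] assms by auto
  have "cmod ?q \<le> cmod (?p + ?q)"
  proof -
    have "(cmod ?q)\<^sup>2 \<le> (cmod (?p + ?q))\<^sup>2"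
      unfolding cmod_power2 using p q by (intro add_mono power_mono) auto
    then show ?thesis by (rule power2_le_imp_le) simp
  qed
  moreover have "(?p - ?q) * (?p + ?q) = of_real (hi - lo)"
  proof -
    have "(?p - ?q) * (?p + ?q) = ?p\<^sup>2 - ?q\<^sup>2" by (simp add: power2_eq_square algebra_simps)
    then show ?thesis by simp
  qed
  then have "cmod (?p - ?q) * cmod (?p + ?q) = hi - lo"
    using assms(2) by (metis abs_of_nonneg diff_ge_0_iff_ge norm_mult norm_of_real)
  ultimately have le: "cmod (?p - ?q) * cmod ?q \<le> hi - lo" by (metis mult_left_mono norm_ge_zero)
  have "band_sqrt lo hi z - z = (?p - ?q) * ?q + (?q\<^sup>2 - z)"
    by (simp add: band_sqrt_def power2_eq_square algebra_simps)
  also have "?q\<^sup>2 - z = - of_real hi" by simp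
  also have "cmod ((?p - ?q) * ?q + - of_real hi) \<le> cmod ((?p - ?q) * ?q) + cmod (- of_real hi :: complex)"
    by (rule norm_triangle_ineq)
  finally show ?thesis using le by (simp add: norm_mult)
qed

text \<open>
  With \<open>r = - 1 / band_sqrt lo hi\<close>, the Herglotz function with purely imaginary boundary values on
  the whole of \<open>(lo, hi)\<close>, the function \<open>ln ((\<rho> + g / r) / (1 + \<rho>))\<close> has imaginary part at most
  \<open>\<pi>\<close>, and its boundary values are real outside the gaps; the parameter \<open>\<rho>\<close> excludes zeros of the
  boundary values of \<open>g\<close>. The gaps have distance at least \<open>\<delta>\<close> from the half-line beyond \<open>hi\<close>.
\<close>

lemma green_comparison:
  fixes g :: "complex \<Rightarrow> complex"
  assumes lohi: "lo < hi" and \<delta>: "\<delta> > 0"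
    and e: "e \<in> sets lborel" "{hi - \<delta>..hi} \<subseteq> e"
    and hol: "g holomorphic_on {w. Im w > 0}" and Im_g: "\<And>w. Im w > 0 \<Longrightarrow> Im (g w) > 0"
    and R0: "R0 > 0"
    and decay: "\<And>w. Im w > 0 \<Longrightarrow> cmod w \<ge> R0 \<Longrightarrow> cmod (g w) \<le> K / cmod w"
    and asymp: "\<And>w. Im w > 0 \<Longrightarrow> cmod w \<ge> R0 \<Longrightarrow> cmod (w * g w + 1) \<le> K / cmod w"
    and band: "AE t in lborel. t \<in> e \<longrightarrow> (\<exists>L. Re L = 0 \<and> ((\<lambda>\<epsilon>. g (Complex t \<epsilon>)) \<longlongrightarrow> L) (at_right 0))"
    and left: "\<And>t. t < lo \<Longrightarrow> \<exists>l\<ge>0. ((\<lambda>\<epsilon>. g (Complex t \<epsilon>)) \<longlongrightarrow> of_real l) (at_right 0)"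
    and right: "\<And>t. t > hi \<Longrightarrow> \<exists>l\<ge>0. ((\<lambda>\<epsilon>. g (Complex t \<epsilon>)) \<longlongrightarrow> - of_real l) (at_right 0)"
    and x: "x > hi" and lim: "((\<lambda>\<epsilon>. g (Complex x \<epsilon>)) \<longlongrightarrow> - of_real l) (at_right 0)" and l: "l \<ge> 0"
  shows "exp (- (pi * (hi - lo) / \<delta>)) \<le> l * sqrt ((x - lo) * (x - hi))"
    and "l * sqrt ((x - lo) * (x - hi)) \<le> exp (pi * (hi - lo) / \<delta>)"
proof -
  define S where "S = band_sqrt lo hi"
  define \<kappa> where "\<kappa> = pi * (hi - lo) / \<delta>"
  define c where "c = l * sqrt ((x - lo) * (x - hi))"
  have c0: "c \<ge> 0" using l x lohi by (simp add: c_def)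
  have K0: "K \<ge> 0"
  proof -
    have "cmod (g (\<i> * of_real R0)) \<le> K / R0"
      using decay[of "\<i> * of_real R0"] R0 by (simp add: norm_mult)
    then have "0 \<le> K / R0" by (rule order_trans[OF norm_ge_zero])
    then show ?thesis using R0 by (simp add: zero_le_divide_iff)
  qed
  have est: "exp (- \<kappa>) \<le> (\<rho> + c) / (1 + \<rho>)" "(\<rho> + c) / (1 + \<rho>) \<le> exp \<kappa>" if \<rho>: "\<rho> > 0" for \<rho> :: real
  proof -
    define w where "w z = (of_real \<rho> - g z * S z) / of_real (1 + \<rho>)" for z
    define D where "D z = Ln (w z)" for z
    \<comment> \<open>If \<open>w z\<close> were on the slit, \<open>g z * S z\<close> would be a
      positive real \<open>k\<close>, and \<open>g z = k / S z\<close> would have negative imaginary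
      part.\<close>
    have w_slit: "w z \<notin> \<real>\<^sub>\<le>\<^sub>0" if "Im z > 0" for z
    proof
      assume "w z \<in> \<real>\<^sub>\<le>\<^sub>0"
      then obtain s where s: "s \<le> 0" "w z = of_real s" by (auto elim: nonpos_Reals_cases)
      have "of_real (1 + \<rho>) \<noteq> (0 :: complex)" using \<rho> by (simp only: of_real_eq_0_iff)
      then have "of_real \<rho> - g z * S z = w z * of_real (1 + \<rho>)" by (simp add: w_def del: of_real_add)
      then have "of_real \<rho> - g z * S z = of_real s * of_real (1 + \<rho>)" by (simp only: s(2))
      then have "g z * S z = of_real (\<rho> - s * (1 + \<rho>))" by (simp add: algebra_simps)
      then obtain k where k: "k = \<rho> - s * (1 + \<rho>)" and gS: "g z * S z = of_real k" by blast
      have "s * (1 + \<rho>) \<le> 0" using s \<rho> by (intro mult_nonpos_nonneg) auto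
      then have k0: "k > 0" using \<rho> k by linarith
      have SI: "Im (S z) > 0" unfolding S_def by (rule Im_band_sqrt_pos[OF that])
      then have S0: "S z \<noteq> 0" by auto
      have "g z = of_real k / S z" using gS S0 by (simp add: eq_divide_eq)
      then have "Im (g z) = - (k * Im (S z)) / ((Re (S z))\<^sup>2 + (Im (S z))\<^sup>2)" by (simp add: Im_divide)
      also have "\<dots> \<le> 0" using k0 SI by (intro divide_nonpos_nonneg) auto
      finally show False using Im_g[OF that] by simp
    qed
    have holD: "D holomorphic_on {w. Im w > 0}"
      unfolding D_def w_def S_def
      by (intro holomorphic_intros hol band_sqrt_holomorphic)
        (use w_slit \<rho> in \<open>auto simp: w_def S_def complex_eq_iff\<close>)
    have ImD: "\<bar>Im (D z)\<bar> \<le> pi" if "Im z > 0" for z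
    proof -
      have "w z \<noteq> 0" using w_slit[OF that] by auto
      then show ?thesis using mpi_less_Im_Ln[of "w z"] Im_Ln_le_pi[of "w z"] by (simp add: D_def abs_le_iff)
    qed
    \<comment> \<open>\<open>K2\<close> bounds \<open>cmod z * cmod (g z * S z + 1)\<close>, because
      \<open>g z * S z + 1\<close> is the sum of \<open>z * g z + 1\<close> and
      \<open>g z * (S z - z)\<close>. This yields the decay of \<open>D\<close> at infinity.\<close>
    define K2 where "K2 = K + K * (hi - lo + \<bar>hi\<bar>)"
    have K2: "K2 \<ge> 0" using K0 lohi by (simp add: K2_def)
    have w1: "cmod (w z - 1) \<le> K2 / cmod z" if z: "Im z > 0" "cmod z \<ge> R0" for z
    proof -
      have "w z - 1 = - (g z * S z + 1) / of_real (1 + \<rho>)"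
      proof -
        have "of_real (1 + \<rho>) \<noteq> (0 :: complex)" using \<rho> by (simp only: of_real_eq_0_iff)
        then have "w z - 1 = ((of_real \<rho> - g z * S z) - of_real (1 + \<rho>)) / of_real (1 + \<rho>)"
          by (simp add: w_def diff_divide_distrib del: of_real_add)
        then show ?thesis by simp
      qed
      then have "cmod (w z - 1) = cmod (g z * S z + 1) / (1 + \<rho>)"
        using \<rho> by (simp only: norm_divide norm_minus_cancel norm_of_real)
      also have "\<dots> \<le> cmod (g z * S z + 1) / 1" using \<rho> by (intro divide_left_mono) auto
      also have "g z * S z + 1 = (z * g z + 1) + g z * (S z - z)" by (simp add: algebra_simps)
      also have "cmod \<dots> \<le> K / cmod z + K / cmod z * (hi - lo + \<bar>hi\<bar>)"
      proof -
        have "cmod (g z * (S z - z)) \<le> K / cmod z * (hi - lo + \<bar>hi\<bar>)"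
          unfolding norm_mult S_def using decay[OF z] band_sqrt_asymptotic[OF z(1), of lo hi] lohi K0
          by (intro mult_mono) auto
        with asymp[OF z] show ?thesis by (rule order_trans[OF norm_triangle_ineq add_mono])
      qed
      finally show ?thesis by (simp add: K2_def add_divide_distrib)
    qed
    define R1 where "R1 = max R0 (4 * K2)"
    have R1: "R1 > 0" using R0 by (simp add: R1_def)
    have decayD: "cmod (D z) \<le> 2 * K2 / cmod z" if z: "Im z > 0" "cmod z \<ge> R1" for z
    proof -
      have zz: "cmod z \<ge> R0" "cmod z \<ge> 4 * K2" "cmod z > 0" using z R0 by (auto simp: R1_def)
      have "K2 / cmod z \<le> 1 / 4" using zz by (simp add: field_simps)
      then have "cmod (w z - 1) < 1 / 2" using w1[OF z(1) zz(1)] by linarith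
      then have "cmod (Ln (1 + (w z - 1))) \<le> 2 * cmod (w z - 1)" by (rule norm_Ln_le)
      then show ?thesis using w1[OF z(1) zz(1)] by (simp add: D_def)
    qed
    have D_lim: "((\<lambda>\<epsilon>. D (Complex t \<epsilon>)) \<longlongrightarrow> of_real (ln ((\<rho> + q) / (1 + \<rho>)))) (at_right 0)"
      if "((\<lambda>\<epsilon>. - (g (Complex t \<epsilon>) * S (Complex t \<epsilon>))) \<longlongrightarrow> of_real q) (at_right 0)" "q \<ge> 0" for t q
    proof -
      have pos: "(\<rho> + q) / (1 + \<rho>) > 0" using \<rho> that(2) by simp
      have "((\<lambda>\<epsilon>. (of_real \<rho> + - (g (Complex t \<epsilon>) * S (Complex t \<epsilon>))) / of_real (1 + \<rho>))
          \<longlongrightarrow> (of_real \<rho> + of_real q) / of_real (1 + \<rho>)) (at_right 0)"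
        using \<rho> by (intro tendsto_intros that(1)) (simp del: of_real_add)
      then have "((\<lambda>\<epsilon>. w (Complex t \<epsilon>)) \<longlongrightarrow> of_real ((\<rho> + q) / (1 + \<rho>))) (at_right 0)"
        by (simp add: w_def)
      then have "((\<lambda>\<epsilon>. Ln (w (Complex t \<epsilon>))) \<longlongrightarrow> Ln (of_real ((\<rho> + q) / (1 + \<rho>)))) (at_right 0)"
        using pos by (intro tendsto_Ln) (auto simp del: of_real_divide)
      then show ?thesis unfolding D_def using Ln_of_real[OF pos] by simp
    qed
    have D_real: "((\<lambda>\<epsilon>. Im (D (Complex t \<epsilon>))) \<longlongrightarrow> 0) (at_right 0)"
      if "((\<lambda>\<epsilon>. - (g (Complex t \<epsilon>) * S (Complex t \<epsilon>))) \<longlongrightarrow> of_real q) (at_right 0)" "q \<ge> 0" for t q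
      using tendsto_Im[OF D_lim[OF that]] by simp
    define \<Gamma> where "\<Gamma> = {lo..hi} - e"
    have \<Gamma>: "\<Gamma> \<in> sets lborel" "\<Gamma> \<subseteq> {lo..hi}" using e by (auto simp: \<Gamma>_def)
    have ae: "AE t in lborel. t \<notin> \<Gamma> \<longrightarrow> ((\<lambda>\<epsilon>. Im (D (Complex t \<epsilon>))) \<longlongrightarrow> 0) (at_right 0)"
      using band AE_lborel_singleton[of lo] AE_lborel_singleton[of hi]
    proof eventually_elim
      case (elim t)
      show ?case
      proof
        assume "t \<notin> \<Gamma>"
        then consider "t < lo" | "t > hi" | "lo < t" "t < hi" "t \<in> e" using elim by (force simp: \<Gamma>_def)
        then show "((\<lambda>\<epsilon>. Im (D (Complex t \<epsilon>))) \<longlongrightarrow> 0) (at_right 0)"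
        proof cases
          case 1
          from left[OF 1] obtain l where l: "l \<ge> 0" "((\<lambda>\<epsilon>. g (Complex t \<epsilon>)) \<longlongrightarrow> of_real l) (at_right 0)" by blast
          show ?thesis
            by (rule D_real[of t "l * sqrt ((lo - t) * (hi - t))"])
              (use tendsto_minus[OF tendsto_mult[OF l(2) band_sqrt_limits(3)[OF lohi 1]]] l(1) 1 lohi in \<open>auto simp: S_def\<close>)
        next
          case 2
          from right[OF 2] obtain l where l: "l \<ge> 0" "((\<lambda>\<epsilon>. g (Complex t \<epsilon>)) \<longlongrightarrow> - of_real l) (at_right 0)" by blast
          show ?thesis
            by (rule D_real[of t "l * sqrt ((t - lo) * (t - hi))"])
              (use tendsto_minus[OF tendsto_mult[OF l(2) band_sqrt_limits(1)[OF lohi 2]]] l(1) 2 lohi in \<open>auto simp: S_def\<close>)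
        next
          case 3
          from elim 3 obtain L where L: "Re L = 0" "((\<lambda>\<epsilon>. g (Complex t \<epsilon>)) \<longlongrightarrow> L) (at_right 0)" by blast
          have "Im L \<ge> 0"
          proof (rule tendsto_lowerbound[OF tendsto_Im[OF L(2)]])
            show "\<forall>\<^sub>F \<epsilon> in at_right 0. 0 \<le> Im (g (Complex t \<epsilon>))"
              using vertical_eventually[of t] by eventually_elim (use Im_g in \<open>auto intro: less_imp_le\<close>)
          qed simp
          \<comment> \<open>On the band both limits are purely imaginary with nonnegative imaginary
            part, so minus their product is a nonnegative real.\<close>
          moreover have "- (L * (\<i> * of_real (sqrt ((t - lo) * (hi - t))))) = of_real (Im L * sqrt ((t - lo) * (hi - t)))"
            using L(1) by (simp add: complex_eq_iff)
          ultimately show ?thesis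
            using D_real[of t "Im L * sqrt ((t - lo) * (hi - t))"]
              tendsto_minus[OF tendsto_mult[OF L(2) band_sqrt_limits(2)[OF lohi 3(1,2)]]] 3
            by (simp add: S_def)
        qed
      qed
    qed
    have bound: "cmod (D (Complex x y)) \<le> \<kappa>" if "y > 0" for y
    proof -
      have "cmod (D (Complex x y)) \<le> pi * (hi - lo) / \<delta>"
      proof (rule half_plane_upper_bound[OF holD decayD _ R1 ImD \<Gamma> _ ae])
        fix t assume "t \<in> \<Gamma>"
        then have "t \<le> hi" "t \<notin> {hi - \<delta>..hi}" using e(2) by (auto simp: \<Gamma>_def)
        then have "t < hi - \<delta>" by auto
        then have "\<delta> \<le> x - t" using x by simp
        also have "\<dots> \<le> cmod (of_real t - Complex x y)" using abs_Re_le_cmod[of "of_real t - Complex x y"] by simp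
        finally show "\<delta> \<le> cmod (of_real t - Complex x y)" .
      qed (use that lohi \<delta> K2 in auto)
      then show ?thesis by (simp add: \<kappa>_def)
    qed
    have "((\<lambda>\<epsilon>. - (g (Complex x \<epsilon>) * S (Complex x \<epsilon>))) \<longlongrightarrow> of_real c) (at_right 0)"
      using tendsto_minus[OF tendsto_mult[OF lim band_sqrt_limits(1)[OF lohi x]]] by (simp add: S_def c_def)
    from tendsto_norm[OF D_lim[OF this c0]]
    have "cmod (of_real (ln ((\<rho> + c) / (1 + \<rho>)))) \<le> \<kappa>"
    proof (rule tendsto_upperbound)
      show "\<forall>\<^sub>F \<epsilon> in at_right 0. cmod (D (Complex x \<epsilon>)) \<le> \<kappa>"
        using eventually_at_right_less[of 0] by eventually_elim (rule bound)
    qed simp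
    then have ln: "\<bar>ln ((\<rho> + c) / (1 + \<rho>))\<bar> \<le> \<kappa>" by (simp only: norm_of_real)
    have pos: "(\<rho> + c) / (1 + \<rho>) > 0" using \<rho> c0 by simp
    show "exp (- \<kappa>) \<le> (\<rho> + c) / (1 + \<rho>)" "(\<rho> + c) / (1 + \<rho>) \<le> exp \<kappa>"
    proof -
      have "exp (- \<kappa>) \<le> exp (ln ((\<rho> + c) / (1 + \<rho>)))" "exp (ln ((\<rho> + c) / (1 + \<rho>))) \<le> exp \<kappa>"
        using ln by (simp_all only: exp_le_cancel_iff)
      then show "exp (- \<kappa>) \<le> (\<rho> + c) / (1 + \<rho>)" "(\<rho> + c) / (1 + \<rho>) \<le> exp \<kappa>"
        by (simp_all only: exp_ln[OF pos])
    qed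
  qed
  \<comment> \<open>The bounds in \<open>est\<close> are uniform in \<open>\<rho>\<close>, which may
    therefore tend to 0.\<close>
  have tend: "((\<lambda>\<rho>. (\<rho> + c) / (1 + \<rho>)) \<longlongrightarrow> (0 + c) / (1 + 0)) (at_right 0)"
    by (intro tendsto_intros) auto
  have "exp (- \<kappa>) \<le> (0 + c) / (1 + 0)"
    by (rule tendsto_lowerbound[OF tend]) (use est(1) in \<open>auto simp: eventually_at_right_less intro: eventually_mono[OF eventually_at_right_less[of 0]]\<close>)
  then show "exp (- (pi * (hi - lo) / \<delta>)) \<le> l * sqrt ((x - lo) * (x - hi))" by (simp add: c_def \<kappa>_def)
  have "(0 + c) / (1 + 0) \<le> exp \<kappa>"
    by (rule tendsto_upperbound[OF tend]) (use est(2) in \<open>auto intro: eventually_mono[OF eventually_at_right_less[of 0]]\<close>)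
  then show "l * sqrt ((x - lo) * (x - hi)) \<le> exp (pi * (hi - lo) / \<delta>)" by (simp add: c_def \<kappa>_def)
qed

section \<open>Ground states of finite gap Jacobi matrices\<close>

text \<open>Multiplication by a unimodular sequence is an isometric bijection of
  \<open>ell2 UNIV\<close>. The multipliers \<open>c\<close> and \<open>d\<close> are independent of
  each other, so that sign changes of the operator are included: \<open>c = -1\<close>,
  \<open>d = 1\<close> handles \<open>- T\<close>, and alternating signs handle the reversed
  diagonal.\<close>

lemma spectrum_multiplier:
  fixes c d :: "'i \<Rightarrow> complex"
  assumes c: "\<And>i. cmod (c i) = 1" and d: "\<And>i. cmod (d i) = 1"
    and eq: "\<And>\<phi>. shifted T' z \<phi> = (\<lambda>i. c i * shifted T w (\<lambda>i. d i * \<phi> i) i)"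
    and w: "w \<notin> spectrum UNIV T"
  shows "z \<notin> spectrum UNIV T'"
proof -
  define mul where "mul f \<phi> = (\<lambda>i. f i * \<phi> i)" for f \<phi> :: "'i \<Rightarrow> complex"
  have norm: "ell2_norm UNIV (mul f \<phi>) = ell2_norm UNIV \<phi>" if "\<And>i. cmod (f i) = 1" for f \<phi>
    using that by (simp add: mul_def ell2_norm_def norm_mult)
  have mem: "mul f \<phi> \<in> ell2 UNIV" if "\<And>i. cmod (f i) = 1" "\<phi> \<in> ell2 UNIV" for f \<phi>
    using that by (simp add: mul_def ell2_def norm_mult)
  have unit: "z * cnj z = 1" "cnj z * z = 1" if "cmod z = 1" for z
    using complex_norm_square[of z] that by (simp_all add: mult.commute)
  have inv: "mul (\<lambda>i. cnj (f i)) (mul f \<phi>) = \<phi>" "mul f (mul (\<lambda>i. cnj (f i)) \<phi>) = \<phi>" if "\<And>i. cmod (f i) = 1" for f \<phi>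
    using unit[OF that] by (simp_all add: mul_def fun_eq_iff mult.assoc[symmetric])
  have bij: "bij_betw (mul f) (ell2 UNIV) (ell2 UNIV)" if "\<And>i. cmod (f i) = 1" for f
    by (rule bij_betw_byWitness[where f' = "mul (\<lambda>i. cnj (f i))"]) (use that inv mem in auto)
  have eq': "shifted T' z = mul c \<circ> (shifted T w \<circ> mul d)"
    by (auto simp: fun_eq_iff eq mul_def)
  from w obtain K where K: "bij_betw (shifted T w) (ell2 UNIV) (ell2 UNIV)"
    "\<And>\<phi>. \<phi> \<in> ell2 UNIV \<Longrightarrow> ell2_norm UNIV \<phi> \<le> K * ell2_norm UNIV (shifted T w \<phi>)"
    by (auto simp: spectrum_def)
  have "bij_betw (shifted T' z) (ell2 UNIV) (ell2 UNIV)"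
    unfolding eq' by (intro bij_betw_trans[OF _ bij] bij_betw_trans[OF bij] K c d)
  moreover have "ell2_norm UNIV \<phi> \<le> K * ell2_norm UNIV (shifted T' z \<phi>)" if "\<phi> \<in> ell2 UNIV" for \<phi>
    using K(2)[OF mem[of d, OF d that]] by (simp add: eq' norm c d)
  ultimately show ?thesis unfolding spectrum_def by blast
qed

text \<open>Only the upper edge is assumed to end a band of length \<open>\<delta>\<close>; the
  lower edge is reached by instantiating the locale with the reflected matrix.\<close>

locale finite_gap_green = bounded_tridiagonal +
  fixes e :: "real set" and lo hi \<delta> :: real
  assumes \<alpha>_pos: "\<And>l. \<alpha> l > 0"
    and spec: "spec = complex_of_real ` e"
    and e_meas: "e \<in> sets lborel" and e_sub: "e \<subseteq> {lo..hi}" and \<delta>: "\<delta> > 0" "{hi - \<delta>..hi} \<subseteq> e"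
    and reflectionless: "\<And>n. AE x in lborel. x \<in> e \<longrightarrow>
      (\<exists>L. Re L = 0 \<and> ((\<lambda>\<epsilon>. green (Complex x \<epsilon>) n n) \<longlongrightarrow> L) (at_right 0))"
begin

lemma lo_hi: "lo < hi"
proof -
  have "hi - \<delta> \<in> e" using \<delta> by auto
  then show ?thesis using e_sub \<delta> by force
qed

lemma not_spec:
  "Im z \<noteq> 0 \<Longrightarrow> z \<notin> spec" "x > hi \<Longrightarrow> complex_of_real x \<notin> spec" "x < lo \<Longrightarrow> complex_of_real x \<notin> spec"
  using e_sub by (auto simp: spec)

lemma outside_open: "open (- complex_of_real ` {lo..hi})" "- complex_of_real ` {lo..hi} \<inter> spec = {}"
proof -
  have "compact (complex_of_real ` {lo..hi})" by (intro compact_continuous_image continuous_intros compact_Icc)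
  then show "open (- complex_of_real ` {lo..hi})" by (simp add: compact_imp_closed open_Compl)
qed (use e_sub in \<open>auto simp: spec\<close>)

lemma form_le: "\<phi> \<in> H \<Longrightarrow> Re (ip \<phi> (T \<phi>)) \<le> hi * (nrm \<phi>)\<^sup>2"
proof -
  assume \<phi>: "\<phi> \<in> H"
  obtain E where E: "complex_of_real E \<in> spec" "\<And>\<phi>. \<phi> \<in> H \<Longrightarrow> Re (ip \<phi> (T \<phi>)) \<le> E * (nrm \<phi>)\<^sup>2"
    using form_sup_in_spectrum by blast
  have "E \<le> hi" using E(1) e_sub by (auto simp: spec)
  then have "E * (nrm \<phi>)\<^sup>2 \<le> hi * (nrm \<phi>)\<^sup>2" by (intro mult_right_mono) auto
  then show ?thesis using E(2)[OF \<phi>] by linarith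
qed

lemma form_ge: "\<phi> \<in> H \<Longrightarrow> lo * (nrm \<phi>)\<^sup>2 \<le> Re (ip \<phi> (T \<phi>))"
proof -
  assume \<phi>: "\<phi> \<in> H"
  interpret N: bounded_tridiagonal "\<lambda>l. - \<alpha> l" "\<lambda>l. - \<beta> l" M
    by unfold_locales (use \<alpha>_le \<beta>_le M_pos in auto)
  obtain E where E: "complex_of_real E \<in> spectrum UNIV N.T" "\<And>\<phi>. \<phi> \<in> H \<Longrightarrow> Re (ip \<phi> (N.T \<phi>)) \<le> E * (nrm \<phi>)\<^sup>2"
    using N.form_sup_in_spectrum by blast
  have "- complex_of_real E \<in> spec"
  proof (rule ccontr)
    assume "- complex_of_real E \<notin> spec"
    then have "complex_of_real E \<notin> spectrum UNIV N.T"
      by (rule spectrum_multiplier[of "\<lambda>_. -1" "\<lambda>_. 1", rotated -1])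
        (auto simp: shifted_def tridiagonal_def fun_eq_iff algebra_simps)
    then show False using E(1) by simp
  qed
  then have "lo \<le> - E" using e_sub by (auto simp: spec complex_eq_iff)
  then have "lo * (nrm \<phi>)\<^sup>2 \<le> - E * (nrm \<phi>)\<^sup>2" by (intro mult_right_mono) auto
  moreover have "N.T \<phi> = (\<lambda>i. (-1) * T \<phi> i)" by (auto simp: tridiagonal_def algebra_simps)
  then have "ip \<phi> (N.T \<phi>) = - ip \<phi> (T \<phi>)" using ell2_inner_scale(1)[of \<phi> "-1" "T \<phi>"] by simp
  ultimately show ?thesis using E(2)[OF \<phi>] by simp
qed

lemma green_real:
  assumes "complex_of_real x \<notin> spec"
  shows "green (of_real x) n m = of_real (Re (green (of_real x) n m))"
proof -
  have "cnj (green (of_real x) n m) = green (of_real x) n m"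
    using green_cnj[of "of_real x", where n = n and m = m] assms by simp
  then have "Im (green (of_real x) n m) = 0" by (metis cnj.simps(2) equal_neg_zero)
  then show ?thesis by (simp add: complex_eq_iff)
qed

lemma green_diag_right: "x > hi \<Longrightarrow> Re (green (of_real x) n n) < 0"
proof -
  assume x: "x > hi"
  note s = not_spec(2)[OF x]
  have "0 < nrm (res (of_real x) (unit_seq n))"
    by (rule resolvent_norm_pos[OF s unit_seq_ell2(1), of _ n]) (simp add: unit_seq_def)
  then have "(hi - x) * (nrm (res (of_real x) (unit_seq n)))\<^sup>2 < 0" using x by (simp add: mult_neg_pos)
  then show ?thesis
    using resolvent_form[OF s unit_seq_ell2(1), of n] form_le[OF resolvent(1)[OF s unit_seq_ell2(1)], of n]
    by (simp add: ell2_inner_unit_left left_diff_distrib)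
qed

lemma green_diag_left: "x < lo \<Longrightarrow> Re (green (of_real x) n n) \<ge> 0"
proof -
  assume x: "x < lo"
  note s = not_spec(3)[OF x]
  have "(lo - x) * (nrm (res (of_real x) (unit_seq n)))\<^sup>2 \<ge> 0" using x by simp
  then show ?thesis
    using resolvent_form[OF s unit_seq_ell2(1), of n] form_ge[OF resolvent(1)[OF s unit_seq_ell2(1)], of n]
    by (simp add: ell2_inner_unit_left left_diff_distrib)
qed

text \<open>To the right of \<open>hi\<close> the form of the resolvent is nonpositive. Its value at
  the difference of two unit vectors bounds the off-diagonal entries by diagonal ones, uniformly in
  the sites.\<close>

lemma green_polarize:
  assumes "x > hi"
  shows "- 2 * Re (green (of_real x) n m) \<le> - Re (green (of_real x) n n) - Re (green (of_real x) m m)"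
proof -
  define z where "z = complex_of_real x"
  have s: "z \<notin> spec" unfolding z_def by (rule not_spec(2)[OF assms])
  note u = unit_seq_ell2(1)
  define \<psi> where "\<psi> = (\<lambda>i. unit_seq n i - unit_seq m i)"
  have \<psi>: "\<psi> \<in> H" unfolding \<psi>_def by (intro ell2_diff u)
  have lin: "res z \<psi> = (\<lambda>i. res z (unit_seq n) i - res z (unit_seq m) i)"
  proof (rule resolvent_unique[OF s])
    show "(\<lambda>i. res z (unit_seq n) i - res z (unit_seq m) i) \<in> H" by (intro ell2_diff resolvent(1) s u)
    show "shifted T z (\<lambda>i. res z (unit_seq n) i - res z (unit_seq m) i) = \<psi>"
      by (rule ext) (simp add: shifted_def T_linear resolvent_T[OF s u] \<psi>_def algebra_simps)
  qed
  have "Re (ip \<psi> (res z \<psi>)) \<le> (hi - x) * (nrm (res z \<psi>))\<^sup>2"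
    using resolvent_form[OF s \<psi>] form_le[OF resolvent(1)[OF s \<psi>]] by (simp add: z_def left_diff_distrib)
  also have "\<dots> \<le> 0" using assms by (intro mult_nonpos_nonneg) auto
  finally have "Re (ip \<psi> (res z \<psi>)) \<le> 0" .
  moreover have "ip \<psi> (res z \<psi>) = res z \<psi> n - res z \<psi> m"
    unfolding \<psi>_def[of] using ell2_inner_diff(2)[OF u u resolvent(1)[OF s \<psi>], of n m]
    by (simp add: ell2_inner_unit_left \<psi>_def)
  moreover have "green z m n = green z n m"
    using green_symmetric[of z, where n = m and m = n] s by (simp add: z_def)
  ultimately show ?thesis unfolding z_def[symmetric] lin by simp
qed

text \<open>
  For the negative part \<open>q\<close> of \<open>\<phi> = (x - T)\<^sup>-\<^sup>1 \<delta>\<^sub>m\<close>, positivity of the off-diagonal entries gives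
  \<open>0 \<le> \<langle>q, (x - T) \<phi>\<rangle> \<le> - \<langle>q, (x - T) q\<rangle>\<close>.
\<close>

lemma green_nonpos:
  assumes "x > hi"
  shows "Re (green (of_real x) n m) \<le> 0"
proof -
  define z where "z = complex_of_real x"
  have s: "z \<notin> spec" unfolding z_def by (rule not_spec(2)[OF assms])
  note u = unit_seq_ell2(1)
  define r where "r i = - Re (green z i m)" for i
  define q where "q i = complex_of_real (max (- r i) 0)" for i
  define p where "p i = complex_of_real (max (r i) 0)" for i
  have g: "green z i m = q i - p i" for i
    using green_real[of x, where n = i and m = m] s unfolding z_def[symmetric] by (simp add: r_def q_def p_def max_def complex_eq_iff)
  have R: "res z (unit_seq m) \<in> H" by (rule resolvent(1)[OF s u])
  have qH: "q \<in> H"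
    by (rule ell2_dominated(1)[OF R, of q 1]) (use abs_Re_le_cmod in \<open>auto simp: q_def r_def max_def intro: order_trans[OF abs_ge_self]\<close>)
  have pH: "p \<in> H"
    by (rule ell2_dominated(1)[OF R, of p 1]) (use abs_Re_le_cmod in \<open>auto simp: p_def r_def max_def intro: order_trans[OF abs_ge_minus_self]\<close>)
  have pq: "(\<lambda>i. q i - p i) = res z (unit_seq m)" using g by auto
  \<comment> \<open>\<open>q\<close> and \<open>p\<close> have disjoint supports, so the diagonal of
    \<open>T\<close> contributes nothing and nonnegative hopping terms remain.\<close>
  have qTp: "Re (ip q (T p)) \<ge> 0"
  proof -
    have "cnj (q i) * T p i = of_real (max (- r i) 0 * (\<alpha> i * max (r (i + 1)) 0 + \<alpha> (i - 1) * max (r (i - 1)) 0))" for i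
      by (simp add: q_def p_def tridiagonal_def max_def algebra_simps)
    then have "Re (ip q (T p)) = (\<Sum>\<^sub>\<infinity>i. max (- r i) 0 * (\<alpha> i * max (r (i + 1)) 0 + \<alpha> (i - 1) * max (r (i - 1)) 0))"
      using infsum_Re[OF ell2_inner_summable[OF qH T_bounded(1)[OF pH]]] by (simp add: ell2_inner_def)
    also have "\<dots> \<ge> 0"
      using \<alpha>_pos by (intro infsum_nonneg mult_nonneg_nonneg add_nonneg_nonneg) (auto intro: less_imp_le)
    finally show ?thesis .
  qed
  have qp: "ip q p = 0"
    unfolding ell2_inner_def by (intro infsum_0) (auto simp: q_def p_def max_def)
  have "ip q (T (res z (unit_seq m))) = ip q (\<lambda>i. unit_seq m i + z * res z (unit_seq m) i)"
    by (rule arg_cong[where f = "ip q"]) (rule ext, rule resolvent_T[OF s u])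
  also have "\<dots> = cnj (q m) + z * ip q (res z (unit_seq m))"
    using qH u[of m] R by (simp add: ell2_inner_add(1) ell2_scale ell2_inner_scale ell2_inner_unit_right)
  finally have "ip q (T (\<lambda>i. q i - p i)) = cnj (q m) + z * ip q (\<lambda>i. q i - p i)" by (simp only: pq)
  then have "ip q (T q) - ip q (T p) = cnj (q m) + z * (nrm q)\<^sup>2"
    using qH pH by (simp add: T_linear ell2_inner_diff(1) T_bounded ell2_inner_self qp)
  then have "Re (ip q (T q)) - Re (ip q (T p)) = Re (q m) + x * (nrm q)\<^sup>2"
    by (metis (no_types) Re_complex_of_real cnj.simps(1) minus_complex.simps(1) of_real_mult of_real_power plus_complex.simps(1) z_def)
  moreover have "Re (q m) \<ge> 0" by (simp add: q_def)
  ultimately have "x * (nrm q)\<^sup>2 \<le> hi * (nrm q)\<^sup>2" using form_le[OF qH] qTp by linarith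
  then have "nrm q = 0" using assms by (simp add: mult_le_cancel_right)
  then have "q n = 0" by (rule ell2_norm_eq_0_imp[OF qH])
  then show ?thesis by (simp add: q_def r_def z_def max_def split: if_splits)
qed

lemma green_tendsto_real:
  assumes "x < lo \<or> x > hi"
  shows "((\<lambda>\<epsilon>. green (Complex x \<epsilon>) n m) \<longlongrightarrow> of_real (Re (green (of_real x) n m))) (at_right 0)"
proof -
  have "(\<lambda>z. green z n m) holomorphic_on (- complex_of_real ` {lo..hi})"
    by (rule resolvent_holomorphic[OF outside_open unit_seq_ell2(1)])
  then have "isCont (\<lambda>z. green z n m) (of_real x)"
    using holomorphic_on_imp_continuous_on outside_open(1) assms by (fastforce simp: continuous_on_eq_continuous_at)
  from isCont_tendsto_compose[OF this vertical_tendsto] show ?thesis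
    using green_real[of x, where n = n and m = m] not_spec assms by auto
qed

lemma green_holomorphic: "(\<lambda>z. green z n m) holomorphic_on {w. Im w > 0}"
  by (rule resolvent_holomorphic[OF open_halfspace_Im_gt _ unit_seq_ell2(1)]) (use not_spec in auto)

lemma green_diag_bounds:
  assumes x: "x > hi"
  defines "\<kappa> \<equiv> pi * (hi - lo) / \<delta>"
  shows "exp (- \<kappa>) \<le> - Re (green (of_real x) n n) * sqrt ((x - lo) * (x - hi))"
    and "- Re (green (of_real x) n n) * sqrt ((x - lo) * (x - hi)) \<le> exp \<kappa>"
proof -
  \<comment> \<open>One constant for both estimates at infinity: 2 comes from the decay of the
    resolvent, \<open>6 * M\<close> from the next term.\<close>
  define K where "K = 6 * M + 2"
  have K: "K \<ge> 2" "K \<ge> 6 * M" using M_pos by (auto simp: K_def)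
  have decay: "cmod (green w n n) \<le> K / cmod w" if w: "Im w > 0" "cmod w \<ge> 6 * M" for w
  proof -
    have s: "w \<notin> spec" using not_spec w by auto
    have "cmod (green w n n) \<le> nrm (res w (unit_seq n))"
      by (rule cmod_le_ell2_norm[OF resolvent(1)[OF s unit_seq_ell2(1)]])
    also have "\<dots> \<le> 2 / cmod w"
      using resolvent_decay[OF s unit_seq_ell2(1) w(2), of n] by (simp add: unit_seq_ell2(2))
    also have "\<dots> \<le> K / cmod w" using K by (intro divide_right_mono) auto
    finally show ?thesis .
  qed
  have asymp: "cmod (w * green w n n + 1) \<le> K / cmod w" if w: "Im w > 0" "cmod w \<ge> 6 * M" for w
  proof -
    have s: "w \<notin> spec" using not_spec w by auto
    note R = resolvent(1)[OF s unit_seq_ell2(1), of n]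
    have "w * green w n n + 1 = T (res w (unit_seq n)) n"
      using resolvent_T[OF s unit_seq_ell2(1), of n n] by (simp add: unit_seq_def)
    also have "cmod \<dots> \<le> nrm (T (res w (unit_seq n)))" by (rule cmod_le_ell2_norm[OF T_bounded(1)[OF R]])
    also have "\<dots> \<le> 3 * M * nrm (res w (unit_seq n))" by (rule T_bounded(2)[OF R])
    also have "\<dots> \<le> 3 * M * (2 / cmod w)"
      using resolvent_decay[OF s unit_seq_ell2(1) w(2), of n] M_pos
      by (intro mult_left_mono) (auto simp: unit_seq_ell2(2))
    also have "\<dots> \<le> K / cmod w" using K by (simp add: divide_right_mono)
    finally show ?thesis .
  qed
  have Im_pos: "Im (green w n n) > 0" if "Im w > 0" for w
  proof -
    have s: "w \<notin> spec" using not_spec that by auto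
    have "0 < nrm (res w (unit_seq n))"
      by (rule resolvent_norm_pos[OF s unit_seq_ell2(1), of _ n]) (simp add: unit_seq_def)
    then show ?thesis
      using Im_resolvent_form[OF s unit_seq_ell2(1), of n] that by (simp add: ell2_inner_unit_left)
  qed
  have left: "\<exists>l\<ge>0. ((\<lambda>\<epsilon>. green (Complex t \<epsilon>) n n) \<longlongrightarrow> of_real l) (at_right 0)" if "t < lo" for t
    using green_tendsto_real[of t n n] green_diag_left[OF that, of n] that by blast
  have right: "((\<lambda>\<epsilon>. green (Complex t \<epsilon>) n n) \<longlongrightarrow> - of_real (- Re (green (of_real t) n n))) (at_right 0)" if "t > hi" for t
    using green_tendsto_real[of t n n] that by simp
  have right': "\<exists>l\<ge>0. ((\<lambda>\<epsilon>. green (Complex t \<epsilon>) n n) \<longlongrightarrow> - of_real l) (at_right 0)" if "t > hi" for t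
    using right[OF that] green_diag_right[OF that, of n] by (intro exI[of _ "- Re (green (of_real t) n n)"]) auto
  have R0: "6 * M > 0" using M_pos by simp
  note cmp = green_comparison[OF lo_hi \<delta>(1) e_meas \<delta>(2) green_holomorphic Im_pos R0 decay asymp reflectionless left right' x right[OF x]]
  show "exp (- \<kappa>) \<le> - Re (green (of_real x) n n) * sqrt ((x - lo) * (x - hi))"
    and "- Re (green (of_real x) n n) * sqrt ((x - lo) * (x - hi)) \<le> exp \<kappa>"
    unfolding \<kappa>_def using cmp green_diag_right[OF x, of n] by auto
qed

end

text \<open>For \<open>w \<noteq> 0\<close> the map satisfies
  \<open>- 1 / k = - 1 / w + \<i> / c\<close>, so it preserves the upper half-plane. If
  \<open>cmod w \<ge> c\<close>, then \<open>cmod k \<ge> c / 2\<close>, and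
  \<open>Im k \<ge> (cmod k)\<^sup>2 / c\<close> gives the constant 1/4. It turns a boundary value
  that is large, but possibly real, into one with large imaginary part, which
  \<open>half_plane_lower_bound\<close> can detect.\<close>

lemma cayley_Im:
  fixes w :: complex and c :: real
  assumes c: "c > 0" and w: "Im w \<ge> 0"
  defines "k \<equiv> w / (1 - \<i> * w / of_real c)"
  shows "1 - \<i> * w / of_real c \<noteq> 0" "cmod k \<le> cmod w" "Im k \<ge> 0" "cmod w \<ge> c \<Longrightarrow> Im k \<ge> c / 4"
proof -
  define d where "d = 1 - \<i> * w / of_real c"
  have d: "Re d = 1 + Im w / c" "Im d = - Re w / c" by (simp_all add: d_def)
  have Re1: "Re d \<ge> 1" using c w by (simp add: d)
  then show d0: "1 - \<i> * w / of_real c \<noteq> 0" unfolding d_def[symmetric] by auto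
  have d1: "cmod d \<ge> 1" using Re1 abs_Re_le_cmod[of d] by linarith
  then have "cmod w / cmod d \<le> cmod w / 1" by (intro divide_left_mono) auto
  then show "cmod k \<le> cmod w" by (simp add: k_def d_def norm_divide)
  define D where "D = (Re d)\<^sup>2 + (Im d)\<^sup>2"
  have D1: "D \<ge> 1" using d1 by (simp add: D_def flip: cmod_power2)
  define N where "N = Im w + (cmod w)\<^sup>2 / c"
  have Imk: "Im k = N / D"
  proof -
    have "Im k = (Im w * Re d - Re w * Im d) / D" by (simp add: k_def d_def[symmetric] Im_divide D_def)
    also have "Im w * Re d - Re w * Im d = N"
      using c unfolding d N_def cmod_power2 by (simp add: power2_eq_square field_simps)
    finally show ?thesis .
  qed
  have N0: "N \<ge> 0" using w c by (simp add: N_def)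
  then show "Im k \<ge> 0" using D1 by (simp add: Imk)
  assume wc: "cmod w \<ge> c"
  have "D = 1 + 2 * Im w / c + (cmod w)\<^sup>2 / c\<^sup>2"
    using c unfolding D_def d cmod_power2 by (simp add: power2_eq_square field_simps)
  then have 1: "c / 4 * D = c / 4 + Im w / 2 + (cmod w)\<^sup>2 / c / 4"
    using c by (simp add: power2_eq_square field_simps)
  have "c * c \<le> cmod w * cmod w" using wc c by (intro mult_mono) auto
  then have 2: "c \<le> (cmod w)\<^sup>2 / c" using c by (simp add: pos_le_divide_eq power2_eq_square)
  define q where "q = (cmod w)\<^sup>2 / c"
  have "c / 4 + Im w / 2 + q / 4 \<le> Im w + q" using 2 w c unfolding q_def[symmetric] by simp
  then have "c / 4 * D \<le> N" unfolding 1 N_def q_def .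
  then show "Im k \<ge> c / 4" using D1 by (simp add: Imk le_divide_eq)
qed

text \<open>The Wronskian does not depend on the site. If it were positive, upper bounds for
  \<open>\<alpha>\<close> and \<open>u\<close> would make \<open>v / u\<close> grow by at least a
  fixed \<open>d\<close> at each step to the right, so far to the left the ratio would be
  negative.\<close>

lemma wronskian_nonpos:
  fixes \<alpha> \<beta> u v :: "int \<Rightarrow> real"
  assumes \<alpha>: "\<And>n. \<alpha> n > 0" "\<And>n. \<alpha> n \<le> M" and u: "\<And>n. u n > 0" "\<And>n. u n \<le> B" and v: "\<And>n. v n > 0"
    and equ: "\<And>n. \<alpha> n * u (n + 1) + \<alpha> (n - 1) * u (n - 1) + \<beta> n * u n = E * u n"
    and eqv: "\<And>n. \<alpha> n * v (n + 1) + \<alpha> (n - 1) * v (n - 1) + \<beta> n * v n = E * v n"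
  shows "\<alpha> n * (u n * v (n + 1) - u (n + 1) * v n) \<le> 0"
proof (rule ccontr)
  define W where "W n = \<alpha> n * (u n * v (n + 1) - u (n + 1) * v n)" for n
  assume "\<not> \<alpha> n * (u n * v (n + 1) - u (n + 1) * v n) \<le> 0"
  then have Wn: "W n > 0" by (simp add: W_def)
  have W_rec: "W k = W (k - 1)" for k
  proof -
    have u: "\<alpha> k * u (k + 1) + \<alpha> (k - 1) * u (k - 1) = E * u k - \<beta> k * u k" using equ[of k] by simp
    have v: "\<alpha> k * v (k + 1) + \<alpha> (k - 1) * v (k - 1) = E * v k - \<beta> k * v k" using eqv[of k] by simp
    have "W k - W (k - 1) = u k * (\<alpha> k * v (k + 1) + \<alpha> (k - 1) * v (k - 1)) - v k * (\<alpha> k * u (k + 1) + \<alpha> (k - 1) * u (k - 1))"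
      by (simp add: W_def algebra_simps)
    also have "\<dots> = 0" unfolding u v by (simp add: algebra_simps)
    finally show ?thesis by simp
  qed
  have Wc: "W (n - int j) = W n" for j
  proof (induction j)
    case (Suc j)
    have "n - int (Suc j) = n - int j - 1" by simp
    then show ?case using W_rec[of "n - int j"] Suc.IH by (simp only:)
  qed simp
  define d where "d = W n / (M * B * B)"
  have MB: "M > 0" "B > 0" using \<alpha>[of 0] u[of 0] by linarith+
  have d: "d > 0" using Wn MB by (simp add: d_def)
  have step: "v (n - int j) / u (n - int j) \<le> v n / u n - real j * d" for j
  proof (induction j)
    case (Suc j)
    let ?k = "n - int (Suc j)"
    have "v (?k + 1) / u (?k + 1) - v ?k / u ?k = W ?k / (\<alpha> ?k * u ?k * u (?k + 1))"
      using u(1)[of ?k] u(1)[of "?k + 1"] \<alpha>(1)[of ?k] by (simp add: W_def field_simps)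
    also have "\<dots> \<ge> d"
      unfolding Wc d_def using Wn MB u(1)[of ?k] u(1)[of "?k + 1"] \<alpha>(1)[of ?k] u(2) \<alpha>(2)
      by (intro divide_left_mono mult_mono mult_pos_pos) (auto intro: less_imp_le)
    finally have "v ?k / u ?k \<le> v (?k + 1) / u (?k + 1) - d" by simp
    moreover have "?k + 1 = n - int j" by simp
    ultimately show ?case using Suc.IH by (simp add: algebra_simps)
  qed simp
  obtain j where "real j * d > v n / u n" using reals_Archimedean3[OF d] by blast
  then have "v (n - int j) / u (n - int j) < 0" using step[of j] by linarith
  moreover have "v (n - int j) / u (n - int j) > 0" using u(1) v by simp
  ultimately show False by simp
qed

text \<open>A nonzero Wronskian would make the ratio of the two solutions change sign.\<close>

lemma bounded_positive_solutions_proportional: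
  fixes \<alpha> \<beta> u v :: "int \<Rightarrow> real"
  assumes \<alpha>: "\<And>n. \<alpha> n > 0" "\<And>n. \<alpha> n \<le> M" and u: "\<And>n. u n > 0" "\<And>n. u n \<le> B" and v: "\<And>n. v n > 0" "\<And>n. v n \<le> B"
    and equ: "\<And>n. \<alpha> n * u (n + 1) + \<alpha> (n - 1) * u (n - 1) + \<beta> n * u n = E * u n"
    and eqv: "\<And>n. \<alpha> n * v (n + 1) + \<alpha> (n - 1) * v (n - 1) + \<beta> n * v n = E * v n"
  shows "u n * v 0 = u 0 * v n"
proof -
  have step: "u k * v (k + 1) = u (k + 1) * v k" for k
  proof -
    have "\<alpha> k * (u k * v (k + 1) - u (k + 1) * v k) \<le> 0" by (rule wronskian_nonpos[OF \<alpha> u v(1) equ eqv])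
    moreover have "\<alpha> k * (v k * u (k + 1) - v (k + 1) * u k) \<le> 0" by (rule wronskian_nonpos[OF \<alpha> v u(1) eqv equ])
    moreover have "\<alpha> k * (v k * u (k + 1) - v (k + 1) * u k) = - (\<alpha> k * (u k * v (k + 1) - u (k + 1) * v k))"
      by (simp add: algebra_simps)
    ultimately have "\<alpha> k * (u k * v (k + 1) - u (k + 1) * v k) = 0" by linarith
    then show ?thesis using \<alpha>(1)[of k] by simp
  qed
  have pos: "u k \<noteq> 0" for k using u(1)[of k] by simp
  have ratio: "v (k + 1) / u (k + 1) = v k / u k" for k using step[of k] pos by (simp add: field_simps)
  have "v n / u n = v 0 / u 0"
  proof (induction n rule: int_induct[where k = 0])
    case (step1 i)
    then show ?case using ratio[of i] by simp
  next
    case (step2 i)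
    then show ?case using ratio[of "i - 1"] by simp
  qed simp
  then show ?thesis using pos by (simp add: field_simps)
qed

section \<open>Uniform bounds for the off-diagonal entries and the ground state\<close>

context finite_gap_green
begin

text \<open>Reflectionlessness speaks of diagonal entries only. The equations in row
  \<open>n + 1\<close> for the columns \<open>n\<close>, \<open>n + 1\<close> and
  \<open>n + 2\<close> allow the entries at \<open>(n, n + 2)\<close> and
  \<open>(n + 1, n + 2)\<close> to be eliminated, which leaves \<open>green z n (n + 1)\<close> in
  terms of the diagonal.\<close>

lemma green_offdiag_identity:
  assumes "z \<notin> spec" "cnj z \<notin> spec"
  shows "(of_real (\<beta> (n + 1)) - z) * (2 * of_real (\<alpha> n) * green z n (n + 1) - 1)
    = (of_real (\<alpha> (n + 1)))\<^sup>2 * green z (n + 2) (n + 2) - (of_real (\<alpha> n))\<^sup>2 * green z n n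
      - (of_real (\<beta> (n + 1)) - z)\<^sup>2 * green z (n + 1) (n + 1)"
proof -
  define a0 a1 b where "a0 = complex_of_real (\<alpha> n)" and "a1 = complex_of_real (\<alpha> (n + 1))" and "b = complex_of_real (\<beta> (n + 1)) - z"
  have sym: "green z (n + 2) (n + 1) = green z (n + 1) (n + 2)" "green z (n + 2) n = green z n (n + 2)"
    "green z (n + 1) n = green z n (n + 1)"
    by (rule green_symmetric[OF assms])+
  note eq = green_eq[OF assms(1), of "n + 1"]
  have C: "a1 * green z (n + 1) (n + 2) = 1 - a0 * green z n (n + 1) - b * green z (n + 1) (n + 1)"
    using eq[of "n + 1"] sym
    by (simp add: a0_def a1_def b_def algebra_simps)
  have B: "a1 * green z n (n + 2) = - a0 * green z n n - b * green z n (n + 1)"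
    using eq[of n] sym
    by (simp add: a0_def a1_def b_def algebra_simps)
  have A: "a1 * green z (n + 2) (n + 2) = - a0 * green z n (n + 2) - b * green z (n + 1) (n + 2)"
    using eq[of "n + 2"] by (simp add: a0_def a1_def b_def algebra_simps)
  have "a1\<^sup>2 * green z (n + 2) (n + 2) = a1 * (a1 * green z (n + 2) (n + 2))"
    by (simp add: power2_eq_square mult.assoc)
  also have "\<dots> = - a0 * (a1 * green z n (n + 2)) - b * (a1 * green z (n + 1) (n + 2))"
    unfolding A by (simp add: algebra_simps)
  also have "\<dots> = a0\<^sup>2 * green z n n + b\<^sup>2 * green z (n + 1) (n + 1) + b * (2 * a0 * green z n (n + 1) - 1)"
    unfolding B C by (simp add: algebra_simps power2_eq_square)
  finally show ?thesis by (simp add: a0_def a1_def b_def)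
qed

text \<open>The quadratic form of the resolvent at \<open>unit_seq n + unit_seq (n + 1)\<close>,
  hence a Herglotz function. Its off-diagonal entry brings \<open>\<alpha> n\<close> into the
  boundary values.\<close>

definition bond_green :: "int \<Rightarrow> complex \<Rightarrow> complex" where
  "bond_green n z = green z n n + green z (n + 1) (n + 1) + 2 * green z n (n + 1)"

lemma bond_green_form:
  assumes z: "Im z > 0"
  shows "Im (bond_green n z) \<ge> 0" and "cmod z \<ge> 6 * M \<Longrightarrow> cmod (bond_green n z) \<le> 8 / cmod z"
proof -
  have s: "z \<notin> spec" "cnj z \<notin> spec" using not_spec z by auto
  note u = unit_seq_ell2(1)
  define \<psi> where "\<psi> = (\<lambda>i. unit_seq n i + unit_seq (n + 1) i)"
  have \<psi>: "\<psi> \<in> H" unfolding \<psi>_def by (intro ell2_add u)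
  have \<psi>2: "nrm \<psi> \<le> 2" unfolding \<psi>_def
    using ell2_add(2)[OF u u, of n "n + 1"] unit_seq_ell2(2)[of n] unit_seq_ell2(2)[of "n + 1"] by linarith
  have lin: "res z \<psi> = (\<lambda>i. res z (unit_seq n) i + res z (unit_seq (n + 1)) i)"
  proof (rule resolvent_unique[OF s(1)])
    show "(\<lambda>i. res z (unit_seq n) i + res z (unit_seq (n + 1)) i) \<in> H" by (intro ell2_add resolvent(1) s u)
    show "shifted T z (\<lambda>i. res z (unit_seq n) i + res z (unit_seq (n + 1)) i) = \<psi>"
      by (rule ext) (simp add: shifted_def T_linear resolvent_T[OF s(1) u] \<psi>_def algebra_simps)
  qed
  have "ip \<psi> (res z \<psi>) = res z \<psi> n + res z \<psi> (n + 1)"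
    using ell2_inner_add(2)[OF u u resolvent(1)[OF s(1) \<psi>], of n "n + 1"]
    by (simp add: ell2_inner_unit_left \<psi>_def)
  also have "\<dots> = bond_green n z"
    unfolding lin bond_green_def using green_symmetric[OF s, where n = n and m = "n + 1"] by simp
  finally have eq: "bond_green n z = ip \<psi> (res z \<psi>)" ..
  show "Im (bond_green n z) \<ge> 0" unfolding eq Im_resolvent_form[OF s(1) \<psi>] using z by simp
  assume big: "cmod z \<ge> 6 * M"
  have "cmod (bond_green n z) \<le> nrm \<psi> * nrm (res z \<psi>)"
    unfolding eq by (rule ell2_cauchy_schwarz[OF \<psi> resolvent(1)[OF s(1) \<psi>]])
  also have "\<dots> \<le> 2 * (2 * 2 / cmod z)"
  proof (intro mult_mono \<psi>2)
    have "nrm (res z \<psi>) \<le> 2 * nrm \<psi> / cmod z" by (rule resolvent_decay[OF s(1) \<psi> big])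
    also have "\<dots> \<le> 2 * 2 / cmod z" using \<psi>2 by (intro divide_right_mono) auto
    finally show "nrm (res z \<psi>) \<le> 2 * 2 / cmod z" .
  qed auto
  finally show "cmod (bond_green n z) \<le> 8 / cmod z" by simp
qed

text \<open>By \<open>green_offdiag_identity\<close>,
  \<open>2 * \<alpha> n * green z n (n + 1) - 1\<close> has a purely imaginary limit at almost every
  point of \<open>e\<close>. The identity degenerates at \<open>\<beta> (n + 1)\<close>, a single
  point.\<close>

lemma bond_green_limit:
  "AE t in lborel. t \<in> e \<longrightarrow> (\<exists>L. Re L = 1 / \<alpha> n \<and> ((\<lambda>\<epsilon>. bond_green n (Complex t \<epsilon>)) \<longlongrightarrow> L) (at_right 0))"
  using reflectionless[of n] reflectionless[of "n + 1"] reflectionless[of "n + 2"] AE_lborel_singleton[of "\<beta> (n + 1)"]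
proof eventually_elim
  case (elim t)
  show ?case
  proof
    assume "t \<in> e"
    then obtain L0 L1 L2 where Re: "Re L0 = 0" "Re L1 = 0" "Re L2 = 0"
      and L0: "((\<lambda>\<epsilon>. green (Complex t \<epsilon>) n n) \<longlongrightarrow> L0) (at_right 0)"
      and L1: "((\<lambda>\<epsilon>. green (Complex t \<epsilon>) (n + 1) (n + 1)) \<longlongrightarrow> L1) (at_right 0)"
      and L2: "((\<lambda>\<epsilon>. green (Complex t \<epsilon>) (n + 2) (n + 2)) \<longlongrightarrow> L2) (at_right 0)"
      using elim by blast
    define b where "b z = complex_of_real (\<beta> (n + 1)) - z" for z
    define X where "X z = (of_real (\<alpha> (n + 1)))\<^sup>2 * green z (n + 2) (n + 2) - (of_real (\<alpha> n))\<^sup>2 * green z n n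
      - (b z)\<^sup>2 * green z (n + 1) (n + 1)" for z
    define bt where "bt = \<beta> (n + 1) - t"
    have bt: "bt \<noteq> 0" using elim by (simp add: bt_def)
    define Xl where "Xl = (of_real (\<alpha> (n + 1)))\<^sup>2 * L2 - (of_real (\<alpha> n))\<^sup>2 * L0 - (of_real bt)\<^sup>2 * L1"
    have a: "\<alpha> n > 0" by (rule \<alpha>_pos)
    have blim: "((\<lambda>\<epsilon>. b (Complex t \<epsilon>)) \<longlongrightarrow> of_real bt) (at_right 0)"
      unfolding b_def bt_def of_real_diff by (intro tendsto_intros vertical_tendsto)
    then have Xlim: "((\<lambda>\<epsilon>. X (Complex t \<epsilon>)) \<longlongrightarrow> Xl) (at_right 0)"
      unfolding X_def Xl_def by (intro tendsto_intros L0 L1 L2)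
    have "((\<lambda>\<epsilon>. (1 + X (Complex t \<epsilon>) / b (Complex t \<epsilon>)) / of_real (\<alpha> n)) \<longlongrightarrow> (1 + Xl / of_real bt) / of_real (\<alpha> n)) (at_right 0)"
      using bt a by (intro tendsto_intros Xlim blim) auto
    then have G01: "((\<lambda>\<epsilon>. 2 * green (Complex t \<epsilon>) n (n + 1)) \<longlongrightarrow> (1 + Xl / of_real bt) / of_real (\<alpha> n)) (at_right 0)"
    proof (rule Lim_transform_eventually)
      show "\<forall>\<^sub>F \<epsilon> in at_right 0. (1 + X (Complex t \<epsilon>) / b (Complex t \<epsilon>)) / of_real (\<alpha> n) = 2 * green (Complex t \<epsilon>) n (n + 1)"
        using vertical_eventually[of t]
      proof eventually_elim
        case (elim \<epsilon>)
        define z where "z = Complex t \<epsilon>"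
        have s: "z \<notin> spec" "cnj z \<notin> spec" using elim not_spec by (auto simp: z_def)
        have b0: "b z \<noteq> 0" using elim by (auto simp: b_def z_def complex_eq_iff)
        have "b z * (2 * of_real (\<alpha> n) * green z n (n + 1) - 1) = X z"
          using green_offdiag_identity[OF s, of n] by (simp add: b_def X_def)
        then have "X z / b z = 2 * of_real (\<alpha> n) * green z n (n + 1) - 1" using b0 by (simp add: field_simps)
        then show ?case using a by (simp add: z_def[symmetric])
      qed
    qed
    have "Re ((1 + Xl / of_real bt) / of_real (\<alpha> n)) = 1 / \<alpha> n"
      using Re by (simp add: Xl_def power2_eq_square)
    then show "\<exists>L. Re L = 1 / \<alpha> n \<and> ((\<lambda>\<epsilon>. bond_green n (Complex t \<epsilon>)) \<longlongrightarrow> L) (at_right 0)"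
      using tendsto_add[OF tendsto_add[OF L0 L1] G01] Re
      by (intro exI[of _ "L0 + L1 + (1 + Xl / of_real bt) / of_real (\<alpha> n)"]) (simp add: bond_green_def)
  qed
qed

text \<open>
  A small \<open>\<alpha> n\<close> makes the boundary values of the Herglotz function \<open>bond_green n\<close> large on all of
  \<open>e\<close>, which the total mass of its measure does not allow.
\<close>

lemma offdiag_lower_bound: "\<exists>c>0. \<forall>n. c \<le> \<alpha> n"
proof -
  define \<Lambda> where "\<Lambda> = max \<bar>lo\<bar> \<bar>hi\<bar>"
  define Y where "Y = 6 * M"
  \<comment> \<open>With \<open>l = 1 / \<alpha> n\<close>, solving \<open>l / 4 * \<delta> * (Y /
    (\<Lambda>^2 + Y^2)) \<le> pi * (8 / Y)\<close> for \<open>l\<close> gives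
    \<open>C\<close>.\<close>
  define C where "C = 32 * pi * (\<Lambda>\<^sup>2 + Y\<^sup>2) / (Y\<^sup>2 * \<delta>)"
  have Y: "Y > 0" using M_pos by (simp add: Y_def)
  have YL: "\<Lambda>\<^sup>2 + Y\<^sup>2 > 0" using Y by (intro add_nonneg_pos) auto
  have C: "C > 0" unfolding C_def using Y YL \<delta>(1) by simp
  have "\<bar>lo\<bar> \<le> \<Lambda>" "\<bar>hi\<bar> \<le> \<Lambda>" by (simp_all add: \<Lambda>_def)
  then have "{lo..hi} \<subseteq> {-\<Lambda>..\<Lambda>}" by auto
  then have sub: "e \<subseteq> {-\<Lambda>..\<Lambda>}" using e_sub by blast
  have "e \<in> fmeasurable lborel"
  proof -
    have "emeasure lborel e \<le> emeasure lborel {lo..hi}" using e_sub e_meas by (intro emeasure_mono) auto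
    also have "\<dots> < \<infinity>" by (simp add: emeasure_lborel_Icc_eq)
    finally show ?thesis using e_meas by (simp add: fmeasurable_def)
  qed
  then have "measure lborel {hi - \<delta>..hi} \<le> measure lborel e"
    using \<delta> by (intro measure_mono_fmeasurable) auto
  then have me: "measure lborel e \<ge> \<delta>" using \<delta>(1) by simp
  have inv: "1 / \<alpha> n \<le> C" for n
  proof -
    define l where "l = 1 / \<alpha> n"
    have l: "l > 0" using \<alpha>_pos by (simp add: l_def)
    \<comment> \<open>The parameter \<open>l\<close> fits the boundary values: on \<open>e\<close>
      they have real part \<open>l\<close>, hence modulus at least \<open>l\<close>, and the
      transform raises the imaginary part to \<open>l / 4\<close>.\<close>
    define k where "k z = bond_green n z / (1 - \<i> * bond_green n z / of_real l)" for z
    note cay = cayley_Im[OF l, folded k_def]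
    have hol: "k holomorphic_on {w. Im w > 0}"
      unfolding k_def using cay(1)[OF bond_green_form(1)] l unfolding bond_green_def
      by (intro holomorphic_intros green_holomorphic) auto
    have decay: "cmod (k w) \<le> 8 / cmod w" if "Im w > 0" "cmod w \<ge> 6 * M" for w
      using cay(2)[OF bond_green_form(1)[OF that(1)]] bond_green_form(2)[OF that] k_def by (metis order_trans)
    have pos: "Im (k w) \<ge> 0" if "Im w > 0" for w
      using cay(3)[OF bond_green_form(1)[OF that]] by (simp add: k_def)
    have ae: "AE t in lborel. t \<in> e \<longrightarrow> (\<exists>m\<ge>l / 4. ((\<lambda>\<epsilon>. Im (k (Complex t \<epsilon>))) \<longlongrightarrow> m) (at_right 0))"
      using bond_green_limit[of n]
    proof eventually_elim
      case (elim t)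
      show ?case
      proof
        assume "t \<in> e"
        then obtain L where L: "Re L = l" "((\<lambda>\<epsilon>. bond_green n (Complex t \<epsilon>)) \<longlongrightarrow> L) (at_right 0)"
          using elim by (auto simp: l_def)
        have ImL: "Im L \<ge> 0"
        proof (rule tendsto_lowerbound[OF tendsto_Im[OF L(2)]])
          show "\<forall>\<^sub>F \<epsilon> in at_right 0. 0 \<le> Im (bond_green n (Complex t \<epsilon>))"
            using vertical_eventually[of t] by eventually_elim (rule bond_green_form(1))
        qed simp
        have big: "cmod L \<ge> l" using L(1) l abs_Re_le_cmod[of L] by linarith
        have "((\<lambda>\<epsilon>. Im (k (Complex t \<epsilon>))) \<longlongrightarrow> Im (L / (1 - \<i> * L / of_real l))) (at_right 0)"
          unfolding k_def using cayley_Im(1)[OF l ImL] l by (intro tendsto_intros L(2)) auto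
        moreover have "Im (L / (1 - \<i> * L / of_real l)) \<ge> l / 4" by (rule cayley_Im(4)[OF l ImL big])
        ultimately show "\<exists>m\<ge>l / 4. ((\<lambda>\<epsilon>. Im (k (Complex t \<epsilon>))) \<longlongrightarrow> m) (at_right 0)" by blast
      qed
    qed
    have "l / 4 * measure lborel e * (Y / (\<Lambda>\<^sup>2 + Y\<^sup>2)) \<le> pi * Im (k (\<i> * of_real Y))"
      by (rule half_plane_lower_bound[where ?R0.0 = "6 * M" and K = 8, OF hol decay _ _ pos e_meas sub _ Y ae]) (use M_pos l in auto)
    also have "Im (k (\<i> * of_real Y)) \<le> 8 / Y"
      using decay[of "\<i> * of_real Y"] Y abs_Im_le_cmod[of "k (\<i> * of_real Y)"] by (simp add: norm_mult Y_def)
    finally have "l / 4 * measure lborel e * (Y / (\<Lambda>\<^sup>2 + Y\<^sup>2)) \<le> pi * (8 / Y)" by simp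
    moreover have "l / 4 * \<delta> * (Y / (\<Lambda>\<^sup>2 + Y\<^sup>2)) \<le> l / 4 * measure lborel e * (Y / (\<Lambda>\<^sup>2 + Y\<^sup>2))"
      using me l Y YL by (intro mult_right_mono mult_left_mono) auto
    ultimately have "l / 4 * \<delta> * (Y / (\<Lambda>\<^sup>2 + Y\<^sup>2)) \<le> pi * (8 / Y)" by linarith
    then show ?thesis
      unfolding l_def[symmetric] C_def using Y YL \<delta>(1)
      by (simp add: field_simps power2_eq_square)
  qed
  have "1 / C \<le> \<alpha> n" for n using inv[of n] C \<alpha>_pos[of n] by (simp add: field_simps)
  then show ?thesis using C by (intro exI[of _ "1 / C"]) auto
qed

text \<open>The upper bound comes from \<open>green_polarize\<close> and the diagonal bounds. The
  lower bound off the diagonal comes from rigidity: the columns of the limit kernel \<open>h\<close>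
  are bounded positive solutions, hence proportional, and with symmetry
  \<open>(h (n, 0))\<^sup>2 = h (0, 0) * h (n, n)\<close>, where the diagonal is bounded
  below.\<close>

lemma positive_bounded_solution:
  obtains u c where "c > 0" "\<And>n. c \<le> u n" "\<And>n. u n \<le> 1 / c"
    "\<And>n. \<alpha> n * u (n + 1) + \<alpha> (n - 1) * u (n - 1) + \<beta> n * u n = hi * u n"
proof -
  define B where "B = exp (pi * (hi - lo) / \<delta>)"
  have B: "B > 0" "exp (- (pi * (hi - lo) / \<delta>)) = 1 / B" by (simp_all add: B_def exp_minus inverse_eq_divide)
  define x where "x k = hi + inverse (real (Suc k))" for k
  have x: "x k > hi" for k by (simp add: x_def)
  \<comment> \<open>As \<open>x k\<close> decreases to \<open>hi\<close> the factor
    \<open>s k\<close> tends to 0 and removes the unit source from the equation, so the limits solve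
    the homogeneous one.\<close>
  define s where "s k = sqrt ((x k - lo) * (x k - hi))" for k
  have s0: "s k \<ge> 0" for k using x[of k] lo_hi by (simp add: s_def)
  have xlim: "x \<longlonglongrightarrow> hi"
    unfolding x_def using tendsto_add[OF tendsto_const LIMSEQ_inverse_real_of_nat, of hi] by simp
  then have slim: "s \<longlonglongrightarrow> 0"
    unfolding s_def using tendsto_real_sqrt[OF tendsto_mult[OF tendsto_diff[OF xlim tendsto_const[of lo]] tendsto_diff[OF xlim tendsto_const[of hi]]]]
    by simp
  define f where "f k = (\<lambda>(n, m). - Re (green (of_real (x k)) n m) * s k)" for k
  have f_diag: "1 / B \<le> f k (n, n)" "f k (n, n) \<le> B" for k n
    using green_diag_bounds[OF x, of k n] unfolding B(2) by (simp_all add: f_def s_def B_def)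
  have f0: "0 \<le> f k (n, m)" for k n m
    using green_nonpos[OF x, where n = n and m = m] s0[of k] by (simp add: f_def mult_nonpos_nonneg)
  have f_le: "f k (n, m) \<le> B" for k n m
  proof -
    have "- 2 * Re (green (of_real (x k)) n m) * s k
      \<le> (- Re (green (of_real (x k)) n n) - Re (green (of_real (x k)) m m)) * s k"
      using green_polarize[OF x, where n = n and m = m] s0[of k] by (rule mult_right_mono)
    then have "2 * f k (n, m) \<le> f k (n, n) + f k (m, m)" by (simp add: f_def algebra_simps)
    then show ?thesis using f_diag(2)[of k n] f_diag(2)[of k m] by linarith
  qed
  have f_sym: "f k (n, m) = f k (m, n)" for k n m
    using green_symmetric[of "of_real (x k)", where n = n and m = m] not_spec(2)[OF x] by (simp add: f_def)
  have f_eq: "\<alpha> n * f k (n + 1, m) + \<alpha> (n - 1) * f k (n - 1, m) + \<beta> n * f k (n, m)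
    = x k * f k (n, m) - (if n = m then s k else 0)" for k n m
  proof -
    have "\<alpha> n * Re (green (of_real (x k)) (n + 1) m) + \<alpha> (n - 1) * Re (green (of_real (x k)) (n - 1) m)
        + \<beta> n * Re (green (of_real (x k)) n m) = x k * Re (green (of_real (x k)) n m) + (if n = m then 1 else 0)"
      using arg_cong[OF green_eq[OF not_spec(2)[OF x], of n k m], of Re] by (simp split: if_splits)
    then have "(\<alpha> n * Re (green (of_real (x k)) (n + 1) m) + \<alpha> (n - 1) * Re (green (of_real (x k)) (n - 1) m)
        + \<beta> n * Re (green (of_real (x k)) n m)) * s k = (x k * Re (green (of_real (x k)) n m) + (if n = m then 1 else 0)) * s k"
      by simp
    then show ?thesis by (auto simp: f_def algebra_simps split: if_splits)
  qed
  have "\<bar>f k i\<bar> \<le> B" for k i using f0[of k "fst i" "snd i"] f_le[of k "fst i" "snd i"] by simp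
  then obtain r h where r: "strict_mono r" and h: "\<And>i. (\<lambda>k. f (r k) i) \<longlonglongrightarrow> h i"
    using pointwise_convergent_subsequence[of f "\<lambda>_. B"] by blast
  have h0: "h (n, m) \<ge> 0" for n m by (rule LIMSEQ_le_const[OF h]) (use f0 in auto)
  have hB: "h (n, m) \<le> B" for n m by (rule LIMSEQ_le_const2[OF h]) (use f_le in auto)
  have hd: "h (n, n) \<ge> 1 / B" for n by (rule LIMSEQ_le_const[OF h]) (use f_diag in auto)
  have hs: "h (n, m) = h (m, n)" for n m
    using LIMSEQ_unique[OF h[of "(n, m)"]] h[of "(m, n)"] f_sym[of _ n m] by simp
  have heq: "\<alpha> n * h (n + 1, m) + \<alpha> (n - 1) * h (n - 1, m) + \<beta> n * h (n, m) = hi * h (n, m)" for n m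
  proof -
    have xr: "(\<lambda>k. x (r k)) \<longlonglongrightarrow> hi" and sr: "(\<lambda>k. s (r k)) \<longlonglongrightarrow> 0"
      using LIMSEQ_subseq_LIMSEQ[OF xlim r] LIMSEQ_subseq_LIMSEQ[OF slim r] by (simp_all add: o_def)
    have "(\<lambda>k. \<alpha> n * f (r k) (n + 1, m) + \<alpha> (n - 1) * f (r k) (n - 1, m) + \<beta> n * f (r k) (n, m))
      \<longlonglongrightarrow> \<alpha> n * h (n + 1, m) + \<alpha> (n - 1) * h (n - 1, m) + \<beta> n * h (n, m)"
      by (intro tendsto_intros h)
    moreover have "(\<lambda>k. x (r k) * f (r k) (n, m) - (if n = m then s (r k) else 0)) \<longlonglongrightarrow> hi * h (n, m) - 0"
      by (cases "n = m") (auto intro!: tendsto_eq_intros xr sr h)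
    ultimately show ?thesis using f_eq LIMSEQ_unique by fastforce
  qed
  have hpos: "h (n, m) > 0" for n m
  proof (rule positive_of_nonneg_solution[of \<alpha> "\<lambda>n. h (n, m)" "\<lambda>n. hi - \<beta> n" m])
    show "h (m, m) \<noteq> 0" using hd[of m] B(1) by (smt (verit) divide_pos_pos)
    show "\<alpha> n * h (n + 1, m) + \<alpha> (n - 1) * h (n - 1, m) = (hi - \<beta> n) * h (n, m)" for n
      using heq[of n m] by (simp add: algebra_simps)
  qed (use \<alpha>_pos h0 in auto)
  have \<alpha>M: "\<alpha> n \<le> M" for n using \<alpha>_le[of n] by simp
  have low: "1 / B \<le> h (n, 0)" for n
  proof -
    have "h (n, 0) * h (0, n) = h (0, 0) * h (n, n)"
      by (rule bounded_positive_solutions_proportional[of \<alpha> M "\<lambda>k. h (k, 0)" B "\<lambda>k. h (k, n)" \<beta> hi])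
        (use \<alpha>_pos \<alpha>M hpos hB heq in auto)
    also have "\<dots> \<ge> 1 / B * (1 / B)" using hd B(1) by (intro mult_mono) (auto simp: less_imp_le hpos)
    finally have "(1 / B)\<^sup>2 \<le> (h (n, 0))\<^sup>2" using hs[of n 0] by (simp add: power2_eq_square)
    then show ?thesis using power2_le_imp_le h0 by blast
  qed
  show thesis
  proof (rule that[of "1 / B" "\<lambda>n. h (n, 0)"])
    show "h (n, 0) \<le> 1 / (1 / B)" for n using hB[of n 0] by simp
  qed (use B(1) low heq in auto)
qed

end

context finite_gap_green
begin

lemma regular_ground_state_tridiagonal:
  assumes "\<And>l. a l (l + 1) = \<alpha> l"
  shows "regular_ground_state a \<beta> hi"
proof -
  obtain u c where u: "c > 0" "\<And>n. c \<le> u n" "\<And>n. u n \<le> 1 / c"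
    "\<And>n. \<alpha> n * u (n + 1) + \<alpha> (n - 1) * u (n - 1) + \<beta> n * u n = hi * u n"
    using positive_bounded_solution by metis
  obtain d where d: "d > 0" "\<And>n. d \<le> \<alpha> n" using offdiag_lower_bound by blast
  define e where "e = min c (min d (1 / M))"
  have e: "e > 0" "e \<le> c" "e \<le> d" "e \<le> 1 / M" using u(1) d(1) M_pos by (auto simp: e_def)
  have ce: "1 / c \<le> 1 / e" using e u(1) by (intro divide_left_mono) auto
  have Me: "M \<le> 1 / e" using e M_pos by (simp add: field_simps)
  have "e \<le> u n \<and> u n \<le> 1 / e" "e \<le> \<alpha> n \<and> \<alpha> n \<le> 1 / e" for n
    using e ce Me u(2,3)[of n] d(2)[of n] \<alpha>_le[of n] by linarith+
  moreover have "a (n - 1) n = \<alpha> (n - 1)" for n using assms[of "n - 1"] by simp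
  ultimately show ?thesis
    unfolding regular_ground_state_def using e(1) u(4)
    by (intro exI[of _ u] exI[of _ e]) (auto simp: assms)
qed

text \<open>
  Conjugation by \<open>(-1)\<^sup>l\<close> turns the matrix with diagonal \<open>- \<beta>\<close> into the negative of the one with
  diagonal \<open>\<beta>\<close>.
\<close>

lemma reflected:
  assumes low: "{lo..lo + \<delta>} \<subseteq> e"
  shows "finite_gap_green \<alpha> (\<lambda>l. - \<beta> l) M (uminus ` e) (- hi) (- lo) \<delta>"
proof -
  define s where "s l = (if even l then 1 else -1 :: complex)" for l :: int
  have s: "cmod (s l) = 1" "s (l + 1) = - s l" "s (l - 1) = - s l" "s l * s l = 1" "cmod (- s l) = 1" for l
    by (auto simp: s_def)
  let ?T' = "tridiagonal \<alpha> (\<lambda>l. - \<beta> l)"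
  have conj: "shifted ?T' z \<phi> = (\<lambda>i. - s i * shifted T (- z) (\<lambda>i. s i * \<phi> i) i)" for z \<phi>
  proof
    fix i
    have ss: "s i * (s i * x) = x" for x using s(4)[of i] by (simp add: mult.assoc[symmetric])
    have "- s i * shifted T (- z) (\<lambda>i. s i * \<phi> i) i
      = s i * (s i * (of_real (\<alpha> i) * \<phi> (i + 1))) + s i * (s i * (of_real (\<alpha> (i - 1)) * \<phi> (i - 1)))
        - s i * (s i * (of_real (\<beta> i) * \<phi> i)) - s i * (s i * (z * \<phi> i))"
      unfolding shifted_def tridiagonal_def s(2,3) by (simp add: algebra_simps)
    then show "shifted ?T' z \<phi> i = - s i * shifted T (- z) (\<lambda>i. s i * \<phi> i) i"
      unfolding ss by (simp add: shifted_def tridiagonal_def)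
  qed
  have conj2: "shifted T z \<phi> = (\<lambda>i. - s i * shifted ?T' (- z) (\<lambda>i. s i * \<phi> i) i)" for z \<phi>
  proof -
    have ss: "s i * (s i * x) = x" for x i using s(4)[of i] by (simp add: mult.assoc[symmetric])
    show ?thesis unfolding conj by (simp add: ss)
  qed
  have spec1: "z \<notin> spectrum UNIV ?T'" if "- z \<notin> spec" for z
    by (rule spectrum_multiplier[OF s(5) s(1) conj that])
  have spec2: "z \<notin> spec" if "- z \<notin> spectrum UNIV ?T'" for z
    by (rule spectrum_multiplier[OF s(5) s(1) conj2 that])
  have spec_eq: "spectrum UNIV ?T' = complex_of_real ` (uminus ` e)"
  proof -
    have "z \<in> spectrum UNIV ?T' \<longleftrightarrow> - z \<in> spec" for z using spec1[of z] spec2[of "- z"] by auto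
    then have "spectrum UNIV ?T' = uminus ` spec" by (force simp: image_iff)
    then show ?thesis by (simp add: spec image_image)
  qed
  interpret N: bounded_tridiagonal \<alpha> "\<lambda>l. - \<beta> l" M
    by unfold_locales (use \<alpha>_le \<beta>_le M_pos in auto)
  have green': "N.green z n n = - green (- z) n n" if z: "- z \<notin> spec" for z n
  proof -
    have "N.res z (unit_seq n) = (\<lambda>i. - s i * s n * green (- z) i n)"
    proof (rule N.resolvent_unique[OF spec1[OF z]])
      have R: "res (- z) (unit_seq n) \<in> H" by (rule resolvent(1)[OF z unit_seq_ell2(1)])
      show "(\<lambda>i. - s i * s n * green (- z) i n) \<in> H"
        by (rule ell2_dominated(1)[OF R, of _ 1]) (auto simp: norm_mult s(1))
      have ss: "s i * (- s i * s n * x) = - s n * x" for i x using s(4)[of i] by (simp add: mult.assoc[symmetric])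
      have "shifted T (- z) (\<lambda>i. - s n * green (- z) i n) i = - s n * unit_seq n i" for i
        unfolding shifted_def T_linear resolvent_T[OF z unit_seq_ell2(1)] by (simp add: algebra_simps)
      then show "shifted N.T z (\<lambda>i. - s i * s n * green (- z) i n) = unit_seq n"
        unfolding conj ss using s(4) by (auto simp: unit_seq_def)
    qed
    then show ?thesis using s(4)[of n] by simp
  qed
  show ?thesis
  proof
    show "spectrum UNIV ?T' = complex_of_real ` (uminus ` e)" by (rule spec_eq)
    have "uminus ` e = uminus -` e" by (force simp: image_iff)
    moreover have "uminus -` e \<inter> space lborel \<in> sets lborel"
      by (rule measurable_sets[of uminus lborel lborel]) (use e_meas in auto)
    ultimately show "uminus ` e \<in> sets lborel" by simp
    show "uminus ` e \<subseteq> {- hi..- lo}" using e_sub by auto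
    show "{- lo - \<delta>..- lo} \<subseteq> uminus ` e"
    proof
      fix x assume "x \<in> {- lo - \<delta>..- lo}"
      then have "- x \<in> e" using low by auto
      then show "x \<in> uminus ` e" by force
    qed
    fix n
    let ?P = "\<lambda>x. x \<in> e \<longrightarrow> (\<exists>L. Re L = 0 \<and> ((\<lambda>\<epsilon>. green (Complex x \<epsilon>) n n) \<longlongrightarrow> L) (at_right 0))"
    \<comment> \<open>Reflection preserves Lebesgue measure, so the exceptional null set may be
      carried to \<open>- x\<close>.\<close>
    have "AE x in distr lborel borel uminus. ?P x" unfolding lborel_distr_uminus by (rule reflectionless)
    then have "AE x in lborel. ?P (- x)" by (rule AE_distrD[rotated]) simp
    then show "AE x in lborel. x \<in> uminus ` e \<longrightarrow>
      (\<exists>L. Re L = 0 \<and> ((\<lambda>\<epsilon>. N.green (Complex x \<epsilon>) n n) \<longlongrightarrow> L) (at_right 0))"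
    proof eventually_elim
      case (elim x)
      show ?case
      proof
        assume "x \<in> uminus ` e"
        then have "- x \<in> e" by auto
        then obtain L where L: "Re L = 0" "((\<lambda>\<epsilon>. green (Complex (- x) \<epsilon>) n n) \<longlongrightarrow> L) (at_right 0)" using elim by blast
        \<comment> \<open>The point \<open>- Complex x \<epsilon>\<close> lies in the lower
          half-plane; conjugation brings it back to where the limit is known and keeps the real part
          0.\<close>
        have "((\<lambda>\<epsilon>. - cnj (green (Complex (- x) \<epsilon>) n n)) \<longlongrightarrow> - cnj L) (at_right 0)"
          by (intro tendsto_intros L(2))
        then have "((\<lambda>\<epsilon>. N.green (Complex x \<epsilon>) n n) \<longlongrightarrow> - cnj L) (at_right 0)"
        proof (rule Lim_transform_eventually)
          show "\<forall>\<^sub>F \<epsilon> in at_right 0. - cnj (green (Complex (- x) \<epsilon>) n n) = N.green (Complex x \<epsilon>) n n"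
            using vertical_eventually[of x]
          proof eventually_elim
            case (elim \<epsilon>)
            have s: "Complex (- x) \<epsilon> \<notin> spec" "cnj (Complex (- x) \<epsilon>) \<notin> spec" "- Complex x \<epsilon> \<notin> spec"
              by (rule not_spec(1), use elim in simp)+
            have "cnj (Complex (- x) \<epsilon>) = - Complex x \<epsilon>" by (simp add: complex_eq_iff)
            then show ?case using green'[OF s(3), of n] green_cnj[OF s(1,2), of n n] by simp
          qed
        qed
        then show "\<exists>L. Re L = 0 \<and> ((\<lambda>\<epsilon>. N.green (Complex x \<epsilon>) n n) \<longlongrightarrow> L) (at_right 0)"
          using L(1) by (intro exI[of _ "- cnj L"]) simp
      qed
    qed
  qed (use \<alpha>_pos \<delta> in auto)
qed

end

lemma finite_gap_regular_ground_states:
  assumes "finite_gap_jacobi a b"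
  shows "\<exists>E. regular_ground_state a b E" "\<exists>E. regular_ground_state a (\<lambda>l. - b l) E"
proof -
  obtain e where fg: "finite_gap_set e" and jp: "jacobi_parameters a b"
    and sp: "spectrum UNIV (jacobi_op UNIV a b) = complex_of_real ` e" and rl: "reflectionless_on e a b"
    using assms by (auto simp: finite_gap_jacobi_def in_isospectral_torus_def)
  define \<alpha> where "\<alpha> l = a l (l + 1)" for l
  obtain M0 where M0: "\<And>l m. \<bar>l - m\<bar> = 1 \<Longrightarrow> \<bar>a l m\<bar> \<le> M0" "\<And>l. \<bar>b l\<bar> \<le> M0"
    and ab: "\<And>l m. \<bar>l - m\<bar> = 1 \<Longrightarrow> a l m = a m l \<and> a l m > 0"
    using jp by (auto simp: jacobi_parameters_def)
  define M where "M = \<bar>M0\<bar> + 1"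
  have J: "jacobi_op UNIV a b = tridiagonal \<alpha> b"
    unfolding \<alpha>_def by (rule jacobi_op_UNIV_eq_tridiagonal) (use ab in blast)
  interpret bounded_tridiagonal \<alpha> b M
  proof
    show "\<bar>\<alpha> l\<bar> \<le> M" for l using M0(1)[of l "l + 1"] by (simp add: \<alpha>_def M_def)
    show "\<bar>b l\<bar> \<le> M" for l using M0(2)[of l] by (simp add: M_def)
  qed (simp add: M_def)
  have spec: "spec = complex_of_real ` e" using sp J by simp
  obtain \<I> where \<I>: "finite \<I>" "\<And>I. I \<in> \<I> \<Longrightarrow> \<exists>x y. x < y \<and> I = {x..y}" "e = \<Union>\<I>"
    using fg by (auto simp: finite_gap_set_def)
  have comp: "compact e" unfolding \<I>(3) using \<I>(1,2) by (intro compact_Union) (metis compact_Icc)+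
  have ne: "e \<noteq> {}"
  proof -
    obtain E where "complex_of_real E \<in> spec" using form_sup_in_spectrum by blast
    then show ?thesis by (auto simp: spec)
  qed
  obtain hi where hi: "hi \<in> e" "\<And>x. x \<in> e \<Longrightarrow> x \<le> hi" using compact_attains_sup[OF comp ne] by blast
  obtain lo where lo: "lo \<in> e" "\<And>x. x \<in> e \<Longrightarrow> lo \<le> x" using compact_attains_inf[OF comp ne] by blast
  obtain x1 y1 where i1: "x1 < y1" "{x1..y1} \<in> \<I>" "hi \<in> {x1..y1}" using hi(1) \<I>(2,3) by (metis UnionE)
  obtain x2 y2 where i2: "x2 < y2" "{x2..y2} \<in> \<I>" "lo \<in> {x2..y2}" using lo(1) \<I>(2,3) by (metis UnionE)
  have subI: "{x1..y1} \<subseteq> e" "{x2..y2} \<subseteq> e" using i1(2) i2(2) by (auto simp: \<I>(3))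
  then have "y1 \<in> e" "x2 \<in> e" using i1(1) i2(1) by (simp_all add: subset_iff)
  then have eq: "y1 = hi" "x2 = lo" using hi(2)[of y1] lo(2)[of x2] i1(3) i2(3) by auto
  \<comment> \<open>The length of the shorter extreme band, so that one \<open>\<delta>\<close>
    serves both edges.\<close>
  define \<delta> where "\<delta> = min (y1 - x1) (y2 - x2)"
  have \<delta>: "\<delta> > 0" using i1 i2 by (simp add: \<delta>_def)
  have dle: "hi - \<delta> \<ge> x1" "lo + \<delta> \<le> y2" using eq by (auto simp: \<delta>_def)
  have right: "{hi - \<delta>..hi} \<subseteq> e" using dle(1) eq(1) by (intro order_trans[OF _ subI(1)]) auto
  have left: "{lo..lo + \<delta>} \<subseteq> e" using dle(2) eq(2) by (intro order_trans[OF _ subI(2)]) auto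
  interpret finite_gap_green \<alpha> b M e lo hi \<delta>
  proof
    show "\<alpha> l > 0" for l using ab[of l "l + 1"] by (simp add: \<alpha>_def)
    show "spec = complex_of_real ` e" by (rule spec)
    show "e \<in> sets lborel" using comp by (simp add: borel_compact)
    show "e \<subseteq> {lo..hi}" using hi lo by auto
    show "AE x in lborel. x \<in> e \<longrightarrow> (\<exists>L. Re L = 0 \<and> ((\<lambda>\<epsilon>. green (Complex x \<epsilon>) n n) \<longlongrightarrow> L) (at_right 0))" for n
      using rl unfolding reflectionless_on_def J ell2_inner_unit_left by blast
  qed (use \<delta> right in auto)
  show "\<exists>E. regular_ground_state a b E"
    using regular_ground_state_tridiagonal[of a] by (auto simp: \<alpha>_def)
  interpret R: finite_gap_green \<alpha> "\<lambda>l. - b l" M "uminus ` e" "- hi" "- lo" \<delta> by (rule reflected[OF left])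
  show "\<exists>E. regular_ground_state a (\<lambda>l. - b l) E"
    using R.regular_ground_state_tridiagonal[of a] by (auto simp: \<alpha>_def)
qed

lemma regular_ground_states:
  assumes "periodic_jacobi a b \<or> finite_gap_jacobi a b"
  obtains E E' where "regular_ground_state a b E" "regular_ground_state a (\<lambda>l. - b l) E'"
proof -
  have "periodic_jacobi a b \<Longrightarrow> periodic_jacobi a (\<lambda>l. - b l)"
    by (simp add: periodic_jacobi_def jacobi_parameters_def)
  then show thesis using assms that periodic_regular_ground_state finite_gap_regular_ground_states by metis
qed

section \<open>Eigenvalues outside the convex hull of the spectrum\<close>

text \<open>Since \<open>\<phi> 0 = 0\<close>, the coefficient \<open>c\<close> of the bond between
  0 and 1 is arbitrary. This lets site 1 obey the same three-term equation as the others.\<close>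

lemma jacobi_op_half_line:
  assumes "\<And>l. l \<ge> 1 \<Longrightarrow> a (l + 1) l = a l (l + 1)" "\<phi> 0 = 0" "l \<ge> 1"
  shows "jacobi_op {1..} a b \<phi> l
    = of_real (a l (l + 1)) * \<phi> (l + 1) + of_real (if l = 1 then c else a (l - 1) l) * \<phi> (l - 1) + of_real (b l) * \<phi> l"
proof (cases "l = 1")
  case True
  then have "{m. m \<in> {1..} \<and> \<bar>m - l\<bar> = 1} = {l + 1}" by auto
  then show ?thesis using True assms(2) by (simp add: jacobi_op_def)
next
  case False
  then have "{m. m \<in> {1..} \<and> \<bar>m - l\<bar> = 1} = {l + 1, l - 1}" using assms(3) by auto
  moreover have "a l (l - 1) = a (l - 1) l" using assms(1)[of "l - 1"] False assms(3) by simp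
  ultimately show ?thesis using False assms(3) by (simp add: jacobi_op_def)
qed

text \<open>Truncations of the solution to \<open>{1..N}\<close> have residuals bounded independently of \<open>N\<close>.\<close>

lemma bounded_solution_in_spectrum:
  fixes v :: "int \<Rightarrow> real"
  assumes c: "c > 0" and v: "\<And>n. c \<le> \<bar>v n\<bar>" "\<And>n. \<bar>v n\<bar> \<le> 1 / c" and a: "\<And>n. \<bar>a n (n + 1)\<bar> \<le> 1 / c"
    and sym: "\<And>n. a (n + 1) n = a n (n + 1)"
    and sol: "\<And>n. a n (n + 1) * v (n + 1) + a (n - 1) n * v (n - 1) + b n * v n = E * v n"
  shows "complex_of_real E \<in> spectrum {1..} (jacobi_op {1..} a b)"
proof (rule ccontr)
  let ?J = "jacobi_op {1..} a b"
  assume "complex_of_real E \<notin> spectrum {1..} ?J"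
  then obtain K where K: "\<And>\<phi>. \<phi> \<in> ell2 {1..} \<Longrightarrow> ell2_norm {1..} \<phi> \<le> K * ell2_norm {1..} (shifted ?J (of_real E) \<phi>)"
    by (auto simp: spectrum_def)
  \<comment> \<open>Each hopping term is at most \<open>1 / (c * c)\<close>, and the equation for
    \<open>v\<close> bounds \<open>(b n - E) * v n\<close> by two of them.\<close>
  define D where "D = 4 / (c * c)"
  have av: "\<bar>a n (n + 1) * v m\<bar> \<le> 1 / (c * c)" for n m
  proof -
    have "\<bar>a n (n + 1)\<bar> * \<bar>v m\<bar> \<le> 1 / c * (1 / c)" using a v(2) c by (intro mult_mono) auto
    then show ?thesis by (simp add: abs_mult)
  qed
  have av': "\<bar>a (n - 1) n * v m\<bar> \<le> 1 / (c * c)" for n m using av[of "n - 1" m] by simp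
  have D0: "D \<ge> 0" using c by (simp add: D_def)
  have bound: "real N * c\<^sup>2 \<le> K\<^sup>2 * (3 * D\<^sup>2)" for N
  proof -
    define \<phi> where "\<phi> n = (if 1 \<le> n \<and> n \<le> int N then complex_of_real (v n) else 0)" for n
    define w where "w n = (if 1 \<le> n \<and> n \<le> int N then v n else 0)" for n
    have \<phi>w: "\<phi> n = of_real (w n)" for n by (simp add: \<phi>_def w_def)
    define r where "r = shifted ?J (of_real E) \<phi>"
    have r: "r n = of_real (a n (n + 1) * w (n + 1) + (if n = 1 then 0 else a (n - 1) n) * w (n - 1) + (b n - E) * w n)"
      if "n \<ge> 1" for n
      unfolding r_def shifted_def using jacobi_op_half_line[of a \<phi> n b 0, OF sym _ that]
      by (simp add: \<phi>w w_def algebra_simps)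
    \<comment> \<open>The truncation fails to solve the equation only where a bond is cut: at 1, at
      \<open>N\<close>, and just outside at \<open>N + 1\<close>.\<close>
    have r0: "r n = 0" if "n \<notin> {1, int N, int N + 1}" for n
    proof (cases "n \<ge> 1")
      case True
      then have "1 < n \<and> n < int N \<or> n > int N + 1" using that by auto
      then consider "1 < n \<and> n < int N" | "n > int N + 1" by blast
      then show ?thesis
      proof cases
        case 1
        then show ?thesis using r[OF True] sol[of n] by (simp add: w_def algebra_simps flip: of_real_mult of_real_add)
      next
        case 2
        then show ?thesis using r[OF True] by (simp add: w_def)
      qed
    next
      case False
      then show ?thesis by (simp add: r_def shifted_def jacobi_op_def \<phi>_def)
    qed
    have r_le: "cmod (r n) \<le> D" if n: "n \<ge> 1" for n
    proof -
      have w_cases: "w m = 0 \<or> w m = v m" for m by (simp add: w_def)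
      have 0: "0 \<le> 1 / (c * c)" using c by simp
      have 1: "\<bar>a n (n + 1) * w (n + 1)\<bar> \<le> 1 / (c * c)" using av[of n "n + 1"] w_cases[of "n + 1"] 0 by auto
      have 2: "\<bar>(if n = 1 then 0 else a (n - 1) n) * w (n - 1)\<bar> \<le> 1 / (c * c)"
        using av'[of n "n - 1"] w_cases[of "n - 1"] 0 by auto
      have "(b n - E) * v n = - (a n (n + 1) * v (n + 1)) - a (n - 1) n * v (n - 1)" using sol[of n] by (simp add: algebra_simps)
      then have "\<bar>(b n - E) * v n\<bar> \<le> 2 / (c * c)" using av[of n "n + 1"] av'[of n "n - 1"] by simp
      then have 3: "\<bar>(b n - E) * w n\<bar> \<le> 2 / (c * c)" using w_cases[of n] 0 by auto
      have "\<bar>a n (n + 1) * w (n + 1) + (if n = 1 then 0 else a (n - 1) n) * w (n - 1) + (b n - E) * w n\<bar> \<le> D"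
        using 1 2 3 unfolding D_def by linarith
      then show ?thesis unfolding r[OF n] norm_of_real .
    qed
    have \<phi>_eq: "(\<Sum>\<^sub>\<infinity>n\<in>{1..}. (cmod (\<phi> n))\<^sup>2) = (\<Sum>n\<in>{1..int N}. (cmod (\<phi> n))\<^sup>2)"
      by (subst infsum_finite[symmetric], simp, rule infsum_cong_neutral) (auto simp: \<phi>_def)
    have "\<phi> \<in> ell2 {1..}"
    proof -
      have "(\<lambda>n. (cmod (\<phi> n))\<^sup>2) summable_on {1..} \<longleftrightarrow> (\<lambda>n. (cmod (\<phi> n))\<^sup>2) summable_on {1..int N}"
        by (rule summable_on_cong_neutral) (auto simp: \<phi>_def)
      then show ?thesis by (auto simp: ell2_def \<phi>_def)
    qed
    from K[OF this] have "(ell2_norm {1..} \<phi>)\<^sup>2 \<le> (K * ell2_norm {1..} r)\<^sup>2"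
      unfolding r_def[symmetric] by (intro power_mono) auto
    moreover have "real N * c\<^sup>2 \<le> (ell2_norm {1..} \<phi>)\<^sup>2"
    proof -
      have "(\<Sum>n\<in>{1..int N}. c\<^sup>2) \<le> (\<Sum>n\<in>{1..int N}. (cmod (\<phi> n))\<^sup>2)"
        using v(1) c by (intro sum_mono) (auto simp: \<phi>_def intro: power_mono abs_le_square_iff[THEN iffD1])
      then show ?thesis unfolding ell2_norm_power2 \<phi>_eq by simp
    qed
    moreover have "(ell2_norm {1..} r)\<^sup>2 \<le> 3 * D\<^sup>2"
    proof -
      have "(ell2_norm {1..} r)\<^sup>2 = (\<Sum>n\<in>{1, int N, int N + 1} \<inter> {1..}. (cmod (r n))\<^sup>2)"
        unfolding ell2_norm_power2
        by (subst infsum_finite[symmetric], simp, rule infsum_cong_neutral) (use r0 in auto)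
      also have "\<dots> \<le> (\<Sum>n\<in>{1, int N, int N + 1} \<inter> {1..}. D\<^sup>2)"
        using r_le by (intro sum_mono power_mono) auto
      also have "\<dots> \<le> 3 * D\<^sup>2"
      proof -
        have "card ({1, int N, int N + 1} \<inter> {1..}) \<le> card {1, int N, int N + 1}" by (intro card_mono) auto
        also have "\<dots> \<le> 3" by (simp add: card_insert_if)
        finally have "real (card ({1, int N, int N + 1} \<inter> {1..})) \<le> 3" by simp
        then show ?thesis by (simp add: mult_right_mono)
      qed
      finally show ?thesis .
    qed
    then have "(K * ell2_norm {1..} r)\<^sup>2 \<le> K\<^sup>2 * (3 * D\<^sup>2)"
      unfolding power_mult_distrib by (intro mult_left_mono) auto
    ultimately show ?thesis by linarith
  qed
  obtain N where "real N * c\<^sup>2 > K\<^sup>2 * (3 * D\<^sup>2)" using reals_Archimedean3[of "c\<^sup>2"] c by auto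
  with bound[of N] show False by linarith
qed

text \<open>These memberships supply what the theorem uses of the spectrum: its convex hull contains
  the segment between the two energies, and the distance of a point from it is at most the distance
  to either energy.\<close>

lemma regular_ground_state_in_spectrum:
  assumes "\<And>l m. \<bar>l - m\<bar> = 1 \<Longrightarrow> a l m = a m l"
  shows "regular_ground_state a b E \<Longrightarrow> complex_of_real E \<in> spectrum {1..} (jacobi_op {1..} a b)"
    and "regular_ground_state a (\<lambda>l. - b l) E \<Longrightarrow> complex_of_real (- E) \<in> spectrum {1..} (jacobi_op {1..} a b)"
proof -
  have sym: "a (n + 1) n = a n (n + 1)" for n using assms[of "n + 1" n] by simp
  show "complex_of_real E \<in> spectrum {1..} (jacobi_op {1..} a b)" if "regular_ground_state a b E"
  proof -
    from that obtain u c where u: "c > 0" "\<And>n. c \<le> u n \<and> u n \<le> 1 / c" "\<And>n. c \<le> a n (n + 1) \<and> a n (n + 1) \<le> 1 / c"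
      "\<And>n. a n (n + 1) * u (n + 1) + a (n - 1) n * u (n - 1) + b n * u n = E * u n"
      unfolding regular_ground_state_def by blast
    have u0: "u n \<ge> 0" for n using u(1) u(2)[of n] by linarith
    have a0: "a n (n + 1) \<ge> 0" for n using u(1) u(3)[of n] by linarith
    show ?thesis
      by (rule bounded_solution_in_spectrum[OF u(1), of u]) (use u u0 a0 sym in auto)
  qed
  show "complex_of_real (- E) \<in> spectrum {1..} (jacobi_op {1..} a b)" if "regular_ground_state a (\<lambda>l. - b l) E"
  proof -
    from that obtain u c where u: "c > 0" "\<And>n. c \<le> u n \<and> u n \<le> 1 / c" "\<And>n. c \<le> a n (n + 1) \<and> a n (n + 1) \<le> 1 / c"
      "\<And>n. a n (n + 1) * u (n + 1) + a (n - 1) n * u (n - 1) + - b n * u n = E * u n"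
      unfolding regular_ground_state_def by blast
    define v where "v n = (if even n then u n else - u n)" for n
    have u0: "u n \<ge> 0" for n using u(1) u(2)[of n] by linarith
    have a0: "a n (n + 1) \<ge> 0" for n using u(1) u(3)[of n] by linarith
    have "a n (n + 1) * v (n + 1) + a (n - 1) n * v (n - 1) + b n * v n = - E * v n" for n
      using u(4)[of n] by (cases "even n") (auto simp: v_def algebra_simps)
    then show ?thesis
      by (intro bounded_solution_in_spectrum[OF u(1), of v]) (use u u0 a0 sym in \<open>auto simp: v_def\<close>)
  qed
qed

section \<open>Eigenvectors of the half-line matrix and the one-sided bound\<close>

lemma half_line_eigenvector_sequence:
  fixes a :: "int \<Rightarrow> int \<Rightarrow> real" and b :: "int \<Rightarrow> real" and c :: real
  assumes sym: "\<And>l. l \<ge> 1 \<Longrightarrow> a (l + 1) l = a l (l + 1)" and "z \<in> eigenvalues {1..} (jacobi_op {1..} a b)"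
  defines "\<alpha> \<equiv> \<lambda>n. if n = 0 then c else a (int n) (int n + 1)" and "\<beta> \<equiv> \<lambda>n. b (int n)"
  obtains y :: "nat \<Rightarrow> complex" where "y 0 = 0" "summable (\<lambda>n. (cmod (y n))\<^sup>2)" "\<exists>n. y n \<noteq> 0"
    "\<And>n. n \<ge> 1 \<Longrightarrow> of_real (\<alpha> n) * y (Suc n) + of_real (\<alpha> (n - 1)) * y (n - 1) + of_real (\<beta> n) * y n = z * y n"
proof -
  obtain \<phi> where \<phi>: "\<phi> \<in> ell2 {1..}" "\<phi> \<noteq> (\<lambda>i. 0)" "jacobi_op {1..} a b \<phi> = (\<lambda>i. z * \<phi> i)"
    using assms(2) by (auto simp: eigenvalues_def)
  define y where "y n = \<phi> (int n)" for n
  have \<phi>0: "\<phi> i = 0" if "i < 1" for i using \<phi>(1) that by (simp add: ell2_def)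
  have y0: "y 0 = 0" using \<phi>0[of 0] by (simp add: y_def)
  have sq: "(\<lambda>i. (cmod (\<phi> i))\<^sup>2) summable_on {1..}" using \<phi>(1) by (simp add: ell2_def)
  have "summable (\<lambda>n. (cmod (y n))\<^sup>2)"
  proof (rule summableI_nonneg_bounded)
    fix N
    have "(\<Sum>n<N. (cmod (y n))\<^sup>2) = (\<Sum>n\<in>{1..<N}. (cmod (y n))\<^sup>2)"
      using y0 by (intro sum.mono_neutral_right) (auto simp: Suc_le_eq intro: ccontr)
    also have "\<dots> = (\<Sum>i\<in>int ` {1..<N}. (cmod (\<phi> i))\<^sup>2)" by (subst sum.reindex) (auto simp: y_def)
    also have "\<dots> \<le> (\<Sum>\<^sub>\<infinity>i\<in>{1..}. (cmod (\<phi> i))\<^sup>2)" by (rule finite_sum_le_infsum[OF sq]) auto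
    finally show "(\<Sum>n<N. (cmod (y n))\<^sup>2) \<le> (\<Sum>\<^sub>\<infinity>i\<in>{1..}. (cmod (\<phi> i))\<^sup>2)" .
  qed simp
  moreover have "\<exists>n. y n \<noteq> 0"
  proof -
    obtain i where i: "\<phi> i \<noteq> 0" using \<phi>(2) by auto
    then have "i \<ge> 1" using \<phi>0 by force
    then show ?thesis using i by (intro exI[of _ "nat i"]) (simp add: y_def)
  qed
  moreover have "of_real (\<alpha> n) * y (Suc n) + of_real (\<alpha> (n - 1)) * y (n - 1) + of_real (\<beta> n) * y n = z * y n"
    if n: "n \<ge> 1" for n
  proof -
    have 1: "int n \<ge> 1" using n by simp
    have "z * \<phi> (int n) = of_real (a (int n) (int n + 1)) * \<phi> (int n + 1)
      + of_real (if int n = 1 then c else a (int n - 1) (int n)) * \<phi> (int n - 1) + of_real (b (int n)) * \<phi> (int n)"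
      using jacobi_op_half_line[of a \<phi> "int n" b c, OF sym _ 1] \<phi>0[of 0] \<phi>(3) by simp
    moreover have "y (Suc n) = \<phi> (int n + 1)" by (simp add: y_def add.commute)
    moreover have "y (n - 1) = \<phi> (int n - 1)" using n by (simp add: y_def of_nat_diff)
    moreover have "\<alpha> (n - 1) = (if int n = 1 then c else a (int n - 1) (int n))"
      using n by (cases "n = 1") (auto simp: \<alpha>_def of_nat_diff)
    moreover have "\<alpha> n = a (int n) (int n + 1)" using n by (simp add: \<alpha>_def)
    ultimately show ?thesis by (simp only: \<beta>_def y_def)
  qed
  ultimately show thesis using that[of y] y0 by blast
qed

text \<open>The Wronskian of \<open>y\<close> with its conjugate: the partial sums of the squared
  moduli, multiplied by \<open>Im z\<close>, equal a boundary term that tends to 0.\<close>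

lemma half_line_eigenvalue_real:
  fixes \<alpha> \<beta> :: "nat \<Rightarrow> real" and y :: "nat \<Rightarrow> complex"
  assumes y0: "y 0 = 0" and sq: "summable (\<lambda>n. (cmod (y n))\<^sup>2)" and nz: "y m \<noteq> 0" and \<alpha>: "\<And>n. \<bar>\<alpha> n\<bar> \<le> B"
    and eq: "\<And>n. n \<ge> 1 \<Longrightarrow> of_real (\<alpha> n) * y (Suc n) + of_real (\<alpha> (n - 1)) * y (n - 1) + of_real (\<beta> n) * y n = z * y n"
  shows "Im z = 0"
proof -
  have partial: "Im z * (\<Sum>n\<in>{1..N}. (cmod (y n))\<^sup>2) = \<alpha> N * Im (cnj (y N) * y (Suc N))" for N
  proof (induction N)
    case 0
    then show ?case using y0 by simp
  next
    case (Suc N)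
    have "cnj (y (Suc N)) * (z * y (Suc N)) = cnj (y (Suc N)) *
      (of_real (\<alpha> (Suc N)) * y (Suc (Suc N)) + of_real (\<alpha> N) * y N + of_real (\<beta> (Suc N)) * y (Suc N))"
      using eq[of "Suc N"] by simp
    then have "Im (cnj (y (Suc N)) * (z * y (Suc N))) = Im (cnj (y (Suc N)) *
      (of_real (\<alpha> (Suc N)) * y (Suc (Suc N)) + of_real (\<alpha> N) * y N + of_real (\<beta> (Suc N)) * y (Suc N)))"
      by (rule arg_cong)
    moreover have "(cmod (y (Suc N)))\<^sup>2 = Re (y (Suc N)) * Re (y (Suc N)) + Im (y (Suc N)) * Im (y (Suc N))"
      unfolding cmod_power2 by (simp add: power2_eq_square)
    ultimately show ?case using Suc.IH by (simp add: algebra_simps)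
  qed
  have "(\<lambda>n. (cmod (y n))\<^sup>2) \<longlonglongrightarrow> 0" by (rule summable_LIMSEQ_zero[OF sq])
  then have "y \<longlonglongrightarrow> 0" by (simp add: power_tendsto_0_iff tendsto_norm_zero_iff)
  then have "(\<lambda>N. Im (cnj (y N) * y (Suc N))) \<longlonglongrightarrow> Im (cnj 0 * 0)" by (intro tendsto_intros LIMSEQ_Suc)
  then have "(\<lambda>N. Im z * (\<Sum>n\<in>{1..N}. (cmod (y n))\<^sup>2)) \<longlonglongrightarrow> 0"
    unfolding partial by (intro bounded_mult_tendsto_0[OF \<alpha>]) simp
  moreover have "(\<lambda>N. Im z * (\<Sum>n\<in>{1..N}. (cmod (y n))\<^sup>2)) \<longlonglongrightarrow> Im z * (\<Sum>n. (cmod (y n))\<^sup>2)"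
  proof -
    have "(\<lambda>N. \<Sum>n\<in>{1..N}. (cmod (y n))\<^sup>2) = (\<lambda>N. \<Sum>n<Suc N. (cmod (y n))\<^sup>2)"
      using y0 by (intro ext sum_atLeast1_eq_lessThan) simp
    then show ?thesis using LIMSEQ_Suc[OF summable_LIMSEQ[OF sq]] by (intro tendsto_intros) simp
  qed
  ultimately have "Im z * (\<Sum>n. (cmod (y n))\<^sup>2) = 0" by (rule LIMSEQ_unique[rotated])
  moreover have "(\<Sum>n. (cmod (y n))\<^sup>2) > 0" using nz by (intro suminf_pos2[OF sq, of m]) auto
  ultimately show ?thesis by simp
qed

text \<open>The coefficients and \<open>p\<close> are real, so the real and imaginary parts of
  \<open>y\<close> are solutions too; one that is nonzero at \<open>m\<close> is normalised.\<close>

lemma half_line_real_eigenvector: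
  fixes \<alpha> \<beta> :: "nat \<Rightarrow> real" and y :: "nat \<Rightarrow> complex"
  assumes y0: "y 0 = 0" and sq: "summable (\<lambda>n. (cmod (y n))\<^sup>2)" and nz: "y m \<noteq> 0"
    and eq: "\<And>n. n \<ge> 1 \<Longrightarrow> of_real (\<alpha> n) * y (Suc n) + of_real (\<alpha> (n - 1)) * y (n - 1) + of_real (\<beta> n) * y n = of_real p * y n"
  obtains x :: "nat \<Rightarrow> real" where "x 0 = 0" "(\<lambda>n. (x n)\<^sup>2) sums 1"
    "\<And>n. n \<ge> 1 \<Longrightarrow> \<alpha> n * x (Suc n) + \<alpha> (n - 1) * x (n - 1) + \<beta> n * x n = p * x n"
proof -
  have "\<exists>w :: nat \<Rightarrow> real. w 0 = 0 \<and> w m \<noteq> 0 \<and> (\<forall>n. \<bar>w n\<bar> \<le> cmod (y n)) \<and>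
    (\<forall>n\<ge>1. \<alpha> n * w (Suc n) + \<alpha> (n - 1) * w (n - 1) + \<beta> n * w n = p * w n)"
  proof (cases "Re (y m) = 0")
    case False
    then show ?thesis using y0 abs_Re_le_cmod arg_cong[OF eq, of _ Re]
      by (intro exI[of _ "\<lambda>n. Re (y n)"]) auto
  next
    case True
    then have "Im (y m) \<noteq> 0" using nz by (simp add: complex_eq_iff)
    then show ?thesis using y0 abs_Im_le_cmod arg_cong[OF eq, of _ Im]
      by (intro exI[of _ "\<lambda>n. Im (y n)"]) auto
  qed
  then obtain w :: "nat \<Rightarrow> real" where w: "w 0 = 0" "w m \<noteq> 0" "\<And>n. \<bar>w n\<bar> \<le> cmod (y n)"
    "\<And>n. n \<ge> 1 \<Longrightarrow> \<alpha> n * w (Suc n) + \<alpha> (n - 1) * w (n - 1) + \<beta> n * w n = p * w n" by blast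
  have wsq: "summable (\<lambda>n. (w n)\<^sup>2)"
    by (rule summable_comparison_test'[OF sq]) (use w(3) in \<open>auto intro!: abs_le_square_iff[THEN iffD1]\<close>)
  define s where "s = (\<Sum>n. (w n)\<^sup>2)"
  have s: "s > 0" unfolding s_def using w(2) by (intro suminf_pos2[OF wsq, of m]) auto
  show thesis
  proof (rule that[of "\<lambda>n. w n / sqrt s"])
    have "(\<lambda>n. (w n)\<^sup>2 / s) sums (s / s)" using wsq unfolding s_def by (intro sums_divide summable_sums)
    then show "(\<lambda>n. (w n / sqrt s)\<^sup>2) sums 1" using s by (simp add: power_divide)
    show "\<alpha> n * (w (Suc n) / sqrt s) + \<alpha> (n - 1) * (w (n - 1) / sqrt s) + \<beta> n * (w n / sqrt s) = p * (w n / sqrt s)"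
      if "n \<ge> 1" for n
    proof -
      have "\<alpha> n * (w (Suc n) / sqrt s) + \<alpha> (n - 1) * (w (n - 1) / sqrt s) + \<beta> n * (w n / sqrt s)
        = (\<alpha> n * w (Suc n) + \<alpha> (n - 1) * w (n - 1) + \<beta> n * w n) / sqrt s"
        by (simp add: add_divide_distrib)
      then show ?thesis unfolding w(4)[OF that] by simp
    qed
  qed (use w(1) in simp)
qed

text \<open>One-sided, so that it serves \<open>b0\<close> at the upper edge and \<open>- b0\<close>
  at the lower one. \<open>C\<close> precedes the perturbation, and finite sets of eigenvalues are
  what the final summability argument consumes.\<close>

definition eigenvalue_bound ::
    "(int \<Rightarrow> int \<Rightarrow> real) \<Rightarrow> (int \<Rightarrow> real) \<Rightarrow> real \<Rightarrow> real \<Rightarrow> bool" where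
  "eigenvalue_bound a0 b0 E C \<longleftrightarrow> (\<forall>\<delta>a \<delta>b.
    (\<forall>(l, m)\<in>half_line_bonds. \<delta>a l m = \<delta>a m l) \<longrightarrow>
    (\<lambda>(l, m). \<bar>\<delta>a l m\<bar>) summable_on half_line_bonds \<longrightarrow> (\<lambda>l. \<bar>\<delta>b l\<bar>) summable_on {1..} \<longrightarrow>
    (\<forall>z\<in>eigenvalues {1..} (jacobi_op {1..} (\<lambda>l m. a0 l m + \<delta>a l m) (\<lambda>l. b0 l + \<delta>b l)). Im z = 0) \<and>
    (\<forall>F. finite F \<longrightarrow> complex_of_real ` F \<subseteq> eigenvalues {1..} (jacobi_op {1..} (\<lambda>l m. a0 l m + \<delta>a l m) (\<lambda>l. b0 l + \<delta>b l)) \<longrightarrow>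
      (\<forall>p\<in>F. p > E) \<longrightarrow>
      (\<Sum>p\<in>F. sqrt (p - E)) \<le> C * ((\<Sum>\<^sub>\<infinity>(l, m)\<in>half_line_bonds. \<bar>\<delta>a l m\<bar>) + (\<Sum>\<^sub>\<infinity>l\<in>{1..}. \<bar>\<delta>b l\<bar>))))"

lemma eigenvalue_bound_above:
  assumes "regular_ground_state a0 b0 E" and sym0: "\<And>l m. \<bar>l - m\<bar> = 1 \<Longrightarrow> a0 l m = a0 m l"
  shows "\<exists>C. eigenvalue_bound a0 b0 E C"
proof -
  obtain u c where c: "c > 0" and u: "\<And>n. c \<le> u n" "\<And>n. u n \<le> 1 / c"
    and a: "\<And>n. c \<le> a0 n (n + 1)" "\<And>n. a0 n (n + 1) \<le> 1 / c"
    and sol: "\<And>n. a0 n (n + 1) * u (n + 1) + a0 (n - 1) n * u (n - 1) + b0 n * u n = E * u n"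
    using assms(1) unfolding regular_ground_state_def by blast
  define C0 where "C0 = 32 / (c ^ 3 * sqrt (c ^ 3))"
  have C0: "C0 \<ge> 0" using c by (simp add: C0_def)
  show ?thesis
    unfolding eigenvalue_bound_def
  proof (intro exI[of _ "2 * C0"] conjI allI impI)
    fix \<delta>a :: "int \<Rightarrow> int \<Rightarrow> real" and \<delta>b :: "int \<Rightarrow> real"
    assume sym: "\<forall>(l, m)\<in>half_line_bonds. \<delta>a l m = \<delta>a m l"
      and sa: "(\<lambda>(l, m). \<bar>\<delta>a l m\<bar>) summable_on half_line_bonds" and sb: "(\<lambda>l. \<bar>\<delta>b l\<bar>) summable_on {1..}"
    define A where "A = (\<Sum>\<^sub>\<infinity>(l, m)\<in>half_line_bonds. \<bar>\<delta>a l m\<bar>)"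
    define B where "B = (\<Sum>\<^sub>\<infinity>l\<in>{1..}. \<bar>\<delta>b l\<bar>)"
    define J where "J = jacobi_op {1..} (\<lambda>l m. a0 l m + \<delta>a l m) (\<lambda>l. b0 l + \<delta>b l)"
    have sym_int: "a0 (l + 1) l + \<delta>a (l + 1) l = a0 l (l + 1) + \<delta>a l (l + 1)" if "l \<ge> 1" for l
      using sym0[of "l + 1" l] bspec[OF sym, of "(l, l + 1)"] that by (simp add: half_line_bonds_def)
    \<comment> \<open>No bond of the half-line ends at 0, so the perturbation is set to 0 there. The
      unperturbed \<open>a' 0\<close> keeps its two-sided value and multiplies
      \<open>x 0 = 0\<close>.\<close>
    define da where "da n = (if n = 0 then 0 else \<delta>a (int n) (int n + 1))" for n :: nat
    define db where "db n = \<delta>b (int n)" for n :: nat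
    define a' where "a' n = a0 (int n) (int n + 1)" for n :: nat
    have dasum: "(\<Sum>n\<in>{1..N}. \<bar>da n\<bar>) \<le> A" for N
    proof -
      have "(\<Sum>n\<in>{1..N}. \<bar>da n\<bar>) = (\<Sum>p\<in>(\<lambda>n. (int n, int n + 1)) ` {1..N}. case p of (l, m) \<Rightarrow> \<bar>\<delta>a l m\<bar>)"
        by (subst sum.reindex) (auto simp: inj_on_def da_def)
      also have "\<dots> \<le> A" unfolding A_def
        by (rule finite_sum_le_infsum[OF sa]) (auto simp: half_line_bonds_def)
      finally show ?thesis .
    qed
    have dasum': "(\<Sum>n\<in>{1..N}. \<bar>da (n - 1)\<bar>) \<le> A" for N
    proof (cases N)
      case 0
      then show ?thesis using dasum[of 0] by simp
    next
      case (Suc k)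
      have "(\<Sum>n\<in>{1..Suc k}. \<bar>da (n - 1)\<bar>) = (\<Sum>n\<in>{0..k}. \<bar>da n\<bar>)"
        by (rule sum.reindex_bij_witness[of _ Suc "\<lambda>n. n - 1"]) auto
      also have "\<dots> = (\<Sum>n\<in>{1..k}. \<bar>da n\<bar>)"
        by (rule sum.mono_neutral_right) (auto simp: da_def)
      finally show ?thesis using dasum[of k] Suc by simp
    qed
    have dbsum: "(\<Sum>n\<in>{1..N}. \<bar>db n\<bar>) \<le> B" for N
    proof -
      have "(\<Sum>n\<in>{1..N}. \<bar>db n\<bar>) = (\<Sum>l\<in>int ` {1..N}. \<bar>\<delta>b l\<bar>)" by (subst sum.reindex) (auto simp: db_def)
      also have "\<dots> \<le> B" unfolding B_def by (rule finite_sum_le_infsum[OF sb]) auto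
      finally show ?thesis .
    qed
    have B0: "B \<ge> 0" using dbsum[of 0] by simp
    have A0: "A \<ge> 0" using dasum[of 0] by simp
    \<comment> \<open>A bond enters the rows of both its ends, which is why \<open>A\<close> counts
      twice.\<close>
    have mass: "(\<Sum>n\<in>{1..N}. \<bar>da n\<bar> + \<bar>da (n - 1)\<bar> + \<bar>db n\<bar>) \<le> 2 * (A + B)" for N
      using dasum[of N] dasum'[of N] dbsum[of N] B0 by (simp add: sum.distrib)
    have da_le: "\<bar>da n\<bar> \<le> A" for n
    proof (cases "n = 0")
      case False
      then have "\<bar>da n\<bar> \<le> (\<Sum>n\<in>{1..n}. \<bar>da n\<bar>)" by (intro member_le_sum) auto
      then show ?thesis using dasum[of n] by simp
    qed (use A0 in \<open>simp add: da_def\<close>)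
    have \<alpha>_le: "\<bar>a' n + da n\<bar> \<le> 1 / c + A" for n
      using a[of "int n"] c da_le[of n] unfolding a'_def by linarith
    have coeff: "(if n = 0 then a' 0 else a0 (int n) (int n + 1) + \<delta>a (int n) (int n + 1)) = a' n + da n" for n
      by (simp add: a'_def da_def)
    have ev: "Im z = 0 \<and> (\<exists>x :: nat \<Rightarrow> real. x 0 = 0 \<and> (\<lambda>n. (x n)\<^sup>2) sums 1 \<and> (\<forall>n\<ge>1.
        (a' n + da n) * x (Suc n) + (a' (n - 1) + da (n - 1)) * x (n - 1) + (b0 (int n) + db n) * x n = Re z * x n))"
      if z_ev: "z \<in> eigenvalues {1..} J" for z
    proof -
      obtain y where y: "y 0 = 0" "summable (\<lambda>n. (cmod (y n))\<^sup>2)" "\<exists>n. y n \<noteq> 0"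
        "\<And>n. n \<ge> 1 \<Longrightarrow> of_real (a' n + da n) * y (Suc n) + of_real (a' (n - 1) + da (n - 1)) * y (n - 1)
          + of_real (b0 (int n) + db n) * y n = z * y n"
        using half_line_eigenvector_sequence[OF sym_int z_ev[unfolded J_def], where c = "a' 0"]
        unfolding coeff db_def by blast
      then obtain m where m: "y m \<noteq> 0" by blast
      have Im0: "Im z = 0" by (rule half_line_eigenvalue_real[OF y(1,2) m \<alpha>_le y(4)])
      then have z: "of_real (Re z) = z" by (simp add: complex_eq_iff)
      obtain x where "x 0 = 0" "(\<lambda>n. (x n)\<^sup>2) sums 1"
        "\<And>n. n \<ge> 1 \<Longrightarrow> (a' n + da n) * x (Suc n) + (a' (n - 1) + da (n - 1)) * x (n - 1) + (b0 (int n) + db n) * x n = Re z * x n"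
        using half_line_real_eigenvector[OF y(1,2) m, of "\<lambda>n. a' n + da n" "\<lambda>n. b0 (int n) + db n" "Re z"] y(4) unfolding z by blast
      then show ?thesis using Im0 by blast
    qed
    show "\<forall>z\<in>eigenvalues {1..} (jacobi_op {1..} (\<lambda>l m. a0 l m + \<delta>a l m) (\<lambda>l. b0 l + \<delta>b l)). Im z = 0"
      using ev unfolding J_def by blast
    fix F :: "real set"
    assume F: "finite F" "complex_of_real ` F \<subseteq> eigenvalues {1..} (jacobi_op {1..} (\<lambda>l m. a0 l m + \<delta>a l m) (\<lambda>l. b0 l + \<delta>b l))"
      "\<forall>p\<in>F. p > E"
    obtain h where h: "bij_betw h {0..<card F} F" using ex_bij_betw_nat_finite[OF F(1)] by blast
    define K where "K = card F"
    have hF: "h k \<in> F" if "k < K" for k using h that by (auto simp: bij_betw_def K_def)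
    have "\<exists>x :: nat \<Rightarrow> real. x 0 = 0 \<and> (\<lambda>n. (x n)\<^sup>2) sums 1 \<and> (\<forall>n\<ge>1.
        (a' n + da n) * x (Suc n) + (a' (n - 1) + da (n - 1)) * x (n - 1) + (b0 (int n) + db n) * x n = h k * x n)"
      if "k < K" for k
      using ev[of "of_real (h k)"] hF[OF that] F(2) by (auto simp: J_def)
    then obtain x where x: "\<And>k. k < K \<Longrightarrow> x k 0 = 0" "\<And>k. k < K \<Longrightarrow> (\<lambda>n. (x k n)\<^sup>2) sums 1"
      "\<And>k n. k < K \<Longrightarrow> n \<ge> 1 \<Longrightarrow> (a' n + da n) * x k (Suc n) + (a' (n - 1) + da (n - 1)) * x k (n - 1)
        + (b0 (int n) + db n) * x k n = (h k :: real) * x k n"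
      by metis
    \<comment> \<open>The mass bound must be positive; adding \<open>\<eta>\<close> includes the
      zero perturbation, and \<open>\<eta>\<close> is removed afterwards.\<close>
    have core: "(\<Sum>k<K. sqrt (h k - E)) \<le> C0 * (2 * (A + B) + \<eta>)" if \<eta>: "\<eta> > 0" for \<eta>
      unfolding C0_def
    proof (rule lieb_thirring_half_line[where u = "\<lambda>n. u (int n)" and a = a' and b = "\<lambda>n. b0 (int n)" and E = E and da = da and db = db and x = x])
      show "(\<Sum>n\<in>{1..N}. \<bar>da n\<bar> + \<bar>da (n - 1)\<bar> + \<bar>db n\<bar>) \<le> 2 * (A + B) + \<eta>" for N using mass[of N] \<eta> by simp
      show "a' n * u (int (Suc n)) + a' (n - 1) * u (int (n - 1)) + b0 (int n) * u (int n) = E * u (int n)"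
        if "n \<ge> 1" for n
        using sol[of "int n"] that by (simp add: a'_def of_nat_diff add.commute)
      show "inj_on (\<lambda>k. h k - E) {..<K}" using h by (auto simp: bij_betw_def inj_on_def K_def)
      show "h k - E > 0" if "k < K" for k using hF[OF that] F(3) by auto
      show "(a' n + da n) * x k (Suc n) + (a' (n - 1) + da (n - 1)) * x k (n - 1) + (b0 (int n) + db n) * x k n
        = (E + (h k - E)) * x k n" if "k < K" "n \<ge> 1" for k n using x(3)[OF that] by simp
      show "c \<le> a' n" "a' n \<le> 1 / c" for n using a by (simp_all add: a'_def)
      show "da 0 = 0" by (simp add: da_def)
      show "2 * (A + B) + \<eta> > 0" using A0 B0 \<eta> by simp
      show "c > 0" by (rule c)
      show "c \<le> u (int n)" "u (int n) \<le> 1 / c" for n by (rule u)+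
      show "x k 0 = 0" "(\<lambda>n. (x k n)\<^sup>2) sums 1" if "k < K" for k using x(1,2)[OF that] by blast+
    qed
    have "(\<Sum>k<K. sqrt (h k - E)) \<le> 2 * C0 * (A + B)"
    proof (rule field_le_epsilon)
      fix \<epsilon> :: real assume \<epsilon>: "\<epsilon> > 0"
      have "C0 * (\<epsilon> / (C0 + 1)) \<le> \<epsilon>" using C0 \<epsilon> by (simp add: pos_divide_le_eq)
      moreover have "(\<Sum>k<K. sqrt (h k - E)) \<le> C0 * (2 * (A + B) + \<epsilon> / (C0 + 1))"
        using C0 \<epsilon> by (intro core) simp
      ultimately show "(\<Sum>k<K. sqrt (h k - E)) \<le> 2 * C0 * (A + B) + \<epsilon>"
        by (simp add: distrib_left)
    qed
    also have "(\<Sum>k<K. sqrt (h k - E)) = (\<Sum>p\<in>F. sqrt (p - E))"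
      using sum.reindex_bij_betw[OF h, of "\<lambda>p. sqrt (p - E)"] by (simp add: K_def atLeast0LessThan)
    finally show "(\<Sum>p\<in>F. sqrt (p - E)) \<le> 2 * C0 * ((\<Sum>\<^sub>\<infinity>(l, m)\<in>half_line_bonds. \<bar>\<delta>a l m\<bar>) + (\<Sum>\<^sub>\<infinity>l\<in>{1..}. \<bar>\<delta>b l\<bar>))"
      by (simp add: A_def B_def)
  qed
qed

text \<open>Alternating the signs of an eigenvector negates the hopping terms relative to it, and
  passing to \<open>- b\<close> negates the diagonal ones.\<close>

lemma eigenvalues_reflected:
  assumes "z \<in> eigenvalues {1..} (jacobi_op {1..} a b)"
  shows "- z \<in> eigenvalues {1..} (jacobi_op {1..} a (\<lambda>l. - b l))"
proof -
  obtain \<phi> where \<phi>: "\<phi> \<in> ell2 {1..}" "\<phi> \<noteq> (\<lambda>i. 0)" "jacobi_op {1..} a b \<phi> = (\<lambda>i. z * \<phi> i)"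
    using assms by (auto simp: eigenvalues_def)
  define s where "s l = (if even l then 1 else -1 :: complex)" for l :: int
  have s: "cmod (s l) = 1" "s l \<noteq> 0" for l by (auto simp: s_def)
  have sn: "s m = - s l" if "\<bar>m - l\<bar> = 1" for l m
  proof -
    have "m = l + 1 \<or> m = l - 1" using that by auto
    then show ?thesis by (auto simp: s_def)
  qed
  define \<psi> where "\<psi> l = s l * \<phi> l" for l
  have "\<psi> \<in> ell2 {1..}" using \<phi>(1) by (simp add: ell2_def \<psi>_def norm_mult s)
  moreover have "\<psi> \<noteq> (\<lambda>i. 0)" using \<phi>(2) s by (auto simp: \<psi>_def fun_eq_iff)
  moreover have "jacobi_op {1..} a (\<lambda>l. - b l) \<psi> = (\<lambda>i. - z * \<psi> i)"
  proof
    fix l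
    show "jacobi_op {1..} a (\<lambda>l. - b l) \<psi> l = - z * \<psi> l"
    proof (cases "l \<in> {1..}")
      case True
      have "(\<Sum>m | m \<in> {1..} \<and> \<bar>m - l\<bar> = 1. of_real (a l m) * \<psi> m)
        = (\<Sum>m | m \<in> {1..} \<and> \<bar>m - l\<bar> = 1. - s l * (of_real (a l m) * \<phi> m))"
        by (intro sum.cong refl) (auto simp: \<psi>_def sn)
      also have "\<dots> = - s l * (\<Sum>m | m \<in> {1..} \<and> \<bar>m - l\<bar> = 1. of_real (a l m) * \<phi> m)"
        by (rule sum_distrib_left[symmetric])
      finally have "jacobi_op {1..} a (\<lambda>l. - b l) \<psi> l = - s l * jacobi_op {1..} a b \<phi> l"
        using True by (simp add: jacobi_op_def \<psi>_def algebra_simps)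
      then show ?thesis by (simp add: \<phi>(3) \<psi>_def)
    next
      case False
      then have "\<phi> l = 0" using \<phi>(1) by (simp add: ell2_def)
      then show ?thesis using False by (simp add: jacobi_op_def \<psi>_def)
    qed
  qed
  ultimately show ?thesis unfolding eigenvalues_def by blast
qed

theorem corollary4p4:
  fixes a0 :: "int \<Rightarrow> int \<Rightarrow> real" and b0 :: "int \<Rightarrow> real"
    and J0 :: "(int \<Rightarrow> complex) \<Rightarrow> (int \<Rightarrow> complex)"
  assumes "periodic_jacobi a0 b0 \<or> finite_gap_jacobi a0 b0"
    and "J0 = jacobi_op {1..} a0 b0"
  shows "\<exists>C::real. \<forall>(\<delta>a :: int \<Rightarrow> int \<Rightarrow> real) (\<delta>b :: int \<Rightarrow> real) J.
    (\<forall>(l, m)\<in>half_line_bonds. \<delta>a l m = \<delta>a m l \<and> a0 l m + \<delta>a l m > 0) \<longrightarrow>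
    (\<lambda>(l, m). \<bar>\<delta>a l m\<bar>) summable_on half_line_bonds \<longrightarrow>
    (\<lambda>l. \<bar>\<delta>b l\<bar>) summable_on {1..} \<longrightarrow>
    J = jacobi_op {1..} (\<lambda>l m. a0 l m + \<delta>a l m) (\<lambda>l. b0 l + \<delta>b l) \<longrightarrow>
    (\<lambda>E. sqrt (infdist E (spectrum {1..} J0))) summable_on outer_eigenvalues J0 J \<and>
    (\<Sum>\<^sub>\<infinity>E\<in>outer_eigenvalues J0 J. sqrt (infdist E (spectrum {1..} J0)))
      \<le> C * ((\<Sum>\<^sub>\<infinity>(l, m)\<in>half_line_bonds. \<bar>\<delta>a l m\<bar>) + (\<Sum>\<^sub>\<infinity>l\<in>{1..}. \<bar>\<delta>b l\<bar>))"
proof -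
  have sym0: "a0 l m = a0 m l" if "\<bar>l - m\<bar> = 1" for l m
    using assms(1) that unfolding periodic_jacobi_def finite_gap_jacobi_def in_isospectral_torus_def jacobi_parameters_def
    by blast
  obtain E1 E2 where gs: "regular_ground_state a0 b0 E1" "regular_ground_state a0 (\<lambda>l. - b0 l) E2"
    using regular_ground_states[OF assms(1)] by blast
  define \<sigma> where "\<sigma> = spectrum {1..} J0"
  have E: "complex_of_real E1 \<in> \<sigma>" "complex_of_real (- E2) \<in> \<sigma>"
    unfolding \<sigma>_def assms(2) using regular_ground_state_in_spectrum[OF sym0] gs by auto
  obtain C1 C2 where C: "eigenvalue_bound a0 b0 E1 C1" "eigenvalue_bound a0 (\<lambda>l. - b0 l) E2 C2"
    using eigenvalue_bound_above[OF _ sym0] gs by meson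
  show ?thesis
  proof (intro exI[of _ "C1 + C2"] allI impI)
    fix \<delta>a :: "int \<Rightarrow> int \<Rightarrow> real" and \<delta>b :: "int \<Rightarrow> real" and J
    assume bonds: "\<forall>(l, m)\<in>half_line_bonds. \<delta>a l m = \<delta>a m l \<and> a0 l m + \<delta>a l m > 0"
      and sa: "(\<lambda>(l, m). \<bar>\<delta>a l m\<bar>) summable_on half_line_bonds" and sb: "(\<lambda>l. \<bar>\<delta>b l\<bar>) summable_on {1..}"
      and J: "J = jacobi_op {1..} (\<lambda>l m. a0 l m + \<delta>a l m) (\<lambda>l. b0 l + \<delta>b l)"
    define S where "S = (\<Sum>\<^sub>\<infinity>(l, m)\<in>half_line_bonds. \<bar>\<delta>a l m\<bar>) + (\<Sum>\<^sub>\<infinity>l\<in>{1..}. \<bar>\<delta>b l\<bar>)"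
    have sym: "\<forall>(l, m)\<in>half_line_bonds. \<delta>a l m = \<delta>a m l" using bonds by auto
    have up': "\<forall>z\<in>eigenvalues {1..} J. Im z = 0" "finite F \<Longrightarrow> complex_of_real ` F \<subseteq> eigenvalues {1..} J \<Longrightarrow>
        (\<forall>p\<in>F. p > E1) \<Longrightarrow> (\<Sum>p\<in>F. sqrt (p - E1)) \<le> C1 * S" for F
      using C(1) sym sa sb unfolding eigenvalue_bound_def J S_def by blast+
    define J' where "J' = jacobi_op {1..} (\<lambda>l m. a0 l m + \<delta>a l m) (\<lambda>l. - b0 l + - \<delta>b l)"
    have sb': "(\<lambda>l. \<bar>- \<delta>b l\<bar>) summable_on {1..}" using sb by simp
    have dn': "finite F \<Longrightarrow> complex_of_real ` F \<subseteq> eigenvalues {1..} J' \<Longrightarrow> (\<forall>p\<in>F. p > E2) \<Longrightarrow> (\<Sum>p\<in>F. sqrt (p - E2)) \<le> C2 * S"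
      for F using C(2)[unfolded eigenvalue_bound_def, THEN spec, THEN spec, THEN mp, THEN mp, THEN mp, OF sym sa sb']
      unfolding S_def J'_def by simp
    have refl: "- z \<in> eigenvalues {1..} J'" if "z \<in> eigenvalues {1..} J" for z
      using eigenvalues_reflected[OF that[unfolded J]] by (simp add: J'_def)
    define d where "d z = sqrt (infdist z \<sigma>)" for z
    have outer: "z = of_real (Re z)" "z \<in> eigenvalues {1..} J" "Re z > E1 \<or> - Re z > E2"
      if "z \<in> outer_eigenvalues J0 J" for z
    proof -
      show ev: "z \<in> eigenvalues {1..} J" using that by (simp add: outer_eigenvalues_def)
      then have Im0: "Im z = 0" using up'(1) by blast
      then show z: "z = of_real (Re z)" by (simp add: complex_eq_iff)
      \<comment> \<open>Otherwise \<open>z\<close> lies on the segment from \<open>- E2\<close> to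
        \<open>E1\<close>, whose ends are in the spectrum.\<close>
      show "Re z > E1 \<or> - Re z > E2"
      proof (rule ccontr)
        assume "\<not> (Re z > E1 \<or> - Re z > E2)"
        then have le: "- E2 \<le> Re z" "Re z \<le> E1" by auto
        have "complex_of_real (Re z) \<in> closed_segment (complex_of_real (- E2)) (complex_of_real E1)"
          using le by (simp add: closed_segment_same_Im closed_segment_eq_real_ivl)
        also have "\<dots> \<subseteq> convex hull \<sigma>"
          using E by (simp add: segment_convex_hull hull_mono)
        finally have "z \<in> convex hull \<sigma>" by (simp only: z[symmetric])
        then show False using that by (simp add: outer_eigenvalues_def \<sigma>_def)
      qed
    qed
    have d1: "d (of_real p) \<le> sqrt (p - E1)" if "p > E1" for p
    proof -
      have "infdist (complex_of_real p) \<sigma> \<le> dist (complex_of_real p) (complex_of_real E1)" by (rule infdist_le[OF E(1)])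
      also have "\<dots> = p - E1" using that by (simp add: dist_norm flip: of_real_diff)
      finally show ?thesis by (simp add: d_def)
    qed
    have d2: "d (of_real (- p)) \<le> sqrt (p - E2)" if "p > E2" for p
    proof -
      have "infdist (complex_of_real (- p)) \<sigma> \<le> dist (complex_of_real (- p)) (complex_of_real (- E2))" by (rule infdist_le[OF E(2)])
      also have "\<dots> = \<bar>E2 - p\<bar>" unfolding dist_norm of_real_diff[symmetric] norm_of_real by simp
      also have "\<dots> = p - E2" using that by simp
      finally show ?thesis by (simp add: d_def)
    qed
    have fin: "(\<Sum>z\<in>F. d z) \<le> (C1 + C2) * S" if F: "finite F" "F \<subseteq> outer_eigenvalues J0 J" for F
    proof -
      \<comment> \<open>Splitting at \<open>E1\<close> counts every eigenvalue once. By
        \<open>outer\<close>, those not above \<open>E1\<close> lie below \<open>- E2\<close>, and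
        reflection moves them above \<open>E2\<close>.\<close>
      define F1 where "F1 = {z \<in> F. Re z > E1}"
      define F2 where "F2 = {z \<in> F. \<not> Re z > E1}"
      have Im_F: "Im z = 0" if "z \<in> F" for z
        using outer(2)[of z] up'(1) F(2) that by blast
      have fin12: "finite F1" "finite F2" using F(1) by (auto simp: F1_def F2_def)
      have inj: "inj_on Re F1" "inj_on (\<lambda>z. - Re z) F2"
        by (intro inj_onI complex_eqI; use Im_F in \<open>simp add: F1_def F2_def\<close>)+
      have "(\<Sum>z\<in>F1. d z) \<le> (\<Sum>z\<in>F1. sqrt (Re z - E1))"
      proof (intro sum_mono)
        fix z assume "z \<in> F1"
        then have "z = of_real (Re z)" "Re z > E1" using outer(1) F(2) by (auto simp: F1_def)
        then show "d z \<le> sqrt (Re z - E1)" using d1[of "Re z"] by simp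
      qed
      also have "\<dots> = (\<Sum>p\<in>Re ` F1. sqrt (p - E1))" by (simp add: sum.reindex[OF inj(1)])
      also have "\<dots> \<le> C1 * S"
      proof -
        have "complex_of_real ` Re ` F1 \<subseteq> eigenvalues {1..} J"
        proof (clarify)
          fix z assume "z \<in> F1"
          then show "complex_of_real (Re z) \<in> eigenvalues {1..} J"
            using outer(1,2)[of z] F(2) by (auto simp: F1_def)
        qed
        then show ?thesis using up'(2) fin12(1) by (auto simp: F1_def)
      qed
      finally have 1: "(\<Sum>z\<in>F1. d z) \<le> C1 * S" .
      have neg: "- Re z > E2" "z = of_real (Re z)" "z \<in> eigenvalues {1..} J" if "z \<in> F2" for z
        using outer[of z] F(2) that by (auto simp: F2_def)
      have "(\<Sum>z\<in>F2. d z) \<le> (\<Sum>z\<in>F2. sqrt (- Re z - E2))"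
      proof (intro sum_mono)
        fix z assume "z \<in> F2"
        then show "d z \<le> sqrt (- Re z - E2)" using d2[of "- Re z"] neg[of z] by simp
      qed
      also have "\<dots> = (\<Sum>p\<in>(\<lambda>z. - Re z) ` F2. sqrt (p - E2))" by (simp add: sum.reindex[OF inj(2)])
      also have "\<dots> \<le> C2 * S"
      proof (rule dn')
        show "complex_of_real ` (\<lambda>z. - Re z) ` F2 \<subseteq> eigenvalues {1..} J'"
        proof (clarify)
          fix z assume "z \<in> F2"
          then have "- z \<in> eigenvalues {1..} J'" "- z = complex_of_real (- Re z)"
            using refl neg[of z] by (auto simp: complex_eq_iff)
          then show "complex_of_real (- Re z) \<in> eigenvalues {1..} J'" by simp
        qed
      qed (use fin12 neg in auto)
      finally have 2: "(\<Sum>z\<in>F2. d z) \<le> C2 * S" .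
      have "(\<Sum>z\<in>F. d z) = (\<Sum>z\<in>F1. d z) + (\<Sum>z\<in>F2. d z)"
        using F(1) unfolding F1_def F2_def by (subst sum.union_disjoint[symmetric]) (auto intro: sum.cong)
      then show ?thesis using 1 2 by (simp add: distrib_right)
    qed
    have summ: "d summable_on outer_eigenvalues J0 J"
    proof (rule nonneg_bounded_partial_sums_imp_summable_on[of _ _ "(C1 + C2) * S"])
      show "\<forall>\<^sub>F F in finite_subsets_at_top (outer_eigenvalues J0 J). sum d F \<le> (C1 + C2) * S"
        by (rule eventually_finite_subsets_at_top_weakI) (rule fin)
    qed (simp add: d_def infdist_nonneg)
    moreover have "(\<Sum>\<^sub>\<infinity>z\<in>outer_eigenvalues J0 J. d z) \<le> (C1 + C2) * S"
      by (rule infsum_le_finite_sums[OF summ]) (rule fin)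
    ultimately show "(\<lambda>E. sqrt (infdist E (spectrum {1..} J0))) summable_on outer_eigenvalues J0 J \<and>
      (\<Sum>\<^sub>\<infinity>E\<in>outer_eigenvalues J0 J. sqrt (infdist E (spectrum {1..} J0)))
      \<le> (C1 + C2) * ((\<Sum>\<^sub>\<infinity>(l, m)\<in>half_line_bonds. \<bar>\<delta>a l m\<bar>) + (\<Sum>\<^sub>\<infinity>l\<in>{1..}. \<bar>\<delta>b l\<bar>))"
      by (simp add: d_def[abs_def] \<sigma>_def S_def)
  qed
qed

end
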